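(* The problem \textsc{Adapt Weakly SM with Ties to Forced and Forbidden Pairs}, restricted to instances where only agents from one side of the bipartition have ties in their preferences, is W[1]-hard when parameterized by the number of ties plus $k$. This holds even when restricted to instances with $|Q|=1$ and $P=\emptyset$, and also even when restricted to instances with $Q=\emptyset$ and $|P|=1$.
   Context: Stable Marriage (SM) with Ties: the agents are partitioned into a set $U$ of men and a set $W$ of women; each man $u$ has a set $\mathrm{Ac}(u)\subseteq W$ and each woman $w$ a set $\mathrm{Ac}(w)\subseteq U$ of acceptable agents, acceptability is symmetric, and each agent $a$ has a weak order $\succsim_a$ over $\mathrm{Ac}(a)$; $a$ strictly prefers $a'$ to $a''$ if $a'\succsim_a a''$ but not $a''\succsim_a a'$, and is indifferent if both $a'\succsim_a a''$ and $a''\succsim_a a'$. A tie is a maximal set of at least two agents between which some agent is indifferent in its preferences; the number of ties is counted over all agents. A matching is a set of pairs of mutually acceptable agents such that each agent appears in at most one pair; $M(a)$ denotes the partner of $a$ in $M$. Under weak stability, a pair $\{a,a'\}$ of mutually acceptable agents blocks $M$ if $a$ is unmatched or strictly prefers $a'$ to $M(a)$, and $a'$ is unmatched or strictly prefers $a$ to $M(a')$. A matching is weakly stable if no pair blocks it. $M\triangle M'$ denotes the symmetric difference. \textsc{Adapt Weakly SM with Ties to Forced and Forbidden Pairs}: Input: an SM with Ties instance with agent set $A=U\cup W$, a weakly stable matching $M_1$, a set of forced pairs $Q\subseteq\binom{A}{2}$, a set of forbidden pairs $P\subseteq\binom{A}{2}$, and an integer $k$. Question: is there a weakly stable matching $M_2$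 with $Q\subseteq M_2$, $M_2\cap P=\emptyset$, and $|M_1\triangle M_2|\le k$? *)

theory Defs
  imports Main "HOL-Library.Log_Nat"
begin

section \<open>Random access machines with logarithmic cost\<close>

text \<open>
  Inputs and outputs are finite sequences of natural numbers. Every number is charged the length of
  its binary representation, both in the size of a word and in the running time of a program, so
  that running times agree up to a polynomial with those of Turing machines on binary encodings.
\<close>

type_synonym word = "nat list"

definition num_size :: "nat \<Rightarrow> nat" where
  "num_size n = floorlog 2 n + 1"

definition word_size :: "word \<Rightarrow> nat" where
  "word_size x = sum_list (map num_size x)"

datatype binop = Plus | Minus | Times | Quot | Rem | Equal | Less

fun apply_op :: "binop \<Rightarrow> nat \<Rightarrow> nat \<Rightarrow> nat" where
  "apply_op Plus a b = a + b"
| "apply_op Minus a b = a - b"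
| "apply_op Times a b = a * b"
| "apply_op Quot a b = a div b"
| "apply_op Rem a b = a mod b"
| "apply_op Equal a b = (if a = b then 1 else 0)"
| "apply_op Less a b = (if a < b then 1 else 0)"

datatype expr =
    Const nat
  | Mem expr
  | Input expr
  | InputLength
  | Op binop expr expr

datatype prog =
    Skip
  | Store expr expr
  | Emit expr
  | Seq prog prog
  | If expr prog prog
  | While expr prog

text \<open>The input is read-only, the output is append-only, and the memory is indexed by addresses.\<close>

fun eval :: "word \<Rightarrow> (nat \<Rightarrow> nat) \<Rightarrow> expr \<Rightarrow> nat" where
  "eval x m (Const n) = n"
| "eval x m (Mem e) = m (eval x m e)"
| "eval x m (Input e) = (if eval x m e < length x then x ! eval x m e else 0)"
| "eval x m InputLength = length x"
| "eval x m (Op f e1 e2) = apply_op f (eval x m e1) (eval x m e2)"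

fun cost :: "word \<Rightarrow> (nat \<Rightarrow> nat) \<Rightarrow> expr \<Rightarrow> nat" where
  "cost x m (Const n) = num_size n"
| "cost x m (Mem e) = cost x m e + num_size (eval x m (Mem e))"
| "cost x m (Input e) = cost x m e + num_size (eval x m (Input e))"
| "cost x m InputLength = num_size (length x)"
| "cost x m (Op f e1 e2) = cost x m e1 + cost x m e2 + num_size (eval x m (Op f e1 e2))"

text \<open>
  \<open>exec x p (m, y) t (m', y')\<close>: on input \<open>x\<close>, program \<open>p\<close> started with memory \<open>m\<close> and output \<open>y\<close>
  terminates at cost \<open>t\<close> with memory \<open>m'\<close> and output \<open>y'\<close>.
\<close>

inductive exec ::
    "word \<Rightarrow> prog \<Rightarrow> (nat \<Rightarrow> nat) \<times> word \<Rightarrow> nat \<Rightarrow> (nat \<Rightarrow> nat) \<times> word \<Rightarrow> bool"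
  for x :: word where
  Skip: "exec x Skip s 1 s"
| Store: "exec x (Store a e) (m, y) (cost x m a + cost x m e + 1)
            (m(eval x m a := eval x m e), y)"
| Emit: "exec x (Emit e) (m, y) (cost x m e + 1) (m, y @ [eval x m e])"
| Seq: "exec x p s t s' \<Longrightarrow> exec x q s' t' s'' \<Longrightarrow> exec x (Seq p q) s (t + t' + 1) s''"
| IfTrue: "eval x m b \<noteq> 0 \<Longrightarrow> exec x p (m, y) t s \<Longrightarrow>
             exec x (If b p q) (m, y) (cost x m b + t + 1) s"
| IfFalse: "eval x m b = 0 \<Longrightarrow> exec x q (m, y) t s \<Longrightarrow>
             exec x (If b p q) (m, y) (cost x m b + t + 1) s"
| WhileTrue: "eval x m b \<noteq> 0 \<Longrightarrow> exec x p (m, y) t s \<Longrightarrow> exec x (While b p) s t' s' \<Longrightarrow>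
             exec x (While b p) (m, y) (cost x m b + t + t' + 1) s'"
| WhileFalse: "eval x m b = 0 \<Longrightarrow> exec x (While b p) (m, y) (cost x m b + 1) (m, y)"

definition runs :: "prog \<Rightarrow> word \<Rightarrow> nat \<Rightarrow> word \<Rightarrow> bool" where
  "runs p x t y \<longleftrightarrow> (\<exists>m. exec x p (\<lambda>_. 0, []) t (m, y))"

definition computable :: "(nat \<Rightarrow> nat) \<Rightarrow> bool" where
  "computable f \<longleftrightarrow> (\<exists>p. \<forall>n. \<exists>t. runs p [n] t [f n])"


section \<open>Parameterized problems and the class W[1]\<close>

type_synonym param_problem = "(word \<times> nat) set"

text \<open>In inputs and outputs of reductions the first number is the parameter.\<close>

definition fpt_reducible :: "param_problem \<Rightarrow> param_problem \<Rightarrow> bool" where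
  "fpt_reducible L L' \<longleftrightarrow>
     (\<exists>p f g c. computable f \<and> computable g \<and>
        (\<forall>x k. \<exists>x' k' t.
           runs p (k # x) t (k' # x') \<and>
           t \<le> f k * (word_size x + 1) ^ c \<and>
           k' \<le> g k \<and>
           ((x, k) \<in> L \<longleftrightarrow> (x', k') \<in> L')))"

datatype literal = Pos nat | Neg nat

type_synonym cnf = "literal list list"

fun literal_var :: "literal \<Rightarrow> nat" where
  "literal_var (Pos v) = v"
| "literal_var (Neg v) = v"

fun literal_holds :: "nat set \<Rightarrow> literal \<Rightarrow> bool" where
  "literal_holds S (Pos v) \<longleftrightarrow> v \<in> S"
| "literal_holds S (Neg v) \<longleftrightarrow> v \<notin> S"

definition cnf_vars :: "cnf \<Rightarrow> nat set" where
  "cnf_vars F = literal_var ` (\<Union>C\<in>set F. set C)"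

definition cnf_holds :: "nat set \<Rightarrow> cnf \<Rightarrow> bool" where
  "cnf_holds S F \<longleftrightarrow> (\<forall>C\<in>set F. \<exists>l\<in>set C. literal_holds S l)"

fun encode_literal :: "literal \<Rightarrow> nat" where
  "encode_literal (Pos v) = 2 * v"
| "encode_literal (Neg v) = 2 * v + 1"

definition encode_cnf :: "cnf \<Rightarrow> word" where
  "encode_cnf F = length F # concat (map (\<lambda>C. length C # map encode_literal C) F)"

text \<open>
  Weighted satisfiability of \<open>d\<close>-CNF formulas: is there a satisfying assignment setting exactly \<open>k\<close>
  of the variables of the formula to true (\<open>S\<close> is the set of true variables)?
\<close>

definition weighted_sat :: "nat \<Rightarrow> param_problem" where
  "weighted_sat d =
     {(encode_cnf F, k) | F k.
        (\<forall>C\<in>set F. length C \<le> d) \<and>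
        (\<exists>S \<subseteq> cnf_vars F. card S = k \<and> cnf_holds S F)}"

text \<open>
  W[t] is the closure under fpt-reductions of the weighted satisfiability problems for the formula
  classes \<open>\<Gamma>\<^sub>t\<^sub>,\<^sub>d\<close>, \<open>d \<ge> 1\<close> (Flum and Grohe). The class \<open>\<Gamma>\<^sub>1\<^sub>,\<^sub>d\<close> consists of the conjunctions of
  disjunctions of at most \<open>d\<close> literals.
\<close>

definition W1 :: "param_problem set" where
  "W1 = {L. \<exists>d\<ge>1. fpt_reducible L (weighted_sat d)}"

definition W1_hard :: "param_problem \<Rightarrow> bool" where
  "W1_hard L \<longleftrightarrow> (\<forall>L'\<in>W1. fpt_reducible L' L)"


section \<open>Stable marriage with ties\<close>

text \<open>\<open>(b, c) \<in> pref I a\<close> means that \<open>a\<close> weakly prefers \<open>b\<close> to \<open>c\<close>.\<close>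

record 'a smt =
  men :: "'a set"
  women :: "'a set"
  acc :: "'a \<Rightarrow> 'a set"
  pref :: "'a \<Rightarrow> 'a rel"

definition agents :: "('a, 'b) smt_scheme \<Rightarrow> 'a set" where
  "agents I = men I \<union> women I"

definition valid_smt :: "('a, 'b) smt_scheme \<Rightarrow> bool" where
  "valid_smt I \<longleftrightarrow>
     finite (men I) \<and> finite (women I) \<and> men I \<inter> women I = {} \<and>
     (\<forall>u\<in>men I. acc I u \<subseteq> women I) \<and>
     (\<forall>w\<in>women I. acc I w \<subseteq> men I) \<and>
     (\<forall>u\<in>men I. \<forall>w\<in>women I. w \<in> acc I u \<longleftrightarrow> u \<in> acc I w) \<and>
     (\<forall>a\<in>agents I. preorder_on (acc I a) (pref I a) \<and> total_on (acc I a) (pref I a))"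

definition strictly_prefers :: "('a, 'b) smt_scheme \<Rightarrow> 'a \<Rightarrow> 'a \<Rightarrow> 'a \<Rightarrow> bool" where
  "strictly_prefers I a b c \<longleftrightarrow> (b, c) \<in> pref I a \<and> (c, b) \<notin> pref I a"

definition indifferent :: "('a, 'b) smt_scheme \<Rightarrow> 'a \<Rightarrow> 'a \<Rightarrow> 'a \<Rightarrow> bool" where
  "indifferent I a b c \<longleftrightarrow> (b, c) \<in> pref I a \<and> (c, b) \<in> pref I a"

definition indifferent_set :: "('a, 'b) smt_scheme \<Rightarrow> 'a \<Rightarrow> 'a set \<Rightarrow> bool" where
  "indifferent_set I a T \<longleftrightarrow> T \<subseteq> acc I a \<and> (\<forall>b\<in>T. \<forall>c\<in>T. indifferent I a b c)"

definition ties :: "('a, 'b) smt_scheme \<Rightarrow> 'a \<Rightarrow> 'a set set" where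
  "ties I a = {T. indifferent_set I a T \<and> card T \<ge> 2 \<and> (\<forall>T'. T \<subset> T' \<longrightarrow> \<not> indifferent_set I a T')}"

definition num_ties :: "('a, 'b) smt_scheme \<Rightarrow> nat" where
  "num_ties I = (\<Sum>a\<in>agents I. card (ties I a))"

definition one_sided_ties :: "('a, 'b) smt_scheme \<Rightarrow> bool" where
  "one_sided_ties I \<longleftrightarrow> (\<forall>u\<in>men I. ties I u = {}) \<or> (\<forall>w\<in>women I. ties I w = {})"

definition mutually_acceptable :: "('a, 'b) smt_scheme \<Rightarrow> 'a \<Rightarrow> 'a \<Rightarrow> bool" where
  "mutually_acceptable I a b \<longleftrightarrow>
     a \<in> agents I \<and> b \<in> agents I \<and> b \<in> acc I a \<and> a \<in> acc I b"

definition matching :: "('a, 'b) smt_scheme \<Rightarrow> 'a set set \<Rightarrow> bool" where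
  "matching I M \<longleftrightarrow>
     (\<forall>e\<in>M. \<exists>a b. e = {a, b} \<and> mutually_acceptable I a b) \<and>
     (\<forall>e\<in>M. \<forall>e'\<in>M. e \<noteq> e' \<longrightarrow> e \<inter> e' = {})"

definition matched :: "'a set set \<Rightarrow> 'a \<Rightarrow> bool" where
  "matched M a \<longleftrightarrow> (\<exists>b. {a, b} \<in> M)"

definition partner :: "'a set set \<Rightarrow> 'a \<Rightarrow> 'a" where
  "partner M a = (THE b. {a, b} \<in> M)"

definition blocks :: "('a, 'b) smt_scheme \<Rightarrow> 'a set set \<Rightarrow> 'a \<Rightarrow> 'a \<Rightarrow> bool" where
  "blocks I M a b \<longleftrightarrow>
     mutually_acceptable I a b \<and>
     (\<not> matched M a \<or> strictly_prefers I a b (partner M a)) \<and>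
     (\<not> matched M b \<or> strictly_prefers I b a (partner M b))"

definition weakly_stable :: "('a, 'b) smt_scheme \<Rightarrow> 'a set set \<Rightarrow> bool" where
  "weakly_stable I M \<longleftrightarrow> matching I M \<and> (\<nexists>a b. blocks I M a b)"


section \<open>Adapting weakly stable matchings to forced and forbidden pairs\<close>

record 'a adapt_instance = "'a smt" +
  initial :: "'a set set"
  forced :: "'a set set"
  forbidden :: "'a set set"
  budget :: nat

definition valid_adapt :: "'a adapt_instance \<Rightarrow> bool" where
  "valid_adapt I \<longleftrightarrow>
     valid_smt I \<and> weakly_stable I (initial I) \<and>
     forced I \<subseteq> {e. e \<subseteq> agents I \<and> card e = 2} \<and>
     forbidden I \<subseteq> {e. e \<subseteq> agents I \<and> card e = 2}"

definition solvable_adapt :: "'a adapt_instance \<Rightarrow> bool" where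
  "solvable_adapt I \<longleftrightarrow>
     (\<exists>M. weakly_stable I M \<and> forced I \<subseteq> M \<and> M \<inter> forbidden I = {} \<and>
          card (sym_diff (initial I) M) \<le> budget I)"

text \<open>
  Encoding: the men are \<open>0, \<dots>, nU - 1\<close> and the women \<open>nU, \<dots>, nU + nW - 1\<close>. The preferences are given
  by the matrix \<open>r\<close> of ranks: \<open>r a b = 0\<close> means that \<open>b\<close> is not acceptable for \<open>a\<close>, and among
  acceptable agents a smaller rank is better, equal ranks expressing indifference.
\<close>

definition adapt_of_ranks ::
    "nat \<Rightarrow> nat \<Rightarrow> (nat \<Rightarrow> nat \<Rightarrow> nat) \<Rightarrow>
     (nat \<times> nat) list \<Rightarrow> (nat \<times> nat) list \<Rightarrow> (nat \<times> nat) list \<Rightarrow> nat \<Rightarrow> nat adapt_instance" where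
  "adapt_of_ranks nU nW r ms qs ps k =
     \<lparr>men = {0..<nU}, women = {nU..<nU + nW},
      acc = (\<lambda>a. {b. b < nU + nW \<and> r a b \<noteq> 0}),
      pref = (\<lambda>a. {(b, c). b < nU + nW \<and> c < nU + nW \<and> r a b \<noteq> 0 \<and> r a c \<noteq> 0 \<and> r a b \<le> r a c}),
      initial = (\<lambda>(a, b). {a, b}) ` set ms,
      forced = (\<lambda>(a, b). {a, b}) ` set qs,
      forbidden = (\<lambda>(a, b). {a, b}) ` set ps,
      budget = k\<rparr>"

definition encode_pairs :: "(nat \<times> nat) list \<Rightarrow> word" where
  "encode_pairs ps = length ps # concat (map (\<lambda>(a, b). [a, b]) ps)"

definition encode_adapt ::
    "nat \<Rightarrow> nat \<Rightarrow> (nat \<Rightarrow> nat \<Rightarrow> nat) \<Rightarrow>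
     (nat \<times> nat) list \<Rightarrow> (nat \<times> nat) list \<Rightarrow> (nat \<times> nat) list \<Rightarrow> nat \<Rightarrow> word" where
  "encode_adapt nU nW r ms qs ps k =
     [nU, nW] @ concat (map (\<lambda>a. map (r a) [0..<nU + nW]) [0..<nU + nW]) @
     encode_pairs ms @ encode_pairs qs @ encode_pairs ps @ [k]"

definition encodes_adapt :: "word \<Rightarrow> nat adapt_instance \<Rightarrow> bool" where
  "encodes_adapt x I \<longleftrightarrow>
     (\<exists>nU nW r ms qs ps k.
        x = encode_adapt nU nW r ms qs ps k \<and> I = adapt_of_ranks nU nW r ms qs ps k)"

text \<open>
  The problem restricted to the instances satisfying \<open>R\<close>, parameterized by the number of ties plus
  the budget. As usual, words that do not encode such an instance are no-instances.
\<close>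

definition adapt_weakly_smt :: "(nat adapt_instance \<Rightarrow> bool) \<Rightarrow> param_problem" where
  "adapt_weakly_smt R =
     {(x, num_ties I + budget I) | x I.
        encodes_adapt x I \<and> valid_adapt I \<and> R I \<and> solvable_adapt I}"

end

theory Submission
  imports Defs
begin

text \<open>
  A weighted satisfiability instance is turned into a choice of one option for each of \<open>K\<close> slots.
  The first \<open>k\<close> slots hold the true variables \<open>x\<^sub>1 < \<dots> < x\<^sub>k\<close>. A positive literal of \<open>v\<close> is false iff
  \<open>v\<close> lies in a gap between two consecutive \<open>x\<^sub>i\<close>, so the falsity of a clause with at most \<open>d\<close>
  literals depends on at most \<open>2d\<close> of the \<open>x\<^sub>i\<close>: one further slot for each \<open>d\<close>-tuple of indices
  records the variables at and next to these indices, and its options are those that falsify no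
  clause. All constraints now say that an option of a later slot demands options of earlier ones.

  In the matching instance the woman \<open>s\<^sub>i\<close> of slot \<open>i\<close> is indifferent between the men \<open>a\<^sub>i\<^sub>j\<close> of its
  options. The forced pair \<open>{z\<^sub>0, s\<^sub>K}\<close>, or else the forbidden pair \<open>{z\<^sub>K, s\<^sub>K}\<close>, separates \<open>z\<^sub>K\<close> from \<open>s\<^sub>K\<close>.
  Once \<open>z\<^sub>i\<^sub>+\<^sub>1\<close> has lost \<open>s\<^sub>i\<^sub>+\<^sub>1\<close>, stability requires him to marry the partner \<open>b\<^sub>i\<^sub>j\<close> of some \<open>a\<^sub>i\<^sub>j\<close>, who
  has to move to \<open>s\<^sub>i\<close>, which in turn expels \<open>z\<^sub>i\<close>.
  When \<open>b\<^sub>i\<^sub>j\<close> is married to \<open>z\<^sub>i\<^sub>+\<^sub>1\<close>, she prefers the men of the options that \<open>j\<close> demands; they do not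
  block only if they are married to the women of their slots, that is, if they are chosen.

  The reduction is computed by composing function combinators, each of which comes with a program and
  a polynomial time bound.
\<close>

section \<open>Running a second program on the output of a first\<close>

text \<open>Hardness concerns every reduction to weighted satisfiability, given only as a program
  whose input is read-only and whose output cannot be read back. That program is therefore rewritten
  to keep its output in memory, in cells out of the way of its successor, which never touches the
  machine input. The target parameter counts one tie per slot, so the number of slots may depend on
  k and d only, whereas the number of clauses is unbounded: a slot per clause is impossible. Instead
  a slot stands for a guess of where the literals of a clause lie relative to the true variables.
  There are (k + 1)^d guesses, and an option is tested against all clauses at once when the instance
  is written down. For fixed d the n^(2d) options of a slot stay polynomially many. Demands are
  enforced by strict preferences, without further ties. Their price is that a man a_ij may desert to
  a woman who demands him instead of taking s_i. Since demands lead only from later slots to earlier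
  ones, this can be ruled out.\<close>

lemma num_size_pos: "1 \<le> num_size n"
  by (simp add: num_size_def)

lemma num_size_mono: "a \<le> b \<Longrightarrow> num_size a \<le> num_size b"
  by (simp add: num_size_def floorlog_mono)

lemma floorlog_two_le: "floorlog 2 n \<le> n"
  by (rule floorlog_leI) simp_all

lemma num_size_le: "num_size n \<le> n + 1"
  using floorlog_two_le[of n] by (simp add: num_size_def)

lemma less_power_floorlog: "n < 2 ^ floorlog 2 n"
  by (rule floorlog_leD[OF order_refl]) simp

lemma num_size_mult: "num_size (a * b) \<le> num_size a + num_size b"
proof -
  have "a * b < 2 ^ floorlog 2 a * 2 ^ floorlog 2 b"
    by (intro mult_strict_mono less_power_floorlog) auto
  then have "floorlog 2 (a * b) \<le> floorlog 2 a + floorlog 2 b"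
    by (intro floorlog_leI) (simp_all add: power_add)
  then show ?thesis by (simp add: num_size_def)
qed

lemma num_size_add: "num_size (a + b) \<le> num_size a + num_size b"
proof (cases "a = 0 \<or> b = 0")
  case True
  then show ?thesis by auto
next
  case False
  have "num_size a \<ge> 2" "num_size b \<ge> 2"
    using False floorlog_eq_zero_iff[of 2 a] floorlog_eq_zero_iff[of 2 b]
    by (auto simp: num_size_def)
  moreover have "floorlog 2 (a + b) \<le> max (floorlog 2 a) (floorlog 2 b) + 1"
  proof (rule floorlog_leI)
    have "a < 2 ^ max (floorlog 2 a) (floorlog 2 b)" "b < 2 ^ max (floorlog 2 a) (floorlog 2 b)"
      using less_power_floorlog[of a] less_power_floorlog[of b]
      by (meson less_le_trans max.cobounded1 max.cobounded2 one_le_numeral power_increasing)+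
    then show "a + b < 2 ^ (max (floorlog 2 a) (floorlog 2 b) + 1)" by simp
  qed simp_all
  ultimately show ?thesis by (simp add: num_size_def)
qed

text \<open>Subtraction, quotient and remainder never exceed the first operand, even for divisor 0,
  and comparisons yield at most 1; so applying an operator at most doubles the cost of its
  arguments.\<close>

lemma num_size_apply_op: "num_size (apply_op f a b) \<le> num_size a + num_size b"
proof -
  have one: "num_size (1::nat) \<le> 2" "num_size (0::nat) \<le> 1"
    using num_size_le[of 1] num_size_le[of 0] by simp_all
  have *: "c \<le> a \<Longrightarrow> num_size c \<le> num_size a + num_size b" for c
    by (meson num_size_mono trans_le_add1)
  have mod: "a mod b \<le> a" by (metis mod_less_eq_dividend)
  show ?thesis
    using num_size_pos[of a] num_size_pos[of b] one *
    by (cases f) (auto simp: num_size_add num_size_mult div_le_dividend mod)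
qed

lemma num_size_eval_le_cost: "num_size (eval x m e) \<le> cost x m e"
  by (cases e) auto

definition lookup :: "word \<Rightarrow> nat \<Rightarrow> nat" where
  "lookup z i = (if i < length z then z ! i else 0)"

text \<open>Addresses are split by residue mod 4: class 0 is the memory of a relocated program, class 1
  (with the length at address 2) holds its output, class 3 holds the registers of the program
  that runs afterwards.\<close>

definition stored :: "word \<Rightarrow> (nat \<Rightarrow> nat) \<Rightarrow> bool" where
  "stored z m \<longleftrightarrow> m 2 = length z \<and> (\<forall>i. m (4 * i + 1) = lookup z i)"

fun reloc_expr :: "expr \<Rightarrow> expr" where
  "reloc_expr (Const n) = Const n"
| "reloc_expr (Mem e) = Mem (Op Times (Const 4) (reloc_expr e))"
| "reloc_expr (Input e) = Input (reloc_expr e)"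
| "reloc_expr InputLength = InputLength"
| "reloc_expr (Op f e1 e2) = Op f (reloc_expr e1) (reloc_expr e2)"

fun reloc :: "prog \<Rightarrow> prog" where
  "reloc Skip = Skip"
| "reloc (Store a e) = Store (Op Times (Const 4) (reloc_expr a)) (reloc_expr e)"
| "reloc (Emit e) =
     Seq (Store (Op Plus (Op Times (Const 4) (Mem (Const 2))) (Const 1)) (reloc_expr e))
         (Store (Const 2) (Op Plus (Mem (Const 2)) (Const 1)))"
| "reloc (Seq p q) = Seq (reloc p) (reloc q)"
| "reloc (If b p q) = If (reloc_expr b) (reloc p) (reloc q)"
| "reloc (While b p) = While (reloc_expr b) (reloc p)"

lemma eval_reloc:
  assumes "\<forall>a. M (4 * a) = m a"
  shows "eval x M (reloc_expr e) = eval x m e"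
  by (induction e) (auto simp: assms)

lemma num_size_consts: "num_size 0 \<le> 1" "num_size 1 \<le> 2" "num_size (Suc 0) \<le> 2"
  "num_size 2 \<le> 3" "num_size 4 \<le> 5"
  using num_size_le[of 0] num_size_le[of 1] num_size_le[of 2] num_size_le[of 4] by simp_all

text \<open>The extra term on the left strengthens the induction: in the case of \<open>Mem\<close>
  it pays for the longer address \<open>4 * a\<close>.\<close>

lemma cost_reloc:
  assumes "\<forall>a. M (4 * a) = m a"
  shows "cost x M (reloc_expr e) + 3 * num_size (eval x m e) \<le> 30 * cost x m e"
proof (induction e)
  case (Mem e)
  have "num_size (4 * eval x m e) \<le> num_size 4 + num_size (eval x m e)"
    by (rule num_size_mult)
  then show ?case
    using Mem num_size_pos[of "m (eval x m e)"] num_size_consts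
    by (simp add: eval_reloc[OF assms] assms)
next
  case (Op f e1 e2)
  then show ?case by (simp add: eval_reloc[OF assms])
next
  case (Input e)
  then show ?case by (auto simp: eval_reloc[OF assms])
qed auto

lemma exec_length_mono:
  assumes "exec x p s t s'"
  shows "length (snd s) \<le> length (snd s')"
  using assms by induction auto

lemma scale_le: "a \<le> 100 * t \<Longrightarrow> a \<le> 100 * (n + 1) * t" for a n t :: nat
  by (erule order_trans) simp

lemma cost_reloc_le:
  assumes "\<forall>a. M (4 * a) = m a"
  shows "cost x M (reloc_expr e) \<le> 100 * (n + 1) * cost x m e"
  using cost_reloc[OF assms, of x e] by (intro scale_le) simp

text \<open>Each step is simulated at constant overhead except \<open>Emit\<close>, which has to
  read and increment the output length kept in cell 2. That length is at most \<open>n\<close>,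
  whence the factor \<open>n + 1\<close>. The real output \<open>z\<close> stays untouched.\<close>

lemma exec_reloc:
  assumes "exec x p s t s'" "length (snd s') \<le> n"
    "\<forall>a. M (4 * a) = fst s a" "stored (snd s) M"
  shows "\<exists>M' t'. exec x (reloc p) (M, z) t' (M', z) \<and> (\<forall>a. M' (4 * a) = fst s' a) \<and>
           stored (snd s') M' \<and> t' \<le> 100 * (n + 1) * t"
  using assms
proof (induction arbitrary: M rule: exec.induct)
  case (Skip s)
  then show ?case
    using exec.Skip[of x "(M, z)"] by (intro exI[of _ M] exI[of _ 1]) auto
next
  case (Store a e m y)
  have m: "\<forall>a. M (4 * a) = m a" using Store by simp
  let ?A = "Op Times (Const 4) (reloc_expr a)"
  have ev: "eval x M ?A = 4 * eval x m a" "eval x M (reloc_expr e) = eval x m e"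
    by (simp_all add: eval_reloc[OF m])
  have "num_size (4 * eval x m a) \<le> num_size 4 + num_size (eval x m a)"
    by (rule num_size_mult)
  then have "cost x M ?A + cost x M (reloc_expr e) + 1 \<le> 100 * (cost x m a + cost x m e + 1)"
    using cost_reloc[OF m, of x a] cost_reloc[OF m, of x e] num_size_consts
    by (simp add: eval_reloc[OF m])
  from scale_le[OF this, of n] have le: "cost x M ?A + cost x M (reloc_expr e) + 1
      \<le> 100 * (n + 1) * (cost x m a + cost x m e + 1)" .
  have "exec x (reloc (Store a e)) (M, z) (cost x M ?A + cost x M (reloc_expr e) + 1)
      (M(4 * eval x m a := eval x m e), z)"
    using exec.Store[of x ?A "reloc_expr e" M z] by (simp only: ev reloc.simps)
  moreover have "stored y (M(4 * eval x m a := eval x m e))"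
  proof -
    have "4 * i + 1 \<noteq> 4 * b" "2 \<noteq> 4 * b" for i b :: nat by presburger+
    then show ?thesis using Store.prems(3) by (simp add: stored_def)
  qed
  ultimately show ?case using le m
    by (intro exI[of _ "M(4 * eval x m a := eval x m e)"] exI) auto
next
  case (Emit e m y)
  have m: "\<forall>a. M (4 * a) = m a" using Emit by simp
  have len: "M 2 = length y" and lookup: "\<And>i. M (4 * i + 1) = lookup y i"
    using Emit.prems(3) by (simp_all add: stored_def)
  let ?A = "Op Plus (Op Times (Const 4) (Mem (Const 2))) (Const 1)"
  let ?e = "reloc_expr e"
  let ?M1 = "M(4 * length y + 1 := eval x m e)"
  let ?M2 = "?M1(2 := length y + 1)"
  let ?E = "Op Plus (Mem (Const 2)) (Const 1)"
  have ev: "eval x M ?A = 4 * length y + 1" "eval x M ?e = eval x m e"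
    by (simp_all add: eval_reloc[OF m] len)
  have ne: "4 * length y + 1 \<noteq> 2" by presburger
  then have ev2: "eval x ?M1 ?E = length y + 1" "eval x ?M1 (Const 2) = 2"
    using len by simp_all
  have "exec x (Store ?A ?e) (M, z) (cost x M ?A + cost x M ?e + 1) (?M1, z)"
    using exec.Store[of x ?A "?e" M z] by (simp only: ev)
  moreover have "exec x (Store (Const 2) ?E) (?M1, z)
      (cost x ?M1 (Const 2) + cost x ?M1 ?E + 1) (?M2, z)"
    using exec.Store[of x "Const 2" ?E ?M1 z] by (simp only: ev2)
  ultimately have ex: "exec x (reloc (Emit e)) (M, z)
      ((cost x M ?A + cost x M ?e + 1) + (cost x ?M1 (Const 2) + cost x ?M1 ?E + 1) + 1) (?M2, z)"
    by (simp only: reloc.simps) (rule exec.Seq)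
  have "stored (y @ [eval x m e]) ?M2"
  proof -
    have "4 * i + 1 \<noteq> (2::nat)" for i by presburger
    then show ?thesis using len lookup by (auto simp: stored_def lookup_def nth_append)
  qed
  moreover have "\<forall>a. ?M2 (4 * a) = m a"
  proof -
    have "4 * a \<noteq> 2" "4 * a \<noteq> 4 * i + 1" for a i :: nat by presburger+
    then show ?thesis using m by simp
  qed
  moreover have "(cost x M ?A + cost x M ?e + 1) + (cost x ?M1 (Const 2) + cost x ?M1 ?E + 1) + 1
      \<le> 100 * (n + 1) * (cost x m e + 1)"
  proof -
    let ?l = "length y"
    have arith: "(a + e + 1) + (b + 1) + 1 \<le> 100 * (n + 1) + 100 * c"
      if "a \<le> 9 * l + 20" "b \<le> 2 * l + 20" "e \<le> 30 * c" "l \<le> n" for a b c e l :: nat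
      using that by simp
    have "cost x M ?A \<le> 9 * ?l + 20"
      using num_size_consts num_size_le[of ?l] num_size_le[of "4 * ?l"] num_size_le[of "4 * ?l + 1"]
      by (simp add: len)
    moreover have "cost x ?M1 (Const 2) + cost x ?M1 ?E \<le> 2 * ?l + 20"
      using num_size_consts num_size_le[of ?l] num_size_le[of "?l + 1"] ne by (simp add: len)
    moreover have "cost x M ?e \<le> 30 * cost x m e"
      using cost_reloc[OF m, of x e] by simp
    moreover have "?l \<le> n" using Emit by simp
    ultimately have "(cost x M ?A + cost x M ?e + 1) +
        (cost x ?M1 (Const 2) + cost x ?M1 ?E + 1) + 1 \<le> 100 * (n + 1) + 100 * cost x m e"
      by (rule arith)
    also have "\<dots> \<le> 100 * (n + 1) * (cost x m e + 1)" by simp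
    finally show ?thesis .
  qed
  ultimately show ?case using ex by (intro exI[of _ ?M2] exI) auto
next
  case (Seq p s t s' q t' s'')
  have "length (snd s') \<le> n" using exec_length_mono[OF Seq.hyps(2)] Seq.prems(1) by simp
  from Seq.IH(1)[OF this Seq.prems(2,3)] obtain M1 t1 where 1:
    "exec x (reloc p) (M, z) t1 (M1, z)" "\<forall>a. M1 (4 * a) = fst s' a" "stored (snd s') M1"
    "t1 \<le> 100 * (n + 1) * t" by blast
  from Seq.IH(2)[OF Seq.prems(1) 1(2,3)] obtain M2 t2 where 2:
    "exec x (reloc q) (M1, z) t2 (M2, z)" "\<forall>a. M2 (4 * a) = fst s'' a" "stored (snd s'') M2"
    "t2 \<le> 100 * (n + 1) * t'" by blast
  show ?case
    using exec.Seq[OF 1(1) 2(1)] 1(4) 2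
    by (intro exI[of _ M2] exI[of _ "t1 + t2 + 1"]) (auto simp: algebra_simps)
next
  case (IfTrue m b p y t s q)
  have m: "\<forall>a. M (4 * a) = m a" using IfTrue by simp
  from IfTrue.IH[OF IfTrue.prems] obtain M1 t1 where 1:
    "exec x (reloc p) (M, z) t1 (M1, z)" "\<forall>a. M1 (4 * a) = fst s a" "stored (snd s) M1"
    "t1 \<le> 100 * (n + 1) * t" by blast
  have "cost x M (reloc_expr b) + t1 + 1 \<le> 100 * (n + 1) * (cost x m b + t + 1)"
    using cost_reloc_le[OF m, of x b n] 1(4) by (simp add: algebra_simps)
  moreover have "exec x (reloc (If b p q)) (M, z) (cost x M (reloc_expr b) + t1 + 1) (M1, z)"
    using exec.IfTrue[OF _ 1(1), of "reloc_expr b" "reloc q"] IfTrue.hyps(1)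
    by (simp add: eval_reloc[OF m])
  ultimately show ?case using 1 by blast
next
  case (IfFalse m b q y t s p)
  have m: "\<forall>a. M (4 * a) = m a" using IfFalse by simp
  from IfFalse.IH[OF IfFalse.prems] obtain M1 t1 where 1:
    "exec x (reloc q) (M, z) t1 (M1, z)" "\<forall>a. M1 (4 * a) = fst s a" "stored (snd s) M1"
    "t1 \<le> 100 * (n + 1) * t" by blast
  have "cost x M (reloc_expr b) + t1 + 1 \<le> 100 * (n + 1) * (cost x m b + t + 1)"
    using cost_reloc_le[OF m, of x b n] 1(4) by (simp add: algebra_simps)
  moreover have "exec x (reloc (If b p q)) (M, z) (cost x M (reloc_expr b) + t1 + 1) (M1, z)"
    using exec.IfFalse[OF _ 1(1), of "reloc_expr b" "reloc p"] IfFalse.hyps(1)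
    by (simp add: eval_reloc[OF m])
  ultimately show ?case using 1 by blast
next
  case (WhileTrue m b p y t s t' s')
  have m: "\<forall>a. M (4 * a) = m a" using WhileTrue by simp
  have "length (snd s) \<le> n" using exec_length_mono[OF WhileTrue.hyps(3)] WhileTrue.prems(1) by simp
  from WhileTrue.IH(1)[OF this WhileTrue.prems(2,3)] obtain M1 t1 where 1:
    "exec x (reloc p) (M, z) t1 (M1, z)" "\<forall>a. M1 (4 * a) = fst s a" "stored (snd s) M1"
    "t1 \<le> 100 * (n + 1) * t" by blast
  from WhileTrue.IH(2)[OF WhileTrue.prems(1) 1(2,3)] obtain M2 t2 where 2:
    "exec x (reloc (While b p)) (M1, z) t2 (M2, z)" "\<forall>a. M2 (4 * a) = fst s' a"
    "stored (snd s') M2" "t2 \<le> 100 * (n + 1) * t'" by blast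
  have "cost x M (reloc_expr b) + t1 + t2 + 1 \<le> 100 * (n + 1) * (cost x m b + t + t' + 1)"
    using cost_reloc_le[OF m, of x b n] 1(4) 2(4) by (simp add: algebra_simps)
  moreover have "exec x (reloc (While b p)) (M, z) (cost x M (reloc_expr b) + t1 + t2 + 1) (M2, z)"
    using exec.WhileTrue[OF _ 1(1) 2(1)[unfolded reloc.simps]] WhileTrue.hyps(1)
    by (simp add: eval_reloc[OF m])
  ultimately show ?case using 2 by blast
next
  case (WhileFalse m b p y)
  have m: "\<forall>a. M (4 * a) = m a" using WhileFalse by simp
  have "cost x M (reloc_expr b) + 1 \<le> 100 * (n + 1) * (cost x m b + 1)"
    using cost_reloc_le[OF m, of x b n] by (simp add: algebra_simps)
  moreover have "exec x (reloc (While b p)) (M, z) (cost x M (reloc_expr b) + 1) (M, z)"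
    using exec.WhileFalse[of x M "reloc_expr b" "reloc p" z] WhileFalse.hyps(1)
    by (simp add: eval_reloc[OF m])
  ultimately show ?case using WhileFalse.prems by (intro exI conjI) auto
qed

section \<open>Polynomial bounds and registers\<close>

text \<open>Adding 2 keeps the base at least 2 even for the empty word, so constants, sums and
  products are absorbed by a larger exponent.\<close>

definition word_base :: "word \<Rightarrow> nat" where
  "word_base z = word_size z + 2"

lemma word_base_ge_two: "2 \<le> word_base z"
  by (simp add: word_base_def)

lemma word_base_power_pos: "1 \<le> word_base z ^ c"
  using word_base_ge_two[of z] by simp

lemma word_base_power_mono: "c \<le> c' \<Longrightarrow> word_base z ^ c \<le> word_base z ^ c'"
  using word_base_ge_two[of z] by (intro power_increasing) auto

lemma length_le_word_size: "length z \<le> word_size z"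
proof (induction z)
  case (Cons a z)
  then show ?case using num_size_pos[of a] by (simp add: word_size_def)
qed simp

lemma num_size_lookup_le: "num_size (lookup z i) \<le> word_base z"
proof (cases "i < length z")
  case True
  then have "num_size (z ! i) \<le> word_size z"
    unfolding word_size_def by (intro member_le_sum_list) auto
  with True show ?thesis by (simp add: lookup_def word_base_def)
qed (use num_size_consts in \<open>simp add: lookup_def word_base_def\<close>)

text \<open>\<open>w s\<close> is the stored word of a state \<open>s\<close>, and \<open>G\<close> lists the quantities that are held in registers.\<close>

definition small :: "('s \<Rightarrow> word) \<Rightarrow> ('s \<Rightarrow> nat) list \<Rightarrow> ('s \<Rightarrow> nat) \<Rightarrow> bool" where
  "small w G f \<longleftrightarrow> (\<forall>b. \<exists>c. \<forall>s. (\<forall>g\<in>set G. g s \<le> word_base (w s) ^ b) \<longrightarrow> f s \<le> word_base (w s) ^ c)"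

lemma small_mono: "small w G g \<Longrightarrow> (\<And>s. f s \<le> g s) \<Longrightarrow> small w G f"
  unfolding small_def by (meson order_trans)

lemma small_var: "f \<in> set G \<Longrightarrow> small w G f"
  unfolding small_def by blast

lemma small_const: "small w G (\<lambda>_. n)"
proof -
  have "n \<le> word_base z ^ n" for z
  proof -
    have "n \<le> 2 ^ n" by (rule less_imp_le[OF less_exp])
    also have "\<dots> \<le> word_base z ^ n" using word_base_ge_two by (intro power_mono) auto
    finally show ?thesis .
  qed
  then show ?thesis unfolding small_def by blast
qed

lemma small_length: "small w G (\<lambda>s. length (w s))"
proof -
  have "length z \<le> word_base z ^ 1" for z using length_le_word_size[of z] by (simp add: word_base_def)
  then show ?thesis unfolding small_def by blast
qed

lemma small_num_size_lookup: "small w G (\<lambda>s. num_size (lookup (w s) (f s)))"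
proof -
  have "num_size (lookup z i) \<le> word_base z ^ 1" for z i using num_size_lookup_le by simp
  then show ?thesis unfolding small_def by blast
qed

lemma small_mult:
  assumes "small w G f" "small w G g"
  shows "small w G (\<lambda>s. f s * g s)"
  unfolding small_def
proof
  fix b
  obtain c1 where 1: "\<And>s. (\<forall>g\<in>set G. g s \<le> word_base (w s) ^ b) \<Longrightarrow> f s \<le> word_base (w s) ^ c1"
    using assms(1) unfolding small_def by meson
  obtain c2 where 2: "\<And>s. (\<forall>g\<in>set G. g s \<le> word_base (w s) ^ b) \<Longrightarrow> g s \<le> word_base (w s) ^ c2"
    using assms(2) unfolding small_def by meson
  have "f s * g s \<le> word_base (w s) ^ (c1 + c2)" if "\<forall>g\<in>set G. g s \<le> word_base (w s) ^ b" for s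
    using mult_le_mono[OF 1[OF that] 2[OF that]] by (simp add: power_add)
  then show "\<exists>c. \<forall>s. (\<forall>g\<in>set G. g s \<le> word_base (w s) ^ b) \<longrightarrow> f s * g s \<le> word_base (w s) ^ c" by blast
qed

lemma small_add:
  assumes "small w G f" "small w G g"
  shows "small w G (\<lambda>s. f s + g s)"
  unfolding small_def
proof
  fix b
  obtain c1 where 1: "\<And>s. (\<forall>g\<in>set G. g s \<le> word_base (w s) ^ b) \<Longrightarrow> f s \<le> word_base (w s) ^ c1"
    using assms(1) unfolding small_def by meson
  obtain c2 where 2: "\<And>s. (\<forall>g\<in>set G. g s \<le> word_base (w s) ^ b) \<Longrightarrow> g s \<le> word_base (w s) ^ c2"
    using assms(2) unfolding small_def by meson
  have "f s + g s \<le> word_base (w s) ^ (c1 + c2 + 1)" if "\<forall>g\<in>set G. g s \<le> word_base (w s) ^ b" for s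
  proof -
    let ?a = "word_base (w s) ^ c1" and ?b = "word_base (w s) ^ c2"
    have "?a * 1 \<le> ?a * ?b" by (rule mult_le_mono2[OF word_base_power_pos])
    moreover have "1 * ?b \<le> ?a * ?b" by (rule mult_le_mono1[OF word_base_power_pos])
    ultimately have "f s + g s \<le> 2 * (?a * ?b)" using 1[OF that] 2[OF that] by linarith
    also have "\<dots> \<le> word_base (w s) * (?a * ?b)" by (rule mult_le_mono1[OF word_base_ge_two])
    finally show ?thesis by (simp add: power_add mult_ac)
  qed
  then show "\<exists>c. \<forall>s. (\<forall>g\<in>set G. g s \<le> word_base (w s) ^ b) \<longrightarrow> f s + g s \<le> word_base (w s) ^ c" by blast
qed

lemma small_num_size: "small w G f \<Longrightarrow> small w G (\<lambda>s. num_size (f s))"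
  by (rule small_mono[OF small_add[OF _ small_const[of _ _ 1]]]) (assumption, rule num_size_le)

text \<open>Inside a loop the state gains a counter and an accumulator; nested loops iterate
  \<open>ext\<close>.\<close>

definition ext :: "('s \<Rightarrow> nat) list \<Rightarrow> ('s \<times> nat \<times> nat \<Rightarrow> nat) list" where
  "ext G = map (\<lambda>g t. g (fst t)) G @ [\<lambda>t. fst (snd t), \<lambda>t. snd (snd t)]"

abbreviation lift :: "('s \<Rightarrow> 'b) \<Rightarrow> 's \<times> nat \<times> nat \<Rightarrow> 'b" where
  "lift f \<equiv> \<lambda>t. f (fst t)"

lemma small_lift: "small w G f \<Longrightarrow> small (lift w) (ext G) (lift f)"
  unfolding small_def ext_def by (auto, metis)

lemma small_new: "small w (ext G) (\<lambda>t. fst (snd t))" "small w (ext G) (\<lambda>t. snd (snd t))"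
  by (rule small_var, simp add: ext_def)+

text \<open>The shape of the running time of a loop. The counter is below \<open>b s\<close> and the
  accumulator \<open>a s i\<close> at most \<open>h s\<close>, so one exponent bounds all registers
  throughout and one polynomial bounds every round.\<close>

lemma small_sum:
  assumes b: "small w G b" and h: "small w G h" and T: "small (lift w) (ext G) T"
    and le: "\<And>s i. i < b s \<Longrightarrow> a s i \<le> h s"
  shows "small w G (\<lambda>s. \<Sum>i<b s. T (s, i, a s i))"
  unfolding small_def
proof
  fix e
  let ?ok = "\<lambda>s. \<forall>g\<in>set G. g s \<le> word_base (w s) ^ e"
  obtain c1 where 1: "\<And>s. ?ok s \<Longrightarrow> b s \<le> word_base (w s) ^ c1" using b unfolding small_def by meson
  obtain c2 where 2: "\<And>s. ?ok s \<Longrightarrow> h s \<le> word_base (w s) ^ c2" using h unfolding small_def by meson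
  let ?e = "e + c1 + c2"
  obtain c3 where 3: "\<And>t. \<forall>g\<in>set (ext G). g t \<le> word_base (w (fst t)) ^ ?e \<Longrightarrow> T t \<le> word_base (w (fst t)) ^ c3"
    using T unfolding small_def by meson
  have "(\<Sum>i<b s. T (s, i, a s i)) \<le> word_base (w s) ^ (c1 + c3)" if ok: "?ok s" for s
  proof -
    have pw: "word_base (w s) ^ e \<le> word_base (w s) ^ ?e" "word_base (w s) ^ c1 \<le> word_base (w s) ^ ?e" "word_base (w s) ^ c2 \<le> word_base (w s) ^ ?e"
      by (rule word_base_power_mono, simp)+
    have "T (s, i, a s i) \<le> word_base (w s) ^ c3" if i: "i < b s" for i
    proof -
      have "\<forall>g\<in>set (ext G). g (s, i, a s i) \<le> word_base (w s) ^ ?e"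
        using ok 1[OF ok] 2[OF ok] le[OF i] i pw by (auto simp: ext_def intro: order_trans)
      then show ?thesis using 3[of "(s, i, a s i)"] by simp
    qed
    then have "(\<Sum>i<b s. T (s, i, a s i)) \<le> b s * word_base (w s) ^ c3"
      using sum_bounded_above[of "{..<b s}" "\<lambda>i. T (s, i, a s i)" "word_base (w s) ^ c3"] by simp
    also have "\<dots> \<le> word_base (w s) ^ (c1 + c3)" using 1[OF ok] by (simp add: power_add)
    finally show ?thesis .
  qed
  then show "\<exists>c. \<forall>s. ?ok s \<longrightarrow> (\<Sum>i<b s. T (s, i, a s i)) \<le> word_base (w s) ^ c" by blast
qed

section \<open>Registers and programs that compute a number\<close>

definition cell :: "nat \<Rightarrow> nat" where
  "cell e = 4 * e + 3"

lemma cell_inject [simp]: "cell a = cell b \<longleftrightarrow> a = b"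
  by (simp add: cell_def)

text \<open>A frame condition: only registers from \<open>D\<close> on may change. In particular the
  stored word, which lies in another residue class of addresses, survives.\<close>

definition same :: "nat \<Rightarrow> (nat \<Rightarrow> nat) \<Rightarrow> (nat \<Rightarrow> nat) \<Rightarrow> bool" where
  "same D m m' \<longleftrightarrow> (\<forall>a. (\<forall>e\<ge>D. a \<noteq> cell e) \<longrightarrow> m' a = m a)"

lemma same_refl: "same D m m"
  by (simp add: same_def)

lemma same_trans: "same D m m' \<Longrightarrow> same D' m' m'' \<Longrightarrow> D \<le> D' \<Longrightarrow> same D m m''"
  unfolding same_def using le_trans by metis

lemma same_upd: "same D m m' \<Longrightarrow> D \<le> e \<Longrightarrow> same D m (m'(cell e := v))"
  by (simp add: same_def)

lemma same_cell: "same D m m' \<Longrightarrow> e < D \<Longrightarrow> m' (cell e) = m (cell e)"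
  unfolding same_def using not_le by (metis cell_inject)

lemma same_stored: "same D m m' \<Longrightarrow> stored z m \<Longrightarrow> stored z m'"
proof -
  have "4 * i + 1 \<noteq> cell e" "2 \<noteq> cell e" for i e unfolding cell_def by presburger+
  then show "same D m m' \<Longrightarrow> stored z m \<Longrightarrow> stored z m'"
    unfolding same_def stored_def by simp
qed

definition holds ::
    "('s \<Rightarrow> word) \<Rightarrow> ('s \<Rightarrow> nat) list \<Rightarrow> nat list \<Rightarrow> 's \<Rightarrow> (nat \<Rightarrow> nat) \<Rightarrow> bool" where
  "holds w G ls s m \<longleftrightarrow> stored (w s) m \<and> list_all2 (\<lambda>l g. m (cell l) = g s) ls G"

lemma holds_same:
  assumes "holds w G ls s m" "same D m m'" "\<forall>l\<in>set ls. l < D"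
  shows "holds w G ls s m'"
proof -
  have "m' (cell (ls ! i)) = m (cell (ls ! i))" if "i < length ls" for i
    using same_cell[OF assms(2)] assms(3) that by simp
  then show ?thesis
    using assms same_stored unfolding holds_def by (auto simp: list_all2_conv_all_nth)
qed

lemma holds_ext:
  assumes "holds w G ls s m" "m (cell p) = i" "m (cell q) = a"
  shows "holds (lift w) (ext G) (ls @ [p, q]) (s, i, a) m"
  using assms unfolding holds_def ext_def
  by (auto simp: list_all2_conv_all_nth nth_append less_Suc_eq list_all2_append list_all2_map2
      intro!: list_all2_appendI)

definition runto ::
    "word \<Rightarrow> prog \<Rightarrow> (nat \<Rightarrow> nat) \<Rightarrow> word \<Rightarrow> nat \<Rightarrow> (nat \<Rightarrow> nat) \<Rightarrow> word \<Rightarrow> bool" where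
  "runto X p m y T m' y' \<longleftrightarrow> (\<exists>t\<le>T. exec X p (m, y) t (m', y'))"

lemma runto_mono: "runto X p m y T m' y' \<Longrightarrow> T \<le> T' \<Longrightarrow> runto X p m y T' m' y'"
  unfolding runto_def by (meson order_trans)

lemma runto_Seq:
  assumes "runto X p m y T m1 y1" "runto X q m1 y1 T' m2 y2"
  shows "runto X (Seq p q) m y (T + T' + 1) m2 y2"
  using assms unfolding runto_def by (metis (no_types, lifting) add_mono exec.Seq le_refl)

lemma runto_Store:
  "runto X (Store (Const a) e) m y (num_size a + cost X m e + 1) (m(a := eval X m e)) y"
  unfolding runto_def using exec.Store[of X "Const a" e m y] by auto

lemma runto_Emit: "runto X (Emit e) m y (cost X m e + 1) m (y @ [eval X m e])"
  unfolding runto_def using exec.Emit by blast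

lemma runto_While:
  assumes guard: "\<And>i m. i \<le> n \<Longrightarrow> I i m \<Longrightarrow> (eval X m b \<noteq> 0 \<longleftrightarrow> i < n) \<and> cost X m b \<le> C"
    and body: "\<And>i m. i < n \<Longrightarrow> I i m \<Longrightarrow>
      \<exists>m'. runto X p m (y i) (T i) m' (y (Suc i)) \<and> I (Suc i) m'"
    and init: "I 0 m"
  shows "\<exists>m'. runto X (While b p) m (y 0) ((\<Sum>i<n. T i) + n * (C + 1) + C + 1) m' (y n) \<and> I n m'"
proof -
  \<comment> \<open>Induction on the number \<open>j\<close> of remaining rounds, since
    \<open>exec\<close> unfolds a loop from the front.\<close>
  have "\<exists>m'. runto X (While b p) m (y (n - j)) ((\<Sum>i=n-j..<n. T i) + j * (C + 1) + C + 1) m' (y n) \<and> I n m'"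
    if "j \<le> n" "I (n - j) m" for j m
    using that
  proof (induction j arbitrary: m)
    case 0
    then have "eval X m b = 0" "cost X m b \<le> C" using guard[of n m] by auto
    then show ?case using exec.WhileFalse[of X m b p "y n"] 0
      unfolding runto_def by (intro exI[of _ m]) auto
  next
    case (Suc j)
    let ?i = "n - Suc j"
    have i: "?i < n" "Suc ?i = n - j" using Suc.prems by auto
    obtain m1 where 1: "runto X p m (y ?i) (T ?i) m1 (y (n - j))" "I (n - j) m1"
      using body[OF i(1) Suc.prems(2)] i(2) by auto
    obtain m2 where 2: "runto X (While b p) m1 (y (n - j))
        ((\<Sum>i=n-j..<n. T i) + j * (C + 1) + C + 1) m2 (y n)" "I n m2"
      using Suc.IH[OF _ 1(2)] Suc.prems(1) by auto
    have g: "eval X m b \<noteq> 0" "cost X m b \<le> C" using guard[OF _ Suc.prems(2)] i by auto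
    have sum: "(\<Sum>i=?i..<n. T i) = T ?i + (\<Sum>i=n-j..<n. T i)"
      using i by (simp add: sum.atLeast_Suc_lessThan)
    obtain t1 t2 where t: "t1 \<le> T ?i" "exec X p (m, y ?i) t1 (m1, y (n - j))"
      "t2 \<le> (\<Sum>i=n-j..<n. T i) + j * (C + 1) + C + 1"
      "exec X (While b p) (m1, y (n - j)) t2 (m2, y n)"
      using 1(1) 2(1) unfolding runto_def by auto
    have "exec X (While b p) (m, y ?i) (cost X m b + t1 + t2 + 1) (m2, y n)"
      using exec.WhileTrue[OF g(1) t(2) t(4)] .
    moreover have "cost X m b + t1 + t2 + 1 \<le> (\<Sum>i=?i..<n. T i) + Suc j * (C + 1) + C + 1"
      using t(1,3) g(2) unfolding sum by simp
    ultimately show ?case using 2(2) unfolding runto_def by blast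
  qed
  from this[of n m] init show ?thesis by (simp add: atLeast0LessThan)
qed

text \<open>\<open>T\<close> also bounds the length of the result, so that it pays for reading the
  result again. The machine input \<open>X\<close> is arbitrary: the word worked on is the one
  stored in memory.\<close>

definition computes ::
    "('s \<Rightarrow> word) \<Rightarrow> ('s \<Rightarrow> nat) list \<Rightarrow> nat list \<Rightarrow> nat \<Rightarrow> prog \<Rightarrow> ('s \<Rightarrow> nat) \<Rightarrow> ('s \<Rightarrow> nat) \<Rightarrow> bool" where
  "computes w G ls D p T f \<longleftrightarrow>
     (\<forall>s X m y. holds w G ls s m \<longrightarrow>
        num_size (f s) \<le> T s \<and>
        (\<exists>m'. runto X p m y (T s) m' y \<and> same D m m' \<and> m' (cell D) = f s))"

abbreviation fits :: "('s \<Rightarrow> nat) list \<Rightarrow> nat list \<Rightarrow> nat \<Rightarrow> bool" where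
  "fits G ls D \<equiv> length ls = length G \<and> (\<forall>l\<in>set ls. l < D)"

text \<open>The code is parametric in the registers \<open>ls\<close> of the available quantities and in the first free
  register \<open>D\<close>, which also receives the result.\<close>

abbreviation code_for ::
    "('s \<Rightarrow> word) \<Rightarrow> ('s \<Rightarrow> nat) list \<Rightarrow> (nat list \<Rightarrow> nat \<Rightarrow> prog) \<Rightarrow> ('s \<Rightarrow> nat) \<Rightarrow> bool" where
  "code_for w G code f \<equiv> \<forall>ls D. fits G ls D \<longrightarrow>
     (\<exists>T. small w G T \<and> computes w G ls D (code ls D) T f)"

definition evals :: "('s \<Rightarrow> word) \<Rightarrow> ('s \<Rightarrow> nat) list \<Rightarrow> ('s \<Rightarrow> nat) \<Rightarrow> bool" where
  "evals w G f \<longleftrightarrow> (\<exists>code. code_for w G code f)"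

lemma evals_store:
  assumes e: "\<And>ls D s X m. fits G ls D \<Longrightarrow> holds w G ls s m \<Longrightarrow> eval X m (e ls) = f s"
    and c: "\<And>ls D. fits G ls D \<Longrightarrow>
      \<exists>T. small w G T \<and> (\<forall>s X m. holds w G ls s m \<longrightarrow> cost X m (e ls) \<le> T s)"
  shows "evals w G f"
  unfolding evals_def
proof (intro exI[of _ "\<lambda>ls D. Store (Const (cell D)) (e ls)"] allI impI)
  fix ls D assume ok: "fits G ls D"
  from c[OF ok] obtain T where T: "small w G T" "\<And>s X m. holds w G ls s m \<Longrightarrow> cost X m (e ls) \<le> T s"
    by blast
  let ?T = "\<lambda>s. T s + (num_size (cell D) + 1)"
  have "computes w G ls D (Store (Const (cell D)) (e ls)) ?T f"
    unfolding computes_def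
  proof (intro allI impI conjI)
    fix s X m y assume h: "holds w G ls s m"
    have ev: "eval X m (e ls) = f s" by (rule e[OF ok h])
    have le: "cost X m (e ls) \<le> T s" by (rule T(2)[OF h])
    show "num_size (f s) \<le> ?T s" using num_size_eval_le_cost[of X m "e ls"] le ev by simp
    have "runto X (Store (Const (cell D)) (e ls)) m y (?T s) (m(cell D := f s)) y"
      by (rule runto_mono[OF runto_Store[of X "cell D" "e ls" m y, unfolded ev]]) (use le in simp)
    moreover have "same D m (m(cell D := f s))" by (rule same_upd[OF same_refl order_refl])
    ultimately show "\<exists>m'. runto X (Store (Const (cell D)) (e ls)) m y (?T s) m' y \<and> same D m m' \<and>
        m' (cell D) = f s"
      by (intro exI[of _ "m(cell D := f s)"]) auto
  qed
  moreover have "small w G ?T" by (rule small_add[OF T(1) small_const])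
  ultimately show "\<exists>T. small w G T \<and> computes w G ls D (Store (Const (cell D)) (e ls)) T f"
    by blast
qed

lemma evals_const: "evals w G (\<lambda>_. n)"
  by (rule evals_store[where e="\<lambda>_. Const n"]) (auto intro!: exI[of _ "\<lambda>_. num_size n"] small_const)

lemma evals_var:
  assumes "f \<in> set G"
  shows "evals w G f"
proof -
  from assms obtain i where i: "i < length G" "G ! i = f" by (auto simp: in_set_conv_nth)
  show ?thesis
  proof (rule evals_store[where e="\<lambda>ls. Mem (Const (cell (ls ! i)))"])
    show *: "eval X m (Mem (Const (cell (ls ! i)))) = f s" if "holds w G ls s m" for ls s X m
      using that i by (simp add: holds_def list_all2_conv_all_nth)
    show "\<exists>T. small w G T \<and> (\<forall>s X m. holds w G ls s m \<longrightarrow> cost X m (Mem (Const (cell (ls ! i)))) \<le> T s)"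
      for ls
      using * by (intro exI[of _ "\<lambda>s. num_size (cell (ls ! i)) + num_size (f s)"] conjI
          small_add small_const small_num_size[OF small_var[OF assms]]) simp
  qed
qed

lemma evals_length: "evals w G (\<lambda>s. length (w s))"
proof (rule evals_store[where e="\<lambda>_. Mem (Const 2)"])
  show *: "eval X m (Mem (Const 2)) = length (w s)" if "holds w G ls s m" for ls s X m
    using that by (simp add: holds_def stored_def)
  show "\<exists>T. small w G T \<and> (\<forall>s X m. holds w G ls s m \<longrightarrow> cost X m (Mem (Const 2)) \<le> T s)" for ls
    using * by (intro exI[of _ "\<lambda>s. num_size 2 + num_size (length (w s))"] conjI
        small_add small_const small_num_size[OF small_length]) simp
qed

text \<open>Cells \<open>4 * i + 1\<close> beyond the stored word hold 0, the default of
  \<open>lookup\<close>, so no range check is performed.\<close>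

lemma evals_lookup:
  assumes "evals w G f"
  shows "evals w G (\<lambda>s. lookup (w s) (f s))"
proof -
  obtain cf where cf: "code_for w G cf f" using assms unfolding evals_def by blast
  let ?e = "\<lambda>D. Mem (Op Plus (Op Times (Const 4) (Mem (Const (cell D)))) (Const 1))"
  let ?p = "\<lambda>ls D. Seq (cf ls D) (Store (Const (cell D)) (?e D))"
  show ?thesis
    unfolding evals_def
  proof (intro exI[of _ ?p] allI impI)
    fix ls D assume ok: "fits G ls D"
    from cf[rule_format, OF ok] obtain T where T: "small w G T" "computes w G ls D (cf ls D) T f" by blast
    let ?S = "\<lambda>s. 5 * T s + num_size (lookup (w s) (f s)) + (2 * num_size (cell D) + 50)"
    have "computes w G ls D (?p ls D) ?S (\<lambda>s. lookup (w s) (f s))"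
      unfolding computes_def
    proof (intro allI impI conjI)
      fix s X m y assume h: "holds w G ls s m"
      from T(2) h obtain m1 where 1: "num_size (f s) \<le> T s" "runto X (cf ls D) m y (T s) m1 y"
        "same D m m1" "m1 (cell D) = f s" unfolding computes_def by blast
      have st: "stored (w s) m1" using same_stored[OF 1(3)] h by (simp add: holds_def)
      then have ev: "eval X m1 (?e D) = lookup (w s) (f s)"
        using 1(4) by (simp add: stored_def)
      have c: "cost X m1 (?e D) \<le> 20 + 2 * T s + num_size (cell D) + num_size (lookup (w s) (f s)) + T s"
        using num_size_mult[of 4 "f s"] num_size_add[of "4 * f s" 1] 1 num_size_consts st
        by (simp add: stored_def)
      show "num_size (lookup (w s) (f s)) \<le> ?S s" by simp
      have r2: "runto X (Store (Const (cell D)) (?e D)) m1 y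
          (num_size (cell D) + cost X m1 (?e D) + 1) (m1(cell D := lookup (w s) (f s))) y"
        using runto_Store[of X "cell D" "?e D" m1 y] unfolding ev .
      show "\<exists>m'. runto X (?p ls D) m y (?S s) m' y \<and> same D m m' \<and> m' (cell D) = lookup (w s) (f s)"
      proof (intro exI conjI)
        show "runto X (?p ls D) m y (?S s) (m1(cell D := lookup (w s) (f s))) y"
          by (rule runto_mono[OF runto_Seq[OF 1(2) r2]]) (use c in simp)
        show "same D m (m1(cell D := lookup (w s) (f s)))" by (rule same_upd[OF 1(3) order_refl])
      qed simp
    qed
    moreover have "small w G ?S"
      by (intro small_add small_mult small_const small_num_size_lookup T(1))
    ultimately show "\<exists>T. small w G T \<and> computes w G ls D (?p ls D) T (\<lambda>s. lookup (w s) (f s))" by blast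
  qed
qed

lemma evals_op:
  assumes "evals w G f" "evals w G g"
  shows "evals w G (\<lambda>s. apply_op opr (f s) (g s))"
proof -
  obtain cf where cf: "code_for w G cf f" using assms(1) unfolding evals_def by blast
  obtain cg where cg: "code_for w G cg g" using assms(2) unfolding evals_def by blast
  let ?e = "\<lambda>D. Op opr (Mem (Const (cell D))) (Mem (Const (cell (Suc D))))"
  let ?p = "\<lambda>ls D. Seq (cf ls D) (Seq (cg ls (Suc D)) (Store (Const (cell D)) (?e D)))"
  show ?thesis
    unfolding evals_def
  proof (intro exI[of _ ?p] allI impI)
    fix ls D assume ok: "fits G ls D"
    then have ok': "fits G ls (Suc D)" by auto
    from cf[rule_format, OF ok] obtain T where T: "small w G T" "computes w G ls D (cf ls D) T f" by blast
    from cg[rule_format, OF ok'] obtain U where U: "small w G U" "computes w G ls (Suc D) (cg ls (Suc D)) U g" by blast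
    let ?S = "\<lambda>s. 3 * T s + 3 * U s + (2 * num_size (cell D) + num_size (cell (Suc D)) + 3)"
    have "computes w G ls D (?p ls D) ?S (\<lambda>s. apply_op opr (f s) (g s))"
      unfolding computes_def
    proof (intro allI impI conjI)
      fix s X m y assume h: "holds w G ls s m"
      from T(2) h obtain m1 where 1: "num_size (f s) \<le> T s" "runto X (cf ls D) m y (T s) m1 y"
        "same D m m1" "m1 (cell D) = f s" unfolding computes_def by blast
      have "holds w G ls s m1" using holds_same[OF h 1(3)] ok by blast
      with U(2) obtain m2 where 2: "num_size (g s) \<le> U s" "runto X (cg ls (Suc D)) m1 y (U s) m2 y"
        "same (Suc D) m1 m2" "m2 (cell (Suc D)) = g s" unfolding computes_def by blast
      have fD: "m2 (cell D) = f s" using same_cell[OF 2(3)] 1(4) by simp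
      have sD: "same D m m2" by (rule same_trans[OF 1(3) 2(3)]) simp
      let ?v = "apply_op opr (f s) (g s)"
      have ev: "eval X m2 (?e D) = ?v" using fD 2(4) by simp
      have v: "num_size ?v \<le> T s + U s" using num_size_apply_op[of opr "f s" "g s"] 1(1) 2(1) by simp
      then show "num_size ?v \<le> ?S s" by simp
      have r3: "runto X (Store (Const (cell D)) (?e D)) m2 y
          (num_size (cell D) + cost X m2 (?e D) + 1) (m2(cell D := ?v)) y"
        using runto_Store[of X "cell D" "?e D" m2 y] unfolding ev .
      have "cost X m2 (?e D) \<le> 2 * T s + 2 * U s + num_size (cell D) + num_size (cell (Suc D))"
        using v 1(1) 2(1) fD 2(4) by simp
      then have "runto X (?p ls D) m y (?S s) (m2(cell D := ?v)) y"
        by (intro runto_mono[OF runto_Seq[OF 1(2) runto_Seq[OF 2(2) r3]]]) simp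
      moreover have "same D m (m2(cell D := ?v))" by (rule same_upd[OF sD order_refl])
      ultimately show "\<exists>m'. runto X (?p ls D) m y (?S s) m' y \<and> same D m m' \<and> m' (cell D) = ?v"
        by (intro exI[of _ "m2(cell D := ?v)"]) simp
    qed
    moreover have "small w G ?S"
      by (intro small_add small_mult small_const T(1) U(1))
    ultimately show "\<exists>T. small w G T \<and> computes w G ls D (?p ls D) T (\<lambda>s. apply_op opr (f s) (g s))"
      by blast
  qed
qed

lemma holds_lift:
  assumes h: "holds (lift w) (ext G) ls t m"
  shows "holds w G (take (length G) ls) (fst t) m"
proof -
  have "length ls = length G + 2" using h by (auto simp: holds_def ext_def dest: list_all2_lengthD)
  moreover have "m (cell (ls ! i)) = (G ! i) (fst t)" if "i < length G" for i
    using h that unfolding holds_def ext_def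
    by (auto simp: list_all2_conv_all_nth nth_append dest: spec[of _ i])
  ultimately show ?thesis using h by (auto simp: holds_def ext_def list_all2_conv_all_nth)
qed

lemma evals_lift:
  assumes "evals w G f"
  shows "evals (lift w) (ext G) (lift f)"
proof -
  obtain cf where cf: "code_for w G cf f" using assms unfolding evals_def by blast
  show ?thesis
    unfolding evals_def
  proof (intro exI[of _ "\<lambda>ls. cf (take (length G) ls)"] allI impI)
    fix ls D assume ok: "fits (ext G) ls D"
    let ?ls = "take (length G) ls"
    have "fits G ?ls D" using ok by (auto simp: ext_def dest: in_set_takeD)
    from cf[rule_format, OF this] obtain T where T: "small w G T" "computes w G ?ls D (cf ?ls D) T f" by blast
    have "holds w G ?ls (fst t) m" if "holds (lift w) (ext G) ls t m" for t m
      using holds_lift[OF that] .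
    then have "computes (lift w) (ext G) ls D (cf ?ls D) (lift T) (lift f)"
      using T(2) unfolding computes_def by blast
    then show "\<exists>T. small (lift w) (ext G) T \<and> computes (lift w) (ext G) ls D (cf ?ls D) T (lift f)"
      using small_lift[OF T(1)] by blast
  qed
qed

lemma evals_new:
  "evals w (ext G) (\<lambda>t. fst (snd t))" "evals w (ext G) (\<lambda>t. snd (snd t))"
  by (rule evals_var, simp add: ext_def)+

definition bump :: "nat \<Rightarrow> prog" where
  "bump c = Store (Const c) (Op Plus (Mem (Const c)) (Const 1))"

lemma runto_bump:
  assumes "m c = i"
  shows "runto X (bump c) m y (2 * num_size c + 2 * i + 6) (m(c := Suc i)) y"
proof -
  let ?e = "Op Plus (Mem (Const c)) (Const 1)"
  have "runto X (bump c) m y (num_size c + cost X m ?e + 1) (m(c := eval X m ?e)) y"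
    unfolding bump_def by (rule runto_Store)
  moreover have "eval X m ?e = Suc i" using assms by simp
  moreover have "cost X m ?e \<le> num_size c + 2 * i + 5"
    using assms num_size_le[of i] num_size_le[of "i + 1"] num_size_consts by simp
  ultimately show ?thesis by (auto elim: runto_mono)
qed

definition below :: "nat \<Rightarrow> nat \<Rightarrow> expr" where
  "below c c' = Op Less (Mem (Const c)) (Mem (Const c'))"

lemma below:
  assumes "m c = i" "m c' = b" "i \<le> b"
  shows "eval X m (below c c') \<noteq> 0 \<longleftrightarrow> i < b"
    "cost X m (below c c') \<le> num_size c + num_size c' + 2 * b + 4"
proof -
  show "eval X m (below c c') \<noteq> 0 \<longleftrightarrow> i < b" using assms by (simp add: below_def)
  show "cost X m (below c c') \<le> num_size c + num_size c' + 2 * b + 4"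
    using assms num_size_le[of i] num_size_le[of b] num_size_consts by (simp add: below_def)
qed

text \<open>The bound \<open>h\<close> on all intermediate accumulators excludes blow-ups such as
  iterated squaring. Register \<open>D\<close> holds the number of rounds, \<open>D+1\<close> the
  accumulator and \<open>D+2\<close> the counter; the body works from \<open>D+3\<close> on.\<close>

lemma evals_iter:
  assumes b: "evals w G b" "small w G b" and a: "evals w G a"
    and B: "evals (lift w) (ext G) (\<lambda>t. B (fst t) (fst (snd t)) (snd (snd t)))"
    and h: "small w G h" "\<And>s i. i \<le> b s \<Longrightarrow> rec_nat (a s) (B s) i \<le> h s"
  shows "evals w G (\<lambda>s. rec_nat (a s) (B s) (b s))"
proof -
  let ?B = "\<lambda>t. B (fst t) (fst (snd t)) (snd (snd t))"
  let ?R = "\<lambda>s. rec_nat (a s) (B s)"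
  obtain cb where cb: "code_for w G cb b" using b(1) unfolding evals_def by blast
  obtain ca where ca: "code_for w G ca a" using a unfolding evals_def by blast
  obtain cB where cB: "code_for (lift w) (ext G) cB ?B" using B unfolding evals_def by blast
  let ?body = "\<lambda>ls D. Seq (cB (ls @ [D+2, D+1]) (D+3))
    (Seq (Store (Const (cell (D+1))) (Mem (Const (cell (D+3))))) (bump (cell (D+2))))"
  let ?loop = "\<lambda>ls D. While (below (cell (D+2)) (cell D)) (?body ls D)"
  let ?p = "\<lambda>ls D. Seq (cb ls D) (Seq (ca ls (D+1)) (Seq (Store (Const (cell (D+2))) (Const 0))
     (Seq (?loop ls D) (Store (Const (cell D)) (Mem (Const (cell (D+1))))))))"
  show ?thesis
    unfolding evals_def
  proof (intro exI[of _ ?p] allI impI)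
    fix ls D assume ok: "fits G ls D"
    have ok1: "fits G ls (D+1)" using ok by auto
    have ok3: "fits (ext G) (ls @ [D+2, D+1]) (D+3)" using ok by (auto simp: ext_def)
    from cb[rule_format, OF ok] obtain Tb where Tb: "small w G Tb" "computes w G ls D (cb ls D) Tb b" by blast
    from ca[rule_format, OF ok1] obtain Ta where Ta: "small w G Ta" "computes w G ls (D+1) (ca ls (D+1)) Ta a" by blast
    from cB[rule_format, OF ok3] obtain TB where TB: "small (lift w) (ext G) TB"
      "computes (lift w) (ext G) (ls @ [D+2, D+1]) (D+3) (cB (ls @ [D+2, D+1]) (D+3)) TB ?B" by blast
    let ?n0 = "num_size (cell D)" and ?n1 = "num_size (cell (D+1))"
    let ?n2 = "num_size (cell (D+2))" and ?n3 = "num_size (cell (D+3))"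
    let ?U = "\<lambda>t. 2 * TB t + (2 * fst (snd t) + (2 * ?n2 + ?n1 + ?n3 + 20))"
    let ?C = "\<lambda>s. ?n2 + ?n0 + 2 * b s + 4"
    let ?L = "\<lambda>s. (\<Sum>i<b s. ?U (s, i, ?R s i)) + b s * (?C s + 1) + ?C s + 1"
    let ?S = "\<lambda>s. Tb s + Ta s + ?L s + h s + (?n0 + ?n1 + ?n2 + 20)"
    have L: "small w G ?L"
      by (intro small_add small_mult small_const b(2) small_sum[OF b(2) h(1)] TB(1) small_new h(2) less_imp_le)
    have "small w G ?S"
      by (rule small_add[OF small_add[OF small_add[OF small_add[OF Tb(1) Ta(1)] L] h(1)] small_const])
    moreover have "computes w G ls D (?p ls D) ?S (\<lambda>s. ?R s (b s))"
      unfolding computes_def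
    proof (intro allI impI conjI)
      fix s X m y assume hold: "holds w G ls s m"
      show "num_size (?R s (b s)) \<le> ?S s"
        using num_size_le[of "?R s (b s)"] h(2)[of "b s" s] by simp
      from Tb(2) hold obtain m1 where 1: "runto X (cb ls D) m y (Tb s) m1 y"
        "same D m m1" "m1 (cell D) = b s" unfolding computes_def by blast
      have "holds w G ls s m1" using holds_same[OF hold 1(2)] ok by blast
      with Ta(2) obtain m2 where 2: "runto X (ca ls (D+1)) m1 y (Ta s) m2 y"
        "same (D+1) m1 m2" "m2 (cell (D+1)) = a s" unfolding computes_def by blast
      let ?m3 = "m2(cell (D+2) := 0)"
      have r3: "runto X (Store (Const (cell (D+2))) (Const 0)) m2 y (?n2 + 2) ?m3 y"
        using runto_Store[of X "cell (D+2)" "Const 0" m2 y] num_size_consts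
        by (auto elim: runto_mono)
      define I where "I = (\<lambda>i m'. same D m m' \<and> m' (cell D) = b s \<and> m' (cell (D+1)) = ?R s i \<and>
        m' (cell (D+2)) = i)"
      have m3: "same D m ?m3" "?m3 (cell D) = b s"
        using same_upd[OF same_trans[OF 1(2) 2(2)]] same_cell[OF 2(2)] 1(3) by simp_all
      then have I0: "I 0 ?m3" using 2(3) by (simp add: I_def)
      have "\<exists>m'. runto X (?loop ls D) ?m3 y (?L s) m' y \<and> I (b s) m'"
      proof (rule runto_While[where I=I and y="\<lambda>_. y"])
        fix i m' assume "i \<le> b s" "I i m'"
        then show "(eval X m' (below (cell (D+2)) (cell D)) \<noteq> 0 \<longleftrightarrow> i < b s) \<and>
            cost X m' (below (cell (D+2)) (cell D)) \<le> ?C s"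
          using below[of m' "cell (D+2)" i "cell D" "b s" X] unfolding I_def by blast
      next
        fix i m' assume i: "i < b s" and I: "I i m'"
        have "holds w G ls s m'" using holds_same[OF hold] I ok unfolding I_def by blast
        then have "holds (lift w) (ext G) (ls @ [D+2, D+1]) (s, i, ?R s i) m'"
          by (rule holds_ext) (use I in \<open>simp_all add: I_def\<close>)
        with TB(2) obtain m4 where 4: "num_size (B s i (?R s i)) \<le> TB (s, i, ?R s i)"
          "runto X (cB (ls @ [D+2, D+1]) (D+3)) m' y (TB (s, i, ?R s i)) m4 y"
          "same (D+3) m' m4" "m4 (cell (D+3)) = B s i (?R s i)"
          unfolding computes_def by (metis fst_conv snd_conv)
        let ?v = "B s i (?R s i)"
        let ?m5 = "m4(cell (D+1) := ?v)"
        let ?m6 = "?m5(cell (D+2) := Suc i)"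
        have "m4 (cell D) = m' (cell D)" "m4 (cell (D+2)) = m' (cell (D+2))"
          by (rule same_cell[OF 4(3)], simp)+
        then have keep: "m4 (cell D) = b s" "m4 (cell (D+2)) = i"
          using I unfolding I_def by metis+
        have r5: "runto X (Store (Const (cell (D+1))) (Mem (Const (cell (D+3))))) m4 y
            (?n1 + (?n3 + num_size ?v) + 1) ?m5 y"
          using runto_Store[of X "cell (D+1)" "Mem (Const (cell (D+3)))" m4 y] 4(4) by simp
        have r6: "runto X (bump (cell (D+2))) ?m5 y (2 * ?n2 + 2 * i + 6) ?m6 y"
          by (rule runto_bump) (use keep in simp)
        have "same D m ?m6"
          using same_upd[OF same_upd[OF same_trans[OF _ 4(3)]]] I unfolding I_def by simp
        then have "I (Suc i) ?m6" using keep by (simp add: I_def)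
        moreover have "runto X (?body ls D) m' y (?U (s, i, ?R s i)) ?m6 y"
          by (rule runto_mono[OF runto_Seq[OF 4(2) runto_Seq[OF r5 r6]]]) (use 4(1) in simp)
        ultimately show "\<exists>m''. runto X (?body ls D) m' y (?U (s, i, ?R s i)) m'' y \<and> I (Suc i) m''"
          by blast
      qed (rule I0)
      then obtain m7 where 7: "runto X (?loop ls D) ?m3 y (?L s) m7 y" "I (b s) m7" by blast
      let ?v = "?R s (b s)"
      have r8: "runto X (Store (Const (cell D)) (Mem (Const (cell (D+1))))) m7 y
          (?n0 + (?n1 + num_size ?v) + 1) (m7(cell D := ?v)) y"
        using runto_Store[of X "cell D" "Mem (Const (cell (D+1)))" m7 y] 7(2) by (simp add: I_def)
      have "num_size ?v \<le> h s + 1" using num_size_le[of ?v] h(2)[of "b s" s] by simp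
      then have "runto X (?p ls D) m y (?S s) (m7(cell D := ?v)) y"
        by (intro runto_mono[OF runto_Seq[OF 1(1) runto_Seq[OF 2(1)
            runto_Seq[OF r3 runto_Seq[OF 7(1) r8]]]]]) simp
      moreover have "same D m (m7(cell D := ?v))"
        using same_upd[of D m m7 D] 7(2) unfolding I_def by simp
      ultimately show "\<exists>m'. runto X (?p ls D) m y (?S s) m' y \<and> same D m m' \<and> m' (cell D) = ?v"
        by (intro exI[of _ "m7(cell D := ?v)"]) simp
    qed
    ultimately show "\<exists>T. small w G T \<and> computes w G ls D (?p ls D) T (\<lambda>s. ?R s (b s))" by blast
  qed
qed

lemmas evals_add = evals_op[where opr=Plus, simplified apply_op.simps]
  and evals_diff = evals_op[where opr=Minus, simplified apply_op.simps]
  and evals_mult = evals_op[where opr=Times, simplified apply_op.simps]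
  and evals_div = evals_op[where opr=Quot, simplified apply_op.simps]
  and evals_mod = evals_op[where opr=Rem, simplified apply_op.simps]

lemma evals_power: "evals w G f \<Longrightarrow> evals w G (\<lambda>s. f s ^ n)"
  by (induction n) (simp_all add: evals_const[of _ _ 1, simplified] evals_mult)

abbreviation tests :: "('s \<Rightarrow> word) \<Rightarrow> ('s \<Rightarrow> nat) list \<Rightarrow> ('s \<Rightarrow> bool) \<Rightarrow> bool" where
  "tests w G P \<equiv> evals w G (\<lambda>s. of_bool (P s))"

lemma tests_eq: "evals w G f \<Longrightarrow> evals w G g \<Longrightarrow> tests w G (\<lambda>s. f s = g s)"
  using evals_op[where opr=Equal, of w G f g] by (simp add: of_bool_def)

lemma tests_less: "evals w G f \<Longrightarrow> evals w G g \<Longrightarrow> tests w G (\<lambda>s. f s < g s)"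
  using evals_op[where opr=Less, of w G f g] by (simp add: of_bool_def)

lemma tests_not: "tests w G P \<Longrightarrow> tests w G (\<lambda>s. \<not> P s)"
proof -
  assume "tests w G P"
  then have "evals w G (\<lambda>s. 1 - of_bool (P s))" by (rule evals_diff[OF evals_const])
  moreover have "1 - of_bool (P s) = (of_bool (\<not> P s) :: nat)" for s by simp
  ultimately show ?thesis by simp
qed

lemma tests_conj: "tests w G P \<Longrightarrow> tests w G Q \<Longrightarrow> tests w G (\<lambda>s. P s \<and> Q s)"
  using evals_mult[of w G "\<lambda>s. of_bool (P s)" "\<lambda>s. of_bool (Q s)"] by (simp add: of_bool_conj)

lemma tests_le: "evals w G f \<Longrightarrow> evals w G g \<Longrightarrow> tests w G (\<lambda>s. f s \<le> g s)"
  using tests_not[OF tests_less[of w G g f]] by (simp add: not_less)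

lemma tests_disj: "tests w G P \<Longrightarrow> tests w G Q \<Longrightarrow> tests w G (\<lambda>s. P s \<or> Q s)"
  using tests_not[OF tests_conj[OF tests_not tests_not], of w G P Q] by simp

lemma tests_imp: "tests w G P \<Longrightarrow> tests w G Q \<Longrightarrow> tests w G (\<lambda>s. P s \<longrightarrow> Q s)"
  using tests_not[OF tests_conj[OF _ tests_not], of w G P Q] by simp

lemma tests_even: "evals w G f \<Longrightarrow> tests w G (\<lambda>s. even (f s))"
  using tests_eq[OF evals_mod[OF _ evals_const[of _ _ 2]] evals_const[of _ _ 0], of w G f]
  by (simp add: even_iff_mod_2_eq_zero)

text \<open>Both branches are evaluated and the unwanted one is multiplied by 0, so arithmetic
  suffices.\<close>

lemma evals_if:
  assumes "tests w G P" "evals w G f" "evals w G g"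
  shows "evals w G (\<lambda>s. if P s then f s else g s)"
proof -
  have "evals w G (\<lambda>s. of_bool (P s) * f s + of_bool (\<not> P s) * g s)"
    by (intro evals_add evals_mult tests_not assms)
  moreover have "of_bool (P s) * f s + of_bool (\<not> P s) * g s = (if P s then f s else g s)" for s
    by simp
  ultimately show ?thesis by simp
qed

lemma evals_min: "evals w G f \<Longrightarrow> evals w G g \<Longrightarrow> evals w G (\<lambda>s. min (f s) (g s))"
  unfolding min_def by (intro evals_if tests_le)

text \<open>The search runs through all candidates without early exit; its accumulator is a truth
  value and hence bounded by 1.\<close>

lemma tests_ex:
  assumes "evals w G b" "small w G b"
    and P: "tests (lift w) (ext G) (\<lambda>t. P (fst t) (fst (snd t)))"
  shows "tests w G (\<lambda>s. \<exists>i<b s. P s i)"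
proof -
  let ?B = "\<lambda>s i a. of_bool (P s i \<or> \<not> a = 0) :: nat"
  have rec: "rec_nat 0 (?B s) n = of_bool (\<exists>i<n. P s i)" for s n
    by (induction n) (auto simp: less_Suc_eq)
  have "evals w G (\<lambda>s. rec_nat 0 (?B s) (b s))"
  proof (rule evals_iter[OF assms(1,2) evals_const _ small_const[of _ _ 1]])
    show "rec_nat 0 (?B s) i \<le> 1" for s i unfolding rec by simp
  qed (intro tests_disj tests_not tests_eq evals_const P evals_new)
  then show ?thesis unfolding rec .
qed

lemma tests_all:
  assumes "evals w G b" "small w G b"
    and P: "tests (lift w) (ext G) (\<lambda>t. P (fst t) (fst (snd t)))"
  shows "tests w G (\<lambda>s. \<forall>i<b s. P s i)"
  using tests_not[OF tests_ex[OF assms(1,2) tests_not[OF P]]] by simp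

text \<open>Dividing \<open>e s\<close> times avoids the power itself, which need not be
  polynomially bounded because the exponent varies.\<close>

lemma evals_div_power:
  assumes "evals w G f" "small w G f" "evals w G g" "evals w G e" "small w G e"
  shows "evals w G (\<lambda>s. f s div g s ^ e s)"
proof -
  have rec: "rec_nat (f s) (\<lambda>_ a. a div g s) n = f s div g s ^ n" for s n
    by (induction n) (simp_all add: div_mult2_eq[symmetric] mult.commute)
  have "evals w G (\<lambda>s. rec_nat (f s) (\<lambda>_ a. a div g s) (e s))"
    by (rule evals_iter[OF assms(4,5,1) _ assms(2)])
      (intro evals_div evals_new evals_lift[OF assms(3)], simp add: rec div_le_dividend)
  then show ?thesis by (simp add: rec)
qed

lemma small_power: "small w G f \<Longrightarrow> small w G (\<lambda>s. f s ^ n)"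
  by (induction n) (simp_all add: small_const[of _ _ 1, simplified] small_mult)

section \<open>Programs that emit a word\<close>

definition generates ::
    "('s \<Rightarrow> word) \<Rightarrow> ('s \<Rightarrow> nat) list \<Rightarrow> nat list \<Rightarrow> nat \<Rightarrow> prog \<Rightarrow> ('s \<Rightarrow> nat) \<Rightarrow> ('s \<Rightarrow> word) \<Rightarrow> bool" where
  "generates w G ls D p T F \<longleftrightarrow>
     (\<forall>s X m y. holds w G ls s m \<longrightarrow>
        (\<exists>m'. runto X p m y (T s) m' (y @ F s) \<and> same D m m'))"

abbreviation emits_code_for ::
    "('s \<Rightarrow> word) \<Rightarrow> ('s \<Rightarrow> nat) list \<Rightarrow> (nat list \<Rightarrow> nat \<Rightarrow> prog) \<Rightarrow> ('s \<Rightarrow> word) \<Rightarrow> bool" where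
  "emits_code_for w G code F \<equiv> \<forall>ls D. fits G ls D \<longrightarrow>
     (\<exists>T. small w G T \<and> generates w G ls D (code ls D) T F)"

definition emits :: "('s \<Rightarrow> word) \<Rightarrow> ('s \<Rightarrow> nat) list \<Rightarrow> ('s \<Rightarrow> word) \<Rightarrow> bool" where
  "emits w G F \<longleftrightarrow> (\<exists>code. emits_code_for w G code F)"

lemma emits_emit:
  assumes "evals w G f"
  shows "emits w G (\<lambda>s. [f s])"
proof -
  obtain cf where cf: "code_for w G cf f" using assms unfolding evals_def by blast
  let ?p = "\<lambda>ls D. Seq (cf ls D) (Emit (Mem (Const (cell D))))"
  show ?thesis
    unfolding emits_def
  proof (intro exI[of _ ?p] allI impI)
    fix ls D assume ok: "fits G ls D"
    from cf[rule_format, OF ok] obtain T where T: "small w G T" "computes w G ls D (cf ls D) T f" by blast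
    let ?S = "\<lambda>s. 2 * T s + (num_size (cell D) + 2)"
    have "generates w G ls D (?p ls D) ?S (\<lambda>s. [f s])"
      unfolding generates_def
    proof (intro allI impI)
      fix s X m y assume h: "holds w G ls s m"
      from T(2) h obtain m1 where 1: "num_size (f s) \<le> T s" "runto X (cf ls D) m y (T s) m1 y"
        "same D m m1" "m1 (cell D) = f s" unfolding computes_def by blast
      have "runto X (?p ls D) m y (?S s) m1 (y @ [f s])"
        using runto_Seq[OF 1(2) runto_Emit[of X "Mem (Const (cell D))"]] 1(1,4)
        by (auto elim: runto_mono)
      then show "\<exists>m'. runto X (?p ls D) m y (?S s) m' (y @ [f s]) \<and> same D m m'"
        using 1(3) by blast
    qed
    moreover have "small w G ?S" by (intro small_add small_mult small_const T(1))
    ultimately show "\<exists>T. small w G T \<and> generates w G ls D (?p ls D) T (\<lambda>s. [f s])" by blast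
  qed
qed

lemma emits_append:
  assumes "emits w G F" "emits w G H"
  shows "emits w G (\<lambda>s. F s @ H s)"
proof -
  obtain cF where cF: "emits_code_for w G cF F"
    using assms(1) unfolding emits_def by blast
  obtain cH where cH: "emits_code_for w G cH H"
    using assms(2) unfolding emits_def by blast
  let ?p = "\<lambda>ls D. Seq (cF ls D) (cH ls D)"
  show ?thesis
    unfolding emits_def
  proof (intro exI[of _ ?p] allI impI)
    fix ls D assume ok: "fits G ls D"
    from cF[rule_format, OF ok] obtain T where T: "small w G T" "generates w G ls D (cF ls D) T F" by blast
    from cH[rule_format, OF ok] obtain U where U: "small w G U" "generates w G ls D (cH ls D) U H" by blast
    let ?S = "\<lambda>s. T s + U s + 1"
    have "generates w G ls D (?p ls D) ?S (\<lambda>s. F s @ H s)"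
      unfolding generates_def
    proof (intro allI impI)
      fix s X m y assume h: "holds w G ls s m"
      from T(2) h obtain m1 where 1: "runto X (cF ls D) m y (T s) m1 (y @ F s)" "same D m m1"
        unfolding generates_def by blast
      have "holds w G ls s m1" using holds_same[OF h 1(2)] ok by blast
      with U(2) obtain m2 where 2: "runto X (cH ls D) m1 (y @ F s) (U s) m2 ((y @ F s) @ H s)"
        "same D m1 m2" unfolding generates_def by blast
      show "\<exists>m'. runto X (?p ls D) m y (?S s) m' (y @ F s @ H s) \<and> same D m m'"
        using runto_Seq[OF 1(1) 2(1)] same_trans[OF 1(2) 2(2)] by auto
    qed
    moreover have "small w G ?S" by (intro small_add small_const T(1) U(1))
    ultimately show "\<exists>T. small w G T \<and> generates w G ls D (?p ls D) T (\<lambda>s. F s @ H s)" by blast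
  qed
qed

lemma emits_lift:
  assumes "emits w G F"
  shows "emits (lift w) (ext G) (lift F)"
proof -
  obtain cF where cF: "emits_code_for w G cF F"
    using assms unfolding emits_def by blast
  show ?thesis
    unfolding emits_def
  proof (intro exI[of _ "\<lambda>ls. cF (take (length G) ls)"] allI impI)
    fix ls D assume ok: "fits (ext G) ls D"
    let ?ls = "take (length G) ls"
    have "fits G ?ls D" using ok by (auto simp: ext_def dest: in_set_takeD)
    from cF[rule_format, OF this] obtain T where T: "small w G T" "generates w G ?ls D (cF ?ls D) T F" by blast
    then have "generates (lift w) (ext G) ls D (cF ?ls D) (lift T) (lift F)"
      using holds_lift unfolding generates_def by blast
    then show "\<exists>T. small (lift w) (ext G) T \<and> generates (lift w) (ext G) ls D (cF ?ls D) T (lift F)"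
      using small_lift[OF T(1)] by blast
  qed
qed

text \<open>Register \<open>D+1\<close>, the place of the accumulator in \<open>ext\<close>, is kept
  at 0, since only the counter matters here.\<close>

lemma emits_concat_map:
  assumes b: "evals w G b" "small w G b"
    and F: "emits (lift w) (ext G) (\<lambda>t. F (fst t) (fst (snd t)))"
  shows "emits w G (\<lambda>s. concat (map (F s) [0..<b s]))"
proof -
  let ?F = "\<lambda>t. F (fst t) (fst (snd t))"
  obtain cb where cb: "code_for w G cb b" using b(1) unfolding evals_def by blast
  obtain cF where cF: "emits_code_for (lift w) (ext G) cF ?F"
    using F unfolding emits_def by blast
  let ?body = "\<lambda>ls D. Seq (cF (ls @ [D+2, D+1]) (D+3)) (bump (cell (D+2)))"
  let ?loop = "\<lambda>ls D. While (below (cell (D+2)) (cell D)) (?body ls D)"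
  let ?p = "\<lambda>ls D. Seq (cb ls D) (Seq (Store (Const (cell (D+1))) (Const 0))
     (Seq (Store (Const (cell (D+2))) (Const 0)) (?loop ls D)))"
  show ?thesis
    unfolding emits_def
  proof (intro exI[of _ ?p] allI impI)
    fix ls D assume ok: "fits G ls D"
    have ok3: "fits (ext G) (ls @ [D+2, D+1]) (D+3)" using ok by (auto simp: ext_def)
    from cb[rule_format, OF ok] obtain Tb where Tb: "small w G Tb" "computes w G ls D (cb ls D) Tb b" by blast
    from cF[rule_format, OF ok3] obtain TF where TF: "small (lift w) (ext G) TF"
      "generates (lift w) (ext G) (ls @ [D+2, D+1]) (D+3) (cF (ls @ [D+2, D+1]) (D+3)) TF ?F" by blast
    let ?n0 = "num_size (cell D)" and ?n1 = "num_size (cell (D+1))"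
    let ?n2 = "num_size (cell (D+2))"
    let ?U = "\<lambda>t. TF t + (2 * fst (snd t) + (2 * ?n2 + 7))"
    let ?C = "\<lambda>s. ?n2 + ?n0 + 2 * b s + 4"
    let ?L = "\<lambda>s. (\<Sum>i<b s. ?U (s, i, 0)) + b s * (?C s + 1) + ?C s + 1"
    let ?S = "\<lambda>s. Tb s + ?L s + (?n1 + ?n2 + 20)"
    have L: "small w G ?L"
      by (intro small_add small_mult small_const b(2) small_sum[OF b(2) small_const[of _ _ 0]] TF(1) small_new) simp
    have "small w G ?S"
      by (rule small_add[OF small_add[OF Tb(1) L] small_const])
    moreover have "generates w G ls D (?p ls D) ?S (\<lambda>s. concat (map (F s) [0..<b s]))"
      unfolding generates_def
    proof (intro allI impI)
      fix s X m y assume hold: "holds w G ls s m"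
      from Tb(2) hold obtain m1 where 1: "runto X (cb ls D) m y (Tb s) m1 y"
        "same D m m1" "m1 (cell D) = b s" unfolding computes_def by blast
      let ?m2 = "m1(cell (D+1) := 0)"
      let ?m3 = "?m2(cell (D+2) := 0)"
      have r2: "runto X (Store (Const (cell (D+1))) (Const 0)) m1 y (?n1 + 2) ?m2 y"
        using runto_Store[of X "cell (D+1)" "Const 0" m1 y] num_size_consts
        by (auto elim: runto_mono)
      have r3: "runto X (Store (Const (cell (D+2))) (Const 0)) ?m2 y (?n2 + 2) ?m3 y"
        using runto_Store[of X "cell (D+2)" "Const 0" ?m2 y] num_size_consts
        by (auto elim: runto_mono)
      define I where "I = (\<lambda>i m'. same D m m' \<and> m' (cell D) = b s \<and> m' (cell (D+1)) = 0 \<and>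
        m' (cell (D+2)) = i)"
      define Y where "Y = (\<lambda>i. y @ concat (map (F s) [0..<i]))"
      have I0: "I 0 ?m3"
        using same_upd[OF same_upd[OF 1(2)]] 1(3) by (simp add: I_def)
      have "\<exists>m'. runto X (?loop ls D) ?m3 (Y 0) (?L s) m' (Y (b s)) \<and> I (b s) m'"
      proof (rule runto_While[where I=I])
        fix i m' assume "i \<le> b s" "I i m'"
        then show "(eval X m' (below (cell (D+2)) (cell D)) \<noteq> 0 \<longleftrightarrow> i < b s) \<and>
            cost X m' (below (cell (D+2)) (cell D)) \<le> ?C s"
          using below[of m' "cell (D+2)" i "cell D" "b s" X] unfolding I_def by blast
      next
        fix i m' assume i: "i < b s" and I: "I i m'"
        have "holds w G ls s m'" using holds_same[OF hold] I ok unfolding I_def by blast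
        then have "holds (lift w) (ext G) (ls @ [D+2, D+1]) (s, i, 0) m'"
          by (rule holds_ext) (use I in \<open>simp_all add: I_def\<close>)
        with TF(2) obtain m4 where 4:
          "runto X (cF (ls @ [D+2, D+1]) (D+3)) m' (Y i) (TF (s, i, 0)) m4 (Y i @ F s i)"
          "same (D+3) m' m4"
          unfolding generates_def by (metis fst_conv snd_conv)
        have Y: "Y i @ F s i = Y (Suc i)" by (simp add: Y_def)
        let ?m6 = "m4(cell (D+2) := Suc i)"
        have keep: "m4 (cell D) = b s" "m4 (cell (D+1)) = 0" "m4 (cell (D+2)) = i"
          using same_cell[OF 4(2), of D] same_cell[OF 4(2), of "D+1"] same_cell[OF 4(2), of "D+2"] I
          unfolding I_def by simp_all
        have r6: "runto X (bump (cell (D+2))) m4 (Y (Suc i)) (2 * ?n2 + 2 * i + 6) ?m6 (Y (Suc i))"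
          by (rule runto_bump) (simp only: keep)
        have "same D m ?m6"
          using same_upd[OF same_trans[OF _ 4(2)]] I unfolding I_def by simp
        then have "I (Suc i) ?m6" using keep by (simp add: I_def)
        moreover have "runto X (?body ls D) m' (Y i) (?U (s, i, 0)) ?m6 (Y (Suc i))"
          by (rule runto_mono[OF runto_Seq[OF 4(1)[unfolded Y] r6]]) simp
        ultimately show "\<exists>m''. runto X (?body ls D) m' (Y i) (?U (s, i, 0)) m'' (Y (Suc i)) \<and> I (Suc i) m''"
          by blast
      qed (rule I0)
      then obtain m7 where 7: "runto X (?loop ls D) ?m3 y (?L s) m7 (Y (b s))" "I (b s) m7"
        by (auto simp: Y_def)
      have "runto X (?p ls D) m y (?S s) m7 (Y (b s))"
        by (rule runto_mono[OF runto_Seq[OF 1(1) runto_Seq[OF r2 runto_Seq[OF r3 7(1)]]]]) simp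
      then show "\<exists>m'. runto X (?p ls D) m y (?S s) m' (y @ concat (map (F s) [0..<b s])) \<and> same D m m'"
        using 7(2) unfolding I_def Y_def by blast
    qed
    ultimately show "\<exists>T. small w G T \<and>
        generates w G ls D (?p ls D) T (\<lambda>s. concat (map (F s) [0..<b s]))" by blast
  qed
qed

text \<open>Unlike an unwanted number, an unwanted output cannot be cancelled afterwards. Each
  branch is therefore a loop with 0 or 1 rounds.\<close>

lemma emits_if:
  assumes P: "tests w G P" and F: "emits w G F" and H: "emits w G H"
  shows "emits w G (\<lambda>s. if P s then F s else H s)"
proof -
  have one: "small w G (\<lambda>s. of_bool (Q s))" for Q :: "'a \<Rightarrow> bool"
    by (rule small_mono[OF small_const[of w G 1]]) simp
  have "emits w G (\<lambda>s. concat (map (\<lambda>_. F s) [0..<of_bool (P s)]) @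
      concat (map (\<lambda>_. H s) [0..<of_bool (\<not> P s)]))"
    by (intro emits_append emits_concat_map P tests_not one emits_lift F H)
  moreover have "concat (map (\<lambda>_. F s) [0..<of_bool (P s)]) @ concat (map (\<lambda>_. H s) [0..<of_bool (\<not> P s)]) =
      (if P s then F s else H s)" for s by simp
  ultimately show ?thesis by (simp only:)
qed

lemma emits_map:
  assumes "evals w G b" "small w G b" "evals (lift w) (ext G) (\<lambda>t. f (fst t) (fst (snd t)))"
  shows "emits w G (\<lambda>s. map (f s) [0..<b s])"
  using emits_concat_map[OF assms(1,2), of "\<lambda>s i. [f s i]"] emits_emit[OF assms(3)]
  by (simp add: concat_map_singleton)

section \<open>Appending a program to a given reduction\<close>

lemma exec_word_size:
  assumes "exec x p s t s'"
  shows "word_size (snd s') \<le> word_size (snd s) + t"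
  using assms
proof (induction rule: exec.induct)
  case (Emit e m y)
  then show ?case using num_size_eval_le_cost[of x m e] by (simp add: word_size_def)
qed auto

text \<open>Cell 1 is where a relocated program leaves the first number of its output, so the
  expression can be evaluated right after it.\<close>

definition polynomial :: "(nat \<Rightarrow> nat) \<Rightarrow> bool" where
  "polynomial h \<longleftrightarrow> (\<exists>e. \<forall>x m. eval x m e = h (m 1))"

lemma polynomial_id: "polynomial (\<lambda>n. n)"
  unfolding polynomial_def by (rule exI[of _ "Mem (Const 1)"]) simp

lemma polynomial_const: "polynomial (\<lambda>_. c)"
  unfolding polynomial_def by (rule exI[of _ "Const c"]) simp

lemma polynomial_add: "polynomial f \<Longrightarrow> polynomial g \<Longrightarrow> polynomial (\<lambda>n. f n + g n)"
  unfolding polynomial_def by (metis eval.simps(5) apply_op.simps(1))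

lemma polynomial_mult: "polynomial f \<Longrightarrow> polynomial g \<Longrightarrow> polynomial (\<lambda>n. f n * g n)"
  unfolding polynomial_def by (metis eval.simps(5) apply_op.simps(3))

lemma polynomial_power: "polynomial f \<Longrightarrow> polynomial (\<lambda>n. f n ^ c)"
  by (induction c) (simp_all add: polynomial_mult polynomial_const[of 1, simplified])

lemma stored_empty: "stored [] (\<lambda>_. 0)"
  by (simp add: stored_def lookup_def)

lemma computable_polynomial:
  assumes "computable f" "polynomial h"
  shows "computable (\<lambda>n. h (f n))"
proof -
  obtain p where p: "\<And>n. \<exists>t. runs p [n] t [f n]" using assms(1) unfolding computable_def by blast
  obtain e where e: "\<And>x m. eval x m e = h (m 1)" using assms(2) unfolding polynomial_def by blast
  have "\<exists>t. runs (Seq (reloc p) (Emit e)) [n] t [h (f n)]" for n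
  proof -
    obtain t m where "exec [n] p (\<lambda>_. 0, []) t (m, [f n])" using p[of n] unfolding runs_def by blast
    from exec_reloc[OF this order_refl, of "\<lambda>_. 0" "[]"] stored_empty
    obtain M t' where M: "exec [n] (reloc p) (\<lambda>_. 0, []) t' (M, [])" "stored [f n] M" by auto
    have "M (4 * 0 + 1) = lookup [f n] 0" using M(2) unfolding stored_def by blast
    then have "eval [n] M e = h (f n)" by (simp add: e lookup_def)
    then have "exec [n] (Emit e) (M, []) (cost [n] M e + 1) (M, [h (f n)])"
      using exec.Emit[of "[n]" e M "[]"] by simp
    then show ?thesis using exec.Seq[OF M(1)] unfolding runs_def by blast
  qed
  then show ?thesis unfolding computable_def by blast
qed

text \<open>The exponent 10 splits as 7 for the constant 100, 2 for the quadratic overhead of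
  relocation, and 1 for doubling when the two running times are added.\<close>

lemma time_bound:
  fixes t c :: nat
  shows "100 * (t + 1) * t + (t + 2) ^ c + 1 \<le> (t + 2) ^ (c + 10)"
proof -
  have p: "1 \<le> (t + 2) ^ c" by simp
  have "(2::nat) ^ 7 \<le> (t + 2) ^ 7" by (rule power_mono) auto
  then have seven: "128 \<le> (t + 2) ^ 7" by simp
  have "100 * (t + 1) * t + 1 \<le> 128 * (t + 2) ^ 2"
    by (simp add: power2_eq_square algebra_simps)
  also have "\<dots> \<le> (t + 2) ^ 7 * (t + 2) ^ 2" using seven by (rule mult_le_mono1)
  also have "\<dots> = (t + 2) ^ 9" by (simp add: power_add[symmetric])
  finally have "100 * (t + 1) * t + (t + 2) ^ c + 1 \<le> (t + 2) ^ 9 * 1 + 1 * (t + 2) ^ c" by simp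
  also have "\<dots> \<le> (t + 2) ^ 9 * (t + 2) ^ c + (t + 2) ^ 9 * (t + 2) ^ c"
    by (intro add_mono mult_mono p) auto
  also have "\<dots> \<le> (t + 2) * ((t + 2) ^ 9 * (t + 2) ^ c)" by simp
  also have "\<dots> = (t + 2) ^ (1 + (9 + c))" by (simp only: power_add power_one_right)
  also have "1 + (9 + c) = c + 10" by simp
  finally show ?thesis .
qed

text \<open>The second program runs in time polynomial in the time \<open>t\<close> of the first,
  and a power of an fpt bound is again an fpt bound. Monotonicity of \<open>h\<close> enters because
  the first reduction only guarantees that its parameter is at most \<open>g k\<close>.\<close>

theorem fpt_reducible_emits:
  assumes L: "fpt_reducible L L0" and F: "emits (\<lambda>z. z) [] F"
    and h: "polynomial h" "mono h"
    and red: "\<And>x k. \<exists>x' k'. F (k # x) = k' # x' \<and> k' \<le> h k \<and> ((x, k) \<in> L0 \<longleftrightarrow> (x', k') \<in> L')"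
  shows "fpt_reducible L L'"
proof -
  obtain p f g c where f: "computable f" and g: "computable g" and
    p: "\<And>x k. \<exists>x' k' t. runs p (k # x) t (k' # x') \<and> t \<le> f k * (word_size x + 1) ^ c \<and>
           k' \<le> g k \<and> ((x, k) \<in> L \<longleftrightarrow> (x', k') \<in> L0)"
    using L unfolding fpt_reducible_def by blast
  obtain code where "\<And>ls D. fits ([]::(word \<Rightarrow> nat) list) ls D \<Longrightarrow>
      \<exists>T. small (\<lambda>z. z) [] T \<and> generates (\<lambda>z. z) [] ls D (code ls D) T F"
    using F unfolding emits_def by blast
  from this[of "[]" 0] obtain T where T: "small (\<lambda>z. z) [] T" "generates (\<lambda>z. z) [] [] 0 (code [] 0) T F"
    by auto
  obtain c1 where c1: "\<And>z. T z \<le> word_base z ^ c1" using T(1) unfolding small_def by auto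
  let ?q = "Seq (reloc p) (code [] 0)"
  let ?e = "c1 + 10"
  show ?thesis
    unfolding fpt_reducible_def
  proof (rule exI[of _ ?q], rule exI[of _ "\<lambda>k. (f k + 2) ^ ?e"], rule exI[of _ "\<lambda>k. h (g k)"],
      rule exI[of _ "c * ?e"], intro conjI allI)
    show "computable (\<lambda>k. (f k + 2) ^ ?e)"
      by (rule computable_polynomial[OF f]) (intro polynomial_power polynomial_add polynomial_id polynomial_const)
    show "computable (\<lambda>k. h (g k))" by (rule computable_polynomial[OF g h(1)])
    fix x k
    obtain x1 k1 t where 1: "runs p (k # x) t (k1 # x1)" "t \<le> f k * (word_size x + 1) ^ c"
      "k1 \<le> g k" "(x, k) \<in> L \<longleftrightarrow> (x1, k1) \<in> L0" using p by blast
    obtain x2 k2 where 2: "F (k1 # x1) = k2 # x2" "k2 \<le> h k1" "(x1, k1) \<in> L0 \<longleftrightarrow> (x2, k2) \<in> L'"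
      using red by blast
    let ?z = "k1 # x1"
    obtain m where m: "exec (k # x) p (\<lambda>_. 0, []) t (m, ?z)" using 1(1) unfolding runs_def by blast
    \<comment> \<open>Every emitted number was paid for when it was evaluated, so the intermediate
      word is no larger than the running time.\<close>
    have ws: "word_size ?z \<le> t" using exec_word_size[OF m] by (simp add: word_size_def)
    then have len: "length ?z \<le> t" using length_le_word_size[of ?z] by linarith
    from exec_reloc[OF m, of t "\<lambda>_. 0" "[]"] stored_empty len
    obtain M t1 where M: "exec (k # x) (reloc p) (\<lambda>_. 0, []) t1 (M, [])" "stored ?z M"
      "t1 \<le> 100 * (t + 1) * t" by auto
    have "holds (\<lambda>z. z) [] [] ?z M" using M(2) by (simp add: holds_def)
    from T(2)[unfolded generates_def, rule_format, OF this, of "k # x" "[]"]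
    obtain M' where "runto (k # x) (code [] 0) M [] (T ?z) M' (F ?z)" by auto
    then obtain t2 where t2: "t2 \<le> T ?z" "exec (k # x) (code [] 0) (M, []) t2 (M', k2 # x2)"
      unfolding runto_def 2(1) by blast
    have "t2 \<le> (t + 2) ^ c1"
      using t2(1) c1[of ?z] power_mono[of "word_base ?z" "t + 2" c1] ws by (simp add: word_base_def)
    then have "t1 + t2 + 1 \<le> (t + 2) ^ ?e" using time_bound[of t c1] M(3) by linarith
    also have "\<dots> \<le> ((f k + 2) * (word_size x + 1) ^ c) ^ ?e"
    proof (rule power_mono)
      have "1 \<le> (word_size x + 1) ^ c" by simp
      then have "t + 2 \<le> f k * (word_size x + 1) ^ c + 2 * (word_size x + 1) ^ c"
        using 1(2) by linarith
      then show "t + 2 \<le> (f k + 2) * (word_size x + 1) ^ c" by (simp only: add_mult_distrib)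
    qed simp
    finally have "t1 + t2 + 1 \<le> (f k + 2) ^ ?e * (word_size x + 1) ^ (c * ?e)"
      by (simp only: power_mult_distrib power_mult)
    moreover have "runs ?q (k # x) (t1 + t2 + 1) (k2 # x2)"
      unfolding runs_def using exec.Seq[OF M(1) t2(2)] by blast
    moreover have "k2 \<le> h (g k)" using 2(2) monoD[OF h(2) 1(3)] by simp
    ultimately show "\<exists>x' k' t. runs ?q (k # x) t (k' # x') \<and>
        t \<le> (f k + 2) ^ ?e * (word_size x + 1) ^ (c * ?e) \<and> k' \<le> h (g k) \<and>
        ((x, k) \<in> L \<longleftrightarrow> (x', k') \<in> L')"
      using 1(4) 2(3) by blast
  qed
qed

section \<open>The matching instance of a slot system\<close>

definition side_size :: "nat \<Rightarrow> nat \<Rightarrow> nat" where "side_size K N = K + 1 + K * N"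

definition option_agent :: "nat \<Rightarrow> nat \<Rightarrow> nat \<Rightarrow> nat \<Rightarrow> nat" where "option_agent K N i j = K + 1 + (i * N + j)"

definition slot_of :: "nat \<Rightarrow> nat \<Rightarrow> nat \<Rightarrow> nat" where "slot_of K N v = (v - (K + 1)) div N"

definition option_of :: "nat \<Rightarrow> nat \<Rightarrow> nat \<Rightarrow> nat" where "option_of K N v = (v - (K + 1)) mod N"

text \<open>Slots \<open>i < K\<close>, each with options \<open>j < N\<close>; \<open>dem i j i' j'\<close> says that option \<open>j\<close> of slot \<open>i\<close>
  requires option \<open>j'\<close> of slot \<open>i'\<close>. The man \<open>u\<close> and the woman \<open>u\<close> are matched initially. Those
  numbered \<open>i \<le> K\<close> are \<open>z\<^sub>i\<close> and \<open>s\<^sub>i\<close>; those numbered \<open>option_agent K N i j\<close> are \<open>a\<^sub>i\<^sub>j\<close> and \<open>b\<^sub>i\<^sub>j\<close>. The only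
  ties are those of the \<open>s\<^sub>i\<close> with \<open>i < K\<close>, over the \<open>a\<^sub>i\<^sub>j\<close> (and also \<open>z\<^sub>0\<close> for \<open>i = 0\<close>):
  \<open>s\<^sub>i\<close> chooses option \<open>j\<close> by marrying \<open>a\<^sub>i\<^sub>j\<close>, which leaves \<open>b\<^sub>i\<^sub>j\<close> to \<open>z\<^sub>i\<^sub>+\<^sub>1\<close>.\<close>

definition acceptable :: "nat \<Rightarrow> nat \<Rightarrow> (nat \<Rightarrow> nat \<Rightarrow> bool) \<Rightarrow> (nat \<Rightarrow> nat \<Rightarrow> nat \<Rightarrow> nat \<Rightarrow> bool) \<Rightarrow>
    nat \<Rightarrow> nat \<Rightarrow> bool" where
  "acceptable K N valid dem u v \<longleftrightarrow>
     (if u \<le> K then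
        if v \<le> K then u = v \<or> u = 0 \<and> v = K
        else u = slot_of K N v + 1 \<and> valid (slot_of K N v) (option_of K N v)
      else if v \<le> K then v = slot_of K N u
      else u = v \<or> dem (slot_of K N v) (option_of K N v) (slot_of K N u) (option_of K N u))"

text \<open>The rank of the woman \<open>v\<close> for the man \<open>u\<close> (\<open>man_rank\<close>) and that of \<open>u\<close> for \<open>v\<close> (\<open>woman_rank\<close>); the
  agents \<open>z\<^sub>0\<close> and \<open>s\<^sub>K\<close> are each other's last choice.\<close>

definition man_rank :: "nat \<Rightarrow> nat \<Rightarrow> (nat \<Rightarrow> nat \<Rightarrow> bool) \<Rightarrow> (nat \<Rightarrow> nat \<Rightarrow> nat \<Rightarrow> nat \<Rightarrow> bool) \<Rightarrow>
    nat \<Rightarrow> nat \<Rightarrow> nat" where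
  "man_rank K N valid dem u v = (if acceptable K N valid dem u v then
      if u = v then side_size K N + 5 else if v \<le> K then if u \<le> K then side_size K N + 6 else 1 else 1 + v
    else 0)"

definition woman_rank :: "nat \<Rightarrow> nat \<Rightarrow> (nat \<Rightarrow> nat \<Rightarrow> bool) \<Rightarrow> (nat \<Rightarrow> nat \<Rightarrow> nat \<Rightarrow> nat \<Rightarrow> bool) \<Rightarrow>
    nat \<Rightarrow> nat \<Rightarrow> nat" where
  "woman_rank K N valid dem u v = (if acceptable K N valid dem u v then
      if u = v then 1 else if v \<le> K then if v = 0 then 1 else 2
      else if u \<le> K then side_size K N + 5 else 1 + u
    else 0)"

definition agent_rank :: "nat \<Rightarrow> nat \<Rightarrow> (nat \<Rightarrow> nat \<Rightarrow> bool) \<Rightarrow> (nat \<Rightarrow> nat \<Rightarrow> nat \<Rightarrow> nat \<Rightarrow> bool) \<Rightarrow>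
    nat \<Rightarrow> nat \<Rightarrow> nat" where
  "agent_rank K N valid dem a b = (if a < side_size K N
     then if side_size K N \<le> b then man_rank K N valid dem a (b - side_size K N) else 0
     else if b < side_size K N then woman_rank K N valid dem b (a - side_size K N) else 0)"

text \<open>Demanding slots are those from \<open>k\<close> on, demanded slots those below. No slot
  does both, which keeps desertions from cascading.\<close>

locale gadget =
  fixes K N k :: nat and valid :: "nat \<Rightarrow> nat \<Rightarrow> bool"
    and dem :: "nat \<Rightarrow> nat \<Rightarrow> nat \<Rightarrow> nat \<Rightarrow> bool"
  assumes K: "1 \<le> K" and N: "2 \<le> N"
    and dem: "dem i j i' j' \<Longrightarrow> i' < k \<and> k \<le> i"
begin

abbreviation "side \<equiv> side_size K N"
abbreviation "ag \<equiv> option_agent K N"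
abbreviation "sl \<equiv> slot_of K N"
abbreviation "op \<equiv> option_of K N"
abbreviation "edge \<equiv> acceptable K N valid dem"
abbreviation "rm \<equiv> man_rank K N valid dem"
abbreviation "rw \<equiv> woman_rank K N valid dem"
abbreviation "rank \<equiv> agent_rank K N valid dem"

lemmas side_def = side_size_def and ag_def = option_agent_def and sl_def = slot_of_def and op_def = option_of_def
  and edge_def = acceptable_def and rm_def = man_rank_def and rw_def = woman_rank_def and rank_def = agent_rank_def

lemma ag_simps [simp]:
  assumes "j < N"
  shows "sl (ag i j) = i" "op (ag i j) = j"
  using assms by (simp_all add: sl_def op_def ag_def)

lemma ag_gt [simp]: "K < ag i j" "\<not> ag i j \<le> K" "\<not> ag i j < K"
  by (simp_all add: ag_def)

lemma ag_neq [simp]: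
  assumes "x \<le> K"
  shows "x \<noteq> ag i j" "ag i j \<noteq> x"
  using assms ag_gt(2) by metis+

lemma ag_less [simp]: "i < K \<Longrightarrow> j < N \<Longrightarrow> ag i j < side"
proof -
  assume "i < K" "j < N"
  then have "i * N + j < (i + 1) * N" by simp
  also have "\<dots> \<le> K * N" using \<open>i < K\<close> by (intro mult_le_mono1) simp
  finally show ?thesis by (simp add: ag_def side_def)
qed

lemma ag_eq:
  assumes "K < v"
  shows "ag (sl v) (op v) = v" "op v < N"
proof -
  show "op v < N" using N by (simp add: op_def)
  show "ag (sl v) (op v) = v" using assms by (simp add: ag_def sl_def op_def)
qed

lemma sl_less: "K < v \<Longrightarrow> v < side \<Longrightarrow> sl v < K"
  using N unfolding sl_def side_def by (intro less_mult_imp_div_less) simp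

lemma ag_cases:
  assumes "v < side"
  obtains "v \<le> K" | i j where "i < K" "j < N" "v = ag i j"
  using assms ag_eq[of v] sl_less[of v] not_le by metis

lemma ag_inject: "j < N \<Longrightarrow> j' < N \<Longrightarrow> ag i j = ag i' j' \<longleftrightarrow> i = i' \<and> j = j'"
  using ag_simps by metis

text \<open>A matching as a relation between the numbers of men and of women, so that the
  combinatorial argument is free of two-element sets and of unmatched cases.\<close>

definition stable :: "(nat \<Rightarrow> nat \<Rightarrow> bool) \<Rightarrow> bool" where
  "stable P \<longleftrightarrow>
     (\<forall>u v. P u v \<longrightarrow> u < side \<and> v < side \<and> edge u v) \<and>
     (\<forall>u v v'. P u v \<longrightarrow> P u v' \<longrightarrow> v = v') \<and> (\<forall>u u' v. P u v \<longrightarrow> P u' v \<longrightarrow> u = u') \<and>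
     (\<forall>u<side. \<forall>v<side. edge u v \<longrightarrow>
        (\<exists>v'. P u v' \<and> rm u v' \<le> rm u v) \<or> (\<exists>u'. P u' v \<and> rw u' v \<le> rw u v))"

definition solution :: "(nat \<Rightarrow> nat) \<Rightarrow> bool" where
  "solution \<sigma> \<longleftrightarrow> (\<forall>i<K. \<sigma> i < N \<and> valid i (\<sigma> i) \<and>
     (\<forall>i'<k. \<forall>j'<N. dem i (\<sigma> i) i' j' \<longrightarrow> \<sigma> i' = j'))"

text \<open>Losing s_K starts a chain reaction downwards: z_(i+1) without s_(i+1) must take some
  b_ij, whose man a_ij should then take s_i, which leaves z_i without her. The gap is that a_ij may
  instead marry a woman who demands him. So the chain is run twice: in the slots from
  \<open>k\<close> on nobody demands a_ij; the links found there exclude every marriage between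
  options that differ; after that the chain reaches all slots.\<close>

lemma stable_imp_solution:
  assumes P: "stable P" and "\<not> P K K" and kK: "k \<le> K"
  shows "\<exists>\<sigma>. solution \<sigma>"
proof -
  have dom: "u < side" "v < side" "edge u v" if "P u v" for u v using P that unfolding stable_def by blast+
  have fun1: "v = v'" if "P u v" "P u v'" for u v v' using P that unfolding stable_def by metis
  have fun2: "u = u'" if "P u v" "P u' v" for u u' v using P that unfolding stable_def by metis
  have st: "(\<exists>v'. P u v' \<and> rm u v' \<le> rm u v) \<or> (\<exists>u'. P u' v \<and> rw u' v \<le> rw u v)"
    if "u < side" "v < side" "edge u v" for u v using P that unfolding stable_def by blast
  define link where "link = (\<lambda>i j. j < N \<and> valid i j \<and> P (i + 1) (ag i j) \<and> P (ag i j) i)"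
  \<comment> \<open>For i + 1 > 0 the woman s_(i+1) ranks nobody but z_(i+1) first, so only the man
    can keep this pair from blocking.\<close>
  have step1: "\<exists>j<N. valid i j \<and> P (i + 1) (ag i j)" if i: "i < K" "\<not> P (i + 1) (i + 1)" for i
  proof -
    have e: "edge (i + 1) (i + 1)" "i + 1 < side" using i by (simp_all add: edge_def side_def)
    have "False" if "P u' (i + 1)" "rw u' (i + 1) \<le> rw (i + 1) (i + 1)" for u'
      using that e i dom[OF that(1)] by (auto simp: rw_def split: if_splits)
    with st[OF e(2) e(2) e(1)] obtain v where v: "P (i + 1) v" "rm (i + 1) v \<le> rm (i + 1) (i + 1)"
      by blast
    have "K < v"
      using dom[OF v(1)] i v(1) by (cases "v \<le> K") (auto simp: edge_def)
    then have "sl v = i" "valid i (op v)" using dom(3)[OF v(1)] i by (auto simp: edge_def)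
    then show ?thesis using ag_eq[OF \<open>K < v\<close>] v(1) by metis
  qed
  \<comment> \<open>b_ij ranks a_ij first but is married to somebody else, so a_ij must be married,
    and not to her.\<close>
  have own: "P (ag i j) i \<or> (\<exists>v. K < v \<and> v \<noteq> ag i j \<and> P (ag i j) v)"
    if ij: "i < K" "j < N" and u: "P u (ag i j)" "u \<noteq> ag i j" for i j u
  proof -
    have e: "edge (ag i j) (ag i j)" "ag i j < side" using ij by (simp_all add: edge_def)
    have "False" if "P u' (ag i j)" "rw u' (ag i j) \<le> rw (ag i j) (ag i j)" for u'
    proof -
      have "u' = u" using fun2 that(1) u(1) by blast
      then show False
        using that e u dom[OF that(1)] by (auto simp: rw_def split: if_splits)
    qed
    with st[OF e(2) e(2) e(1)] obtain v where v: "P (ag i j) v" by blast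
    have "v \<noteq> ag i j" using fun2[OF u(1)] v u(2) by blast
    moreover have "v = i" if "v \<le> K" using dom(3)[OF v] that ij by (auto simp: edge_def)
    ultimately show ?thesis using v not_le by blast
  qed
  have foreign: "dem (sl v) (op v) (sl u) (op u)" if "P u v" "K < u" "K < v" "u \<noteq> v" for u v
    using dom(3)[OF that(1)] that by (auto simp: edge_def)
  have link_step: "\<exists>j. link i j" if i: "i < K" "\<not> P (i + 1) (i + 1)"
    and no: "\<And>j v. j < N \<Longrightarrow> P (ag i j) v \<Longrightarrow> K < v \<Longrightarrow> v = ag i j" for i
  proof -
    obtain j where j: "j < N" "valid i j" "P (i + 1) (ag i j)" using step1[OF i] by blast
    have "i + 1 \<noteq> ag i j" using i by (metis ag_gt(2) Suc_eq_plus1 Suc_leI)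
    from own[OF i(1) j(1,3) this] no[OF j(1)] have "P (ag i j) i" by blast
    then show ?thesis using j unfolding link_def by blast
  qed
  have free: "\<not> P i i" if "link i j" "i < K" for i j
    using that fun2 unfolding link_def by (metis ag_gt(2) less_imp_le)
  \<comment> \<open>Descent from K to k: men of these slots are demanded by nobody, so s_i is the
    only escape of a_ij.\<close>
  have high: "\<exists>j. link i j" if "k \<le> i" "i < K" for i
  proof -
    have "\<not> P i' i' \<and> (i' < K \<longrightarrow> (\<exists>j. link i' j))" if "k \<le> i'" "i' \<le> K" for i'
      using that(2,1)
    proof (induction i' rule: inc_induct)
      case base
      then show ?case using assms(2) by simp
    next
      case (step i')
      have "\<exists>j. link i' j"
      proof (rule link_step)
        show "i' < K" "\<not> P (i' + 1) (i' + 1)" using step by auto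
        fix j v assume "j < N" "P (ag i' j) v" "K < v"
        then show "v = ag i' j" using foreign[of "ag i' j" v] dem step.prems by fastforce
      qed
      then show ?case using free step by blast
    qed
    then show ?thesis using that by simp
  qed
  \<comment> \<open>A woman v married to the man of another option lies in a slot from
    \<open>k\<close> on. Her own man, also numbered v, is displaced and must hold the slot woman, so
    v is the linked option; but then v is married to z_(i+1) and not to u.\<close>
  have no_foreign: "u = v" if uv: "P u v" "K < u" "K < v" for u v
  proof (rule ccontr)
    assume ne: "u \<noteq> v"
    let ?i = "sl v" and ?j = "op v"
    have i: "k \<le> ?i" "?i < K" "?j < N" "ag ?i ?j = v"
      using dem[OF foreign[OF uv ne]] sl_less[OF uv(3)] dom[OF uv(1)] ag_eq[OF uv(3)] by auto
    obtain j where j: "link ?i j" using high i by blast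
    have "P u (ag ?i ?j)" "u \<noteq> ag ?i ?j" using uv ne i by auto
    from own[OF i(2,3) this] consider "P v ?i" | v' where "K < v'" "v' \<noteq> v" "P v v'"
      unfolding i(4) by blast
    then show False
    proof cases
      case 1
      then have "v = ag ?i j" using j fun2 unfolding link_def by blast
      then have "P (?i + 1) v" using j unfolding link_def by metis
      then have "u = ?i + 1" by (rule fun2[OF uv(1)])
      then show False using uv(2) i(2) by simp
    next
      case 2
      then show False using dem[OF foreign[of v v']] uv(3) i(1) by simp
    qed
  qed
  \<comment> \<open>The descent again, now through all slots, since desertion is excluded.\<close>
  have link: "\<exists>j. link i j" if "i < K" for i
  proof -
    have "\<not> P i' i' \<and> (i' < K \<longrightarrow> (\<exists>j. link i' j))" if "i' \<le> K" for i'
      using that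
    proof (induction i' rule: inc_induct)
      case base
      then show ?case using assms(2) by simp
    next
      case (step i')
      have "\<exists>j. link i' j"
      proof (rule link_step)
        show "i' < K" "\<not> P (i' + 1) (i' + 1)" using step by auto
        fix j v assume "P (ag i' j) v" "K < v"
        then show "v = ag i' j" using no_foreign[of "ag i' j" v] by simp
      qed
      then show ?case using free step by blast
    qed
    then show ?thesis using that by simp
  qed
  define \<sigma> where "\<sigma> = (\<lambda>i. SOME j. link i j)"
  have \<sigma>: "link i (\<sigma> i)" if "i < K" for i unfolding \<sigma>_def using link[OF that] by (rule someI_ex)
  have "solution \<sigma>"
    unfolding solution_def
  proof (intro allI impI conjI)
    fix i assume i: "i < K"
    show "\<sigma> i < N" "valid i (\<sigma> i)" using \<sigma>[OF i] by (simp_all add: link_def)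
    fix i' j' assume d: "i' < k" "j' < N" "dem i (\<sigma> i) i' j'"
    let ?u = "ag i' j'" and ?v = "ag i (\<sigma> i)"
    have \<sigma>N: "\<sigma> i < N" by fact
    have ii: "i' < K" "i' \<noteq> i" using d dem[OF d(3)] kK by auto
    then have ne: "?u \<noteq> ?v" using d \<sigma>N by (simp add: ag_inject)
    have e: "?u < side" "?v < side" "edge ?u ?v" using i ii d \<sigma>N by (simp_all add: edge_def)
    \<comment> \<open>\<open>?v\<close> is married to z_(i+1), her last choice, so only the demanded
      man \<open>?u\<close> can keep the pair from blocking.\<close>
    have "False" if "P u' ?v" "rw u' ?v \<le> rw ?u ?v" for u'
    proof -
      have "u' = i + 1" using fun2[OF that(1)] \<sigma>[OF i] by (simp add: link_def)
      then show False using that(2) dom[OF that(1)] e ne i by (auto simp: rw_def split: if_splits)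
    qed
    with st[OF e] obtain v where v: "P ?u v" "rm ?u v \<le> rm ?u ?v" by blast
    \<comment> \<open>He ranks his own b below every woman who demands him, so only the woman of his
      slot is left.\<close>
    have "v \<le> K"
    proof (rule ccontr)
      assume "\<not> v \<le> K"
      then have "v = ?u" using no_foreign[OF v(1)] by simp
      then show False using v(2) e ne by (auto simp: rm_def edge_def split: if_splits)
    qed
    then have "v = i'" using dom(3)[OF v(1)] d by (simp add: edge_def)
    then have "ag i' (\<sigma> i') = ?u" using v(1) \<sigma>[OF ii(1)] fun2 by (metis link_def)
    then show "\<sigma> i' = j'" using d \<sigma>[OF ii(1)] by (simp add: ag_inject link_def)
  qed
  then show ?thesis by blast
qed

text \<open>The shift along the chain, closed up by z_0 and s_K so that nobody remains
  single.\<close>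

definition target :: "(nat \<Rightarrow> nat) \<Rightarrow> nat \<Rightarrow> nat \<Rightarrow> bool" where
  "target \<sigma> u v \<longleftrightarrow> u = 0 \<and> v = K \<or> (\<exists>i<K. u = i + 1 \<and> v = ag i (\<sigma> i)) \<or>
     (\<exists>i<K. u = ag i (\<sigma> i) \<and> v = i) \<or> (\<exists>i<K. \<exists>j<N. j \<noteq> \<sigma> i \<and> u = ag i j \<and> v = ag i j)"

text \<open>Every woman is married to a first choice.\<close>

lemma stable_initial: "stable (\<lambda>u v. u = v \<and> u < side)"
  by (auto simp: stable_def edge_def rw_def)

text \<open>Unchosen women b_ij keep their first choice, z_(i+1) prefers his b to s_(i+1), and s_i
  is indifferent between the options of her slot. A chosen b_ij would rather have a_ij or a man she
  demands, but all of these are chosen and so hold their own first choice.\<close>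

lemma stable_target:
  assumes \<sigma>: "solution \<sigma>" and kK: "k \<le> K"
  shows "stable (target \<sigma>)"
proof -
  have s: "\<sigma> i < N" "valid i (\<sigma> i)" if "i < K" for i using \<sigma> that unfolding solution_def by auto
  have KU: "i \<le> K \<Longrightarrow> i < side" for i by (simp add: side_def)
  have T: "target \<sigma> 0 K" "i < K \<Longrightarrow> target \<sigma> (i + 1) (ag i (\<sigma> i))" "i < K \<Longrightarrow> target \<sigma> (ag i (\<sigma> i)) i"
    "i < K \<Longrightarrow> j < N \<Longrightarrow> j \<noteq> \<sigma> i \<Longrightarrow> target \<sigma> (ag i j) (ag i j)" for i j
    by (auto simp: target_def)
  have dom: "u < side \<and> v < side \<and> edge u v" if "target \<sigma> u v" for u v
    using that s unfolding target_def by (auto simp: KU edge_def)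
  have row: "target \<sigma> 0 v \<longleftrightarrow> v = K" "i < K \<Longrightarrow> target \<sigma> (i + 1) v \<longleftrightarrow> v = ag i (\<sigma> i)"
    "i < K \<Longrightarrow> j < N \<Longrightarrow> target \<sigma> (ag i j) v \<longleftrightarrow> v = (if j = \<sigma> i then i else ag i j)" for i j v
    using K s by (auto simp: target_def ag_inject)
  have col: "target \<sigma> u K \<longleftrightarrow> u = 0" "i < K \<Longrightarrow> target \<sigma> u i \<longleftrightarrow> u = ag i (\<sigma> i)"
    "i < K \<Longrightarrow> j < N \<Longrightarrow> target \<sigma> u (ag i j) \<longleftrightarrow> u = (if j = \<sigma> i then i + 1 else ag i j)" for i j u
    using K s by (auto simp: target_def ag_inject)
  have fun1: "v = v'" if P: "target \<sigma> u v" "target \<sigma> u v'" for u v v'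
  proof -
    have "u < side" using dom P by blast
    then consider "u = 0" | i where "i < K" "u = i + 1" | i j where "i < K" "j < N" "u = ag i j"
      by (metis ag_cases Suc_eq_plus1 Suc_le_lessD not0_implies_Suc)
    then show ?thesis using P by cases (simp_all only: row)
  qed
  have fun2: "u = u'" if P: "target \<sigma> u v" "target \<sigma> u' v" for u u' v
  proof -
    have "v < side" using dom P by blast
    then consider "v = K" | "v < K" | i j where "i < K" "j < N" "v = ag i j"
      by (metis ag_cases le_neq_implies_less)
    then show ?thesis using P by cases (simp_all only: col)
  qed
  have st: "(\<exists>v'. target \<sigma> u v' \<and> rm u v' \<le> rm u v) \<or> (\<exists>u'. target \<sigma> u' v \<and> rw u' v \<le> rw u v)"
    if uv: "u < side" "v < side" "edge u v" for u v
  proof (cases "target \<sigma> u v")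
    case True
    then show ?thesis by blast
  next
    case False
    have pos: "rm u v \<ge> 1" "rw u v \<ge> 1" using uv by (auto simp: rm_def rw_def)
    from ag_cases[OF uv(1)] ag_cases[OF uv(2)]
    consider "u \<le> K" "v \<le> K" | i j where "u \<le> K" "i < K" "j < N" "v = ag i j"
      | i j where "v \<le> K" "i < K" "j < N" "u = ag i j"
      | i j i' j' where "i < K" "j < N" "v = ag i j" "i' < K" "j' < N" "u = ag i' j'"
      by metis
    then show ?thesis
    proof cases
      case 1
      then consider "u = v" "u = 0" | i where "i < K" "u = i + 1" "v = i + 1"
        using uv False T(1) unfolding edge_def by (metis Suc_eq_plus1 Suc_le_lessD not0_implies_Suc)
      then show ?thesis
      proof cases
        case 1
        \<comment> \<open>z_0 ends with his last choice s_K and would return to s_0; this is why her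
          tie includes him.\<close>
        have "0 < K" using K by simp
        then have "target \<sigma> (ag 0 (\<sigma> 0)) 0" "rw (ag 0 (\<sigma> 0)) 0 \<le> 1"
          using T(3)[of 0] dom[OF T(3)[of 0]] by (simp_all add: rw_def)
        then show ?thesis using 1 pos by (metis le_trans)
      next
        case 2
        have "rm u (ag i (\<sigma> i)) \<le> rm u v"
          using 2 dom[OF T(2)[OF 2(1)]] uv by (auto simp: rm_def)
        then show ?thesis using T(2)[OF 2(1)] 2 by blast
      qed
    next
      case 2
      then have "u = i + 1" using uv by (simp add: edge_def)
      then have "j \<noteq> \<sigma> i" using False 2 T(2) by auto
      then have "target \<sigma> v v" "rw v v \<le> 1" using 2 T(4) by (auto simp: rw_def)
      then show ?thesis using pos by (metis le_trans)
    next
      case 3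
      then have "v = i" using uv by (simp add: edge_def)
      have "rw (ag i (\<sigma> i)) i \<le> rw u v"
        using 3 \<open>v = i\<close> dom[OF T(3)[OF 3(2)]] uv by (auto simp: rw_def)
      then show ?thesis using T(3)[OF 3(2)] \<open>v = i\<close> by blast
    next
      case 4
      show ?thesis
      proof (cases "j = \<sigma> i \<and> u \<noteq> v \<or> u = v")
        case True
        have "j' = \<sigma> i'"
        proof (cases "u = v")
          case True
          then have "i = i'" "j = j'" using 4 ag_inject by metis+
          then show ?thesis using False True 4 T(4) by metis
        next
          case F: False
          then have d: "dem i (\<sigma> i) i' j'" using uv True 4 by (auto simp: edge_def)
          then show ?thesis using dem[OF d] \<sigma> 4 unfolding solution_def by auto
        qed
        then have "target \<sigma> u i'" "rm u i' \<le> 1" using T(3)[OF 4(4)] 4 dom[OF T(3)[OF 4(4)]]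
          by (auto simp: rm_def)
        then show ?thesis using pos by (metis le_trans)
      next
        case F: False
        then have "target \<sigma> v v" "rw v v \<le> 1" using 4 T(4) by (auto simp: rw_def)
        then show ?thesis using pos by (metis le_trans)
      qed
    qed
  qed
  show ?thesis unfolding stable_def using dom fun1 fun2 st by blast
qed

end

section \<open>From relations to weakly stable matchings\<close>

lemma blocks_commute: "blocks I M a b \<longleftrightarrow> blocks I M b a"
  unfolding blocks_def mutually_acceptable_def by blast

lemma partner_eq:
  assumes "matching I M" "{a, b} \<in> M"
  shows "partner M a = b"
  unfolding partner_def
proof (rule the_equality)
  fix c assume "{a, c} \<in> M"
  have "{a, c} = {a, b}"
  proof (rule ccontr)
    assume "{a, c} \<noteq> {a, b}"
    from conjunct2[OF assms(1)[unfolded matching_def], rule_format, OF \<open>{a, c} \<in> M\<close> assms(2) this]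
    show False by simp
  qed
  then show "c = b" by (auto simp: doubleton_eq_iff)
qed fact

text \<open>Decoding a word determines the ranks only between agents, so the ranks \<open>r\<close> may differ from
  \<open>rank\<close> elsewhere.\<close>

locale gadget_instance = gadget +
  fixes r :: "nat \<Rightarrow> nat \<Rightarrow> nat" and ms qs ps :: "(nat \<times> nat) list" and B :: nat
    and I :: "nat adapt_instance"
  assumes r: "a < side + side \<Longrightarrow> b < side + side \<Longrightarrow> r a b = rank a b"
    and I: "I = adapt_of_ranks side side r ms qs ps B"
begin

lemma men_I: "men I = {0..<side}" and women_I: "women I = {side..<side + side}"
  and agents_I: "agents I = {0..<side + side}"
  by (auto simp: I adapt_of_ranks_def agents_def)

lemma acc_I: "b \<in> acc I a \<longleftrightarrow> b < side + side \<and> r a b \<noteq> 0"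
  by (simp add: I adapt_of_ranks_def)

lemma pref_I: "(b, c) \<in> pref I a \<longleftrightarrow>
    b < side + side \<and> c < side + side \<and> r a b \<noteq> 0 \<and> r a c \<noteq> 0 \<and> r a b \<le> r a c"
  by (simp add: I adapt_of_ranks_def)

lemma r_man_woman: "u < side \<Longrightarrow> v < side \<Longrightarrow> r u (side + v) = rm u v"
  and r_woman_man: "u < side \<Longrightarrow> v < side \<Longrightarrow> r (side + v) u = rw u v"
  by (simp_all add: r rank_def)

lemma rm_pos: "rm u v \<noteq> 0 \<longleftrightarrow> edge u v" and rw_pos: "rw u v \<noteq> 0 \<longleftrightarrow> edge u v"
  by (auto simp: rm_def rw_def)

lemma mutually_acceptable_I:
  "mutually_acceptable I a b \<longleftrightarrow>
     (\<exists>u v. u < side \<and> v < side \<and> edge u v \<and> (a = u \<and> b = side + v \<or> b = u \<and> a = side + v))"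
proof
  assume *: "mutually_acceptable I a b"
  then have lt: "a < side + side" "b < side + side" and nz: "rank a b \<noteq> 0"
    by (auto simp: mutually_acceptable_def agents_I acc_I r)
  show "\<exists>u v. u < side \<and> v < side \<and> edge u v \<and> (a = u \<and> b = side + v \<or> b = u \<and> a = side + v)"
  proof (cases "a < side")
    case True
    then have "side \<le> b" "edge a (b - side)" using nz rm_pos by (auto simp: rank_def split: if_splits)
    then show ?thesis using True lt by (intro exI[of _ a] exI[of _ "b - side"]) auto
  next
    case False
    then have "b < side" "edge b (a - side)" using nz rw_pos by (auto simp: rank_def split: if_splits)
    then show ?thesis using False lt by (intro exI[of _ b] exI[of _ "a - side"]) auto
  qed
next
  assume "\<exists>u v. u < side \<and> v < side \<and> edge u v \<and> (a = u \<and> b = side + v \<or> b = u \<and> a = side + v)"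
  then show "mutually_acceptable I a b"
    using rm_pos rw_pos
    by (auto simp: mutually_acceptable_def agents_I acc_I r_man_woman r_woman_man)
qed

lemma strictly_prefers_I:
  "strictly_prefers I a b c \<longleftrightarrow>
     b < side + side \<and> c < side + side \<and> r a b \<noteq> 0 \<and> r a c \<noteq> 0 \<and> r a b < r a c"
  by (auto simp: strictly_prefers_def pref_I)

lemma valid_smt_I: "valid_smt I"
proof -
  have "acc I u \<subseteq> women I" if "u \<in> men I" for u
    using that by (auto simp: men_I women_I acc_I r rank_def split: if_splits)
  moreover have "acc I w \<subseteq> men I" if "w \<in> women I" for w
    using that by (auto simp: men_I women_I acc_I r rank_def split: if_splits)
  moreover have "w \<in> acc I u \<longleftrightarrow> u \<in> acc I w" if "u \<in> men I" "w \<in> women I" for u w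
  proof -
    obtain v where v: "w = side + v" "v < side" "u < side"
      using \<open>w \<in> women I\<close> \<open>u \<in> men I\<close> by (auto simp: men_I women_I dest: le_Suc_ex)
    then show ?thesis using rm_pos[of u v] rw_pos[of u v] by (simp add: acc_I r_man_woman r_woman_man)
  qed
  moreover have "preorder_on (acc I a) (pref I a)" "total_on (acc I a) (pref I a)" for a
    by (auto simp: preorder_on_def refl_on_def trans_def total_on_def pref_I acc_I)
  moreover have "men I \<inter> women I = {}" "finite (men I)" "finite (women I)"
    by (auto simp: men_I women_I)
  ultimately show ?thesis unfolding valid_smt_def by blast
qed

lemma weakly_stable_imp_stable:
  assumes "weakly_stable I M"
  shows "stable (\<lambda>u v. u < side \<and> v < side \<and> {u, side + v} \<in> M)" (is "stable ?P")
proof -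
  have M: "matching I M" using assms unfolding weakly_stable_def by blast
  have nb: "\<not> blocks I M a b" for a b using assms unfolding weakly_stable_def by blast
  have pair: "\<exists>u v. u < side \<and> v < side \<and> edge u v \<and> (a = u \<and> b = side + v \<or> b = u \<and> a = side + v)"
    if "{a, b} \<in> M" for a b
  proof -
    from conjunct1[OF M[unfolded matching_def], rule_format, OF that]
    obtain c d where cd: "{a, b} = {c, d}" "mutually_acceptable I c d" by blast
    then have "a = c \<and> b = d \<or> a = d \<and> b = c" by (simp add: doubleton_eq_iff)
    then show ?thesis using cd(2) unfolding mutually_acceptable_I by (elim disjE conjE) auto
  qed
  show ?thesis
    unfolding stable_def
  proof (intro conjI allI impI)
    fix u v assume P: "?P u v"
    then show "u < side" "v < side" by auto
    show "edge u v" using pair[of u "side + v"] P by auto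
    fix v' assume "?P u v'"
    then show "v = v'"
      using partner_eq[OF M, of u "side + v"] partner_eq[OF M, of u "side + v'"] P by simp
  next
    fix u u' v assume "?P u v" "?P u' v"
    then show "u = u'"
      using partner_eq[OF M, of "side + v" u] partner_eq[OF M, of "side + v" u']
      by (simp add: insert_commute)
  next
    fix u v assume uv: "u < side" "v < side" "edge u v"
    then have "mutually_acceptable I u (side + v)" unfolding mutually_acceptable_I by blast
    with nb[of u "side + v"] consider
        "matched M u" "\<not> strictly_prefers I u (side + v) (partner M u)"
      | "matched M (side + v)" "\<not> strictly_prefers I (side + v) u (partner M (side + v))"
      unfolding blocks_def by blast
    then show "(\<exists>v'. ?P u v' \<and> rm u v' \<le> rm u v) \<or> (\<exists>u'. ?P u' v \<and> rw u' v \<le> rw u v)"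
    proof cases
      case 1
      then obtain b where b: "{u, b} \<in> M" unfolding matched_def by blast
      then obtain v' where v': "v' < side" "edge u v'" "b = side + v'" using pair[OF b] uv(1) by auto
      have "\<not> rm u v < rm u v'"
        using 1(2) partner_eq[OF M b] v' uv rm_pos[of u v] rm_pos[of u v']
        by (auto simp: strictly_prefers_I r_man_woman)
      then show ?thesis using b v' uv(1) not_less by blast
    next
      case 2
      then obtain u' where b: "{side + v, u'} \<in> M" unfolding matched_def by blast
      then have u': "u' < side" "edge u' v" using pair[OF b] uv(2) by auto
      have "\<not> rw u v < rw u' v"
        using 2(2) partner_eq[OF M b] u' uv rw_pos[of u v] rw_pos[of u' v]
        by (auto simp: strictly_prefers_I r_woman_man)
      moreover have "{u', side + v} \<in> M" using b by (simp add: insert_commute)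
      ultimately show ?thesis using u' uv(2) not_less by blast
    qed
  qed
qed

lemma stable_imp_weakly_stable:
  assumes P: "stable P"
  shows "weakly_stable I {{u, side + v} | u v. P u v}" (is "weakly_stable I ?M")
proof -
  have dom: "u < side" "v < side" "edge u v" if "P u v" for u v using P that unfolding stable_def by blast+
  have fun1: "v = v'" if "P u v" "P u v'" for u v v' using P that unfolding stable_def by metis
  have fun2: "u = u'" if "P u v" "P u' v" for u u' v using P that unfolding stable_def by metis
  have M: "matching I ?M"
    unfolding matching_def
  proof (intro conjI ballI impI)
    fix e assume "e \<in> ?M"
    then obtain u v where e: "e = {u, side + v}" "P u v" by blast
    then have "mutually_acceptable I u (side + v)" using dom unfolding mutually_acceptable_I by blast
    then show "\<exists>a b. e = {a, b} \<and> mutually_acceptable I a b" using e by blast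
    fix e' assume "e' \<in> ?M" "e \<noteq> e'"
    then obtain u' v' where e': "e' = {u', side + v'}" "P u' v'" by blast
    have "u \<noteq> u'" "v \<noteq> v'" using e e' \<open>e \<noteq> e'\<close> fun1 fun2 by blast+
    moreover have "u < side" "u' < side" using dom e e' by auto
    ultimately show "e \<inter> e' = {}" using e e' by auto
  qed
  have no: "\<not> blocks I ?M u (side + v)" if uv: "u < side" "v < side" "edge u v" for u v
  proof
    assume b: "blocks I ?M u (side + v)"
    from P uv consider v' where "P u v'" "rm u v' \<le> rm u v" | u' where "P u' v" "rw u' v \<le> rw u v"
      unfolding stable_def by blast
    then show False
    proof cases
      case 1
      then have in_M: "{u, side + v'} \<in> ?M" by blast
      then have "strictly_prefers I u (side + v) (side + v')"
        using b partner_eq[OF M in_M] unfolding blocks_def matched_def by auto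
      then show False using 1 uv dom[OF 1(1)] by (simp add: strictly_prefers_I r_man_woman)
    next
      case 2
      then have in_M: "{side + v, u'} \<in> ?M" by blast
      then have "strictly_prefers I (side + v) u u'"
        using b partner_eq[OF M in_M] unfolding blocks_def matched_def by auto
      then show False using 2 uv dom[OF 2(1)] by (simp add: strictly_prefers_I r_woman_man)
    qed
  qed
  have "\<not> blocks I ?M a b" for a b
  proof
    assume b: "blocks I ?M a b"
    then have "mutually_acceptable I a b" unfolding blocks_def by blast
    then show False using no b blocks_commute[of I ?M] unfolding mutually_acceptable_I by blast
  qed
  then show ?thesis using M unfolding weakly_stable_def by blast
qed

section \<open>The ties of the instance\<close>

lemma ties_I:
  "ties I a = {T. \<exists>q. q \<noteq> 0 \<and> T = {b. b < side + side \<and> r a b = q} \<and> 2 \<le> card T}"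
    (is "_ = {T. \<exists>q. q \<noteq> 0 \<and> T = ?c q \<and> _ T}")
proof -
  have ind: "indifferent_set I a (?c q)" if "q \<noteq> 0" for q
    using that by (auto simp: indifferent_set_def indifferent_def acc_I pref_I)
  have sub: "T \<subseteq> ?c (r a x) \<and> r a x \<noteq> 0" if "indifferent_set I a T" "x \<in> T" for T x
    using that unfolding indifferent_set_def indifferent_def
    by (auto simp: acc_I pref_I subset_eq intro!: le_antisym)
  have ne: "\<exists>x. x \<in> T" if "2 \<le> card T" for T :: "nat set"
    using that by (cases "T = {}") auto
  show ?thesis
  proof (intro set_eqI iffI)
    fix T assume T: "T \<in> ties I a"
    then obtain x where x: "x \<in> T" using ne unfolding ties_def by blast
    then have "T \<subseteq> ?c (r a x)" "r a x \<noteq> 0" using sub T unfolding ties_def by blast+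
    moreover have "\<not> T \<subset> ?c (r a x)" using T ind[OF calculation(2)] unfolding ties_def by blast
    ultimately show "T \<in> {T. \<exists>q. q \<noteq> 0 \<and> T = ?c q \<and> 2 \<le> card T}"
      using T unfolding ties_def by blast
  next
    fix T assume "T \<in> {T. \<exists>q. q \<noteq> 0 \<and> T = ?c q \<and> 2 \<le> card T}"
    then obtain q where q: "q \<noteq> 0" "T = ?c q" "2 \<le> card T" by blast
    obtain x where x: "x \<in> T" using ne q(3) by blast
    have "\<not> indifferent_set I a T'" if "T \<subset> T'" for T'
    proof
      assume "indifferent_set I a T'"
      then have "T' \<subseteq> ?c (r a x)" using sub x that by blast
      then show False using x q(2) that by auto
    qed
    then show "T \<in> ties I a" using q ind unfolding ties_def by auto
  qed
qed

lemma no_ties: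
  assumes "\<And>b c. b < side + side \<Longrightarrow> c < side + side \<Longrightarrow> r a b = r a c \<Longrightarrow> r a b \<noteq> 0 \<Longrightarrow> b = c"
  shows "ties I a = {}"
proof -
  have "\<not> 2 \<le> card {b. b < side + side \<and> r a b = q}" if "q \<noteq> 0" for q
  proof -
    have "card {b. b < side + side \<and> r a b = q} \<le> 1"
      using that assms by (auto simp: card_le_Suc0_iff_eq)
    then show ?thesis by linarith
  qed
  then show ?thesis unfolding ties_I by blast
qed

text \<open>The ranks \<open>1 + v\<close> of the women b lie strictly between 1 and
  \<open>side_size K N + 5\<close>, and apart from the woman of his own number a man accepts at most
  one s_i.\<close>

lemma rm_inject:
  assumes e: "edge u v" "edge u v'" and eq: "rm u v = rm u v'" and lt: "v < side" "v' < side"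
  shows "v = v'"
proof (cases "v \<le> K \<and> v' \<le> K \<and> u \<noteq> v \<and> u \<noteq> v'")
  case True
  then show ?thesis using e unfolding edge_def by (cases "u \<le> K") simp_all
next
  case False
  then show ?thesis using eq lt K unfolding rm_def if_P[OF e(1)] if_P[OF e(2)]
    by (simp split: if_splits)
qed

text \<open>The bound \<open>K \<le> v\<close> leaves s_K, who accepts only z_K and z_0 because no
  option belongs to slot K, and the women b, who accept at most one z and rank the men they demand
  by number.\<close>

lemma rw_inject:
  assumes e: "edge u v" "edge u' v" and eq: "rw u v = rw u' v" and lt: "u < side" "u' < side"
    and v: "K \<le> v"
  shows "u = u'"
proof (cases "v = K")
  case True
  have "x = 0 \<or> x = v" if "edge x v" "x < side" for x
    using that True sl_less[of x] by (cases "x \<le> K") (auto simp: edge_def)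
  then have "u = 0 \<or> u = v" "u' = 0 \<or> u' = v" using e lt by blast+
  moreover have "rw x v = (if x = v then 1 else 2)" if "edge x v" for x
    using that True K by (simp add: rw_def)
  ultimately show ?thesis using eq e by (cases "u = v"; cases "u' = v") auto
next
  case False
  then have nv: "\<not> v \<le> K" using v by simp
  show ?thesis
  proof (cases "u \<le> K \<and> u' \<le> K")
    case True
    then show ?thesis using e nv by (simp add: edge_def)
  next
    case False
    have rw: "rw x v = (if x = v then 1 else if x \<le> K then side + 5 else 1 + x)" if "edge x v" for x
      using that nv by (simp add: rw_def)
    show ?thesis using False eq lt unfolding rw[OF e(1)] rw[OF e(2)]
      by (cases "u = v"; cases "u' = v"; cases "u \<le> K"; cases "u' \<le> K") simp_all
  qed
qed

lemma ties_man:
  assumes u: "u < side"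
  shows "ties I u = {}"
proof (rule no_ties)
  fix b c assume *: "b < side + side" "c < side + side" "r u b = r u c" "r u b \<noteq> 0"
  then have "\<not> b < side" "\<not> c < side" using u by (auto simp: r rank_def)
  then obtain v v' where v: "b = side + v" "c = side + v'" by (metis le_Suc_ex not_less)
  then have lt: "v < side" "v' < side" using * by auto
  then have eq: "rm u v = rm u v'" "rm u v \<noteq> 0" using * u v by (simp_all add: r_man_woman)
  then have "edge u v" "edge u v'" using rm_pos by metis+
  then have "v = v'" using rm_inject[OF _ _ eq(1) lt] by blast
  then show "b = c" using v by simp
qed

lemma ties_woman_rest:
  assumes v: "v < side" "K \<le> v"
  shows "ties I (side + v) = {}"
proof (rule no_ties)
  fix b c assume *: "b < side + side" "c < side + side" "r (side + v) b = r (side + v) c"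
    "r (side + v) b \<noteq> 0"
  then have bc: "b < side" "c < side" using v by (auto simp: r rank_def split: if_splits)
  have "rw b v = rw c v" "rw b v \<noteq> 0" using * v bc by (simp_all add: r_woman_man)
  moreover from this have "edge b v" "edge c v" using rw_pos by metis+
  ultimately show "b = c" using rw_inject bc v(2) by blast
qed

text \<open>The options of a slot share one rank and, as \<open>2 \<le> N\<close>, form a tie. Only
  z_v may lie outside it, and a single man makes no second tie.\<close>

lemma ties_woman:
  assumes v: "v < K"
  shows "card (ties I (side + v)) = 1"
proof -
  let ?c = "\<lambda>q. {b. b < side + side \<and> r (side + v) b = q}"
  let ?q = "if v = 0 then 1 else 2 :: nat"
  have vs: "v < side" using v by (simp add: side_def)
  have e: "edge u v \<longleftrightarrow> u = v \<or> (\<exists>j<N. u = ag v j)" if "u < side" for u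
  proof (cases "u \<le> K")
    case True
    then show ?thesis using v by (auto simp: edge_def)
  next
    case False
    then show ?thesis using v ag_eq[of u] by (auto simp: edge_def)
  qed
  have rw: "rw (ag v j) v = ?q" if "j < N" for j using that v by (simp add: rw_def edge_def)
  have one: "rw v v = 1" using v vs by (simp add: rw_def e)
  have mem: "b \<in> ?c q \<longleftrightarrow> b < side \<and> rw b v = q" if "q \<noteq> 0" for b q
    using that vs by (auto simp: r rank_def split: if_splits)
  have q: "2 \<le> card (?c ?q)"
  proof -
    have "inj_on (ag v) {0, 1}" by (auto simp: inj_on_def ag_def)
    then have two: "2 = card (ag v ` {0, 1})" by (simp add: card_image)
    have sub: "ag v ` {0, 1} \<subseteq> ?c ?q" using rw N mem[of ?q] v by auto
    have fin: "finite (?c ?q)" by (rule finite_subset[of _ "{..<side + side}"]) auto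
    show ?thesis by (rule ord_eq_le_trans[OF two card_mono[OF fin sub]])
  qed
  have "ties I (side + v) = {?c ?q}"
  proof (intro set_eqI iffI)
    fix T assume "T \<in> ties I (side + v)"
    then obtain q where q: "q \<noteq> 0" "T = ?c q" "2 \<le> card T" unfolding ties_I by blast
    have "q = ?q"
    proof (rule ccontr)
      assume ne: "q \<noteq> ?q"
      have "b = v" if "b \<in> ?c q" for b
      proof -
        have b: "b < side" "rw b v = q" using that mem[OF q(1)] by auto
        then have "edge b v" using q(1) rw_pos[of b v] by simp
        then show ?thesis using e[OF b(1)] rw b(2) ne by auto
      qed
      then have "?c q \<subseteq> {v}" by blast
      then have "card (?c q) \<le> 1" using card_mono[of "{v}" "?c q"] by simp
      then show False using q by simp
    qed
    then show "T \<in> {?c ?q}" using q(2) by blast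
  next
    fix T assume "T \<in> {?c ?q}"
    then show "T \<in> ties I (side + v)" using q unfolding ties_I by auto
  qed
  then show ?thesis by simp
qed

lemma num_ties_I: "num_ties I = K"
proof -
  have "num_ties I = (\<Sum>a\<in>{0..<side + side}. card (ties I a))" by (simp add: num_ties_def agents_I)
  also have "\<dots> = (\<Sum>a\<in>{side..<side + K}. card (ties I a))"
  proof (rule sum.mono_neutral_right)
    show "{side..<side + K} \<subseteq> {0..<side + side}" by (auto simp: side_def)
    show "\<forall>a\<in>{0..<side + side} - {side..<side + K}. card (ties I a) = 0"
    proof
      fix a assume "a \<in> {0..<side + side} - {side..<side + K}"
      then have a: "a < side + side" "a < side \<or> side + K \<le> a" by auto
      show "card (ties I a) = 0"
      proof (cases "a < side")
        case True
        then show ?thesis using ties_man[OF True] by simp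
      next
        case False
        with a(2) have "side + K \<le> a" by blast
        then obtain c where c: "a = side + K + c" using le_Suc_ex by blast
        have "ties I (side + (K + c)) = {}" using a(1) c by (intro ties_woman_rest) simp_all
        then show ?thesis using c by (simp add: add.assoc)
      qed
    qed
  qed simp
  also have "\<dots> = (\<Sum>a\<in>{side..<side + K}. 1)"
  proof (rule sum.cong)
    fix a assume "a \<in> {side..<side + K}"
    then have "side + (a - side) = a" "a - side < K" by auto
    then show "card (ties I a) = 1" using ties_woman[of "a - side"] by simp
  qed simp
  finally show ?thesis by simp
qed

lemma one_sided_I: "one_sided_ties I"
  unfolding one_sided_ties_def using ties_man by (auto simp: men_I)

end

section \<open>The budget and the forced or forbidden pair\<close>

context gadget_instance
begin

lemma initial_I:
  assumes "ms = map (\<lambda>u. (u, side + u)) [0..<side]"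
  shows "initial I = {{u, side + v} | u v. u = v \<and> u < side}"
  by (auto simp: I adapt_of_ranks_def assms)

lemma valid_adapt_I:
  assumes ms: "ms = map (\<lambda>u. (u, side + u)) [0..<side]"
    and pairs: "\<forall>(a, b) \<in> set qs \<union> set ps. a < side \<and> side \<le> b \<and> b < side + side"
  shows "valid_adapt I"
proof -
  have "weakly_stable I (initial I)"
    unfolding initial_I[OF ms] by (rule stable_imp_weakly_stable[OF stable_initial])
  moreover have "(\<lambda>(a, b). {a, b}) ` set xs \<subseteq> {e. e \<subseteq> agents I \<and> card e = 2}"
    if "set xs \<subseteq> set qs \<union> set ps" for xs
  proof
    fix e assume "e \<in> (\<lambda>(a, b). {a, b}) ` set xs"
    then obtain a b where ab: "(a, b) \<in> set xs" "e = {a, b}" by auto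
    then have "(a, b) \<in> set qs \<union> set ps" using that by blast
    from bspec[OF pairs this] have e: "e = {a, b}" "a < side" "side \<le> b" "b < side + side"
      using ab(2) by simp_all
    then have "card e = 2" by simp
    then show "e \<in> {e. e \<subseteq> agents I \<and> card e = 2}" using e by (auto simp: agents_I)
  qed
  ultimately show ?thesis
    using valid_smt_I unfolding valid_adapt_def by (auto simp: I adapt_of_ranks_def)
qed

text \<open>At most 2K + 1 pairs disappear, namely K + 1 along the chain and one chosen option per
  slot, and at most 2K + 1 appear, namely two per slot and the closing pair {z_0, s_K}.\<close>

lemma budget_bound:
  assumes ms: "ms = map (\<lambda>u. (u, side + u)) [0..<side]"
  shows "card (sym_diff (initial I) {{u, side + v} | u v. target \<sigma> u v}) \<le> 4 * K + 2"
    (is "card (sym_diff ?A ?M) \<le> _")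
proof -
  let ?g = "\<lambda>i. ag i (\<sigma> i)"
  let ?X = "(\<lambda>u. {u, side + u}) ` ({..K} \<union> ?g ` {..<K})"
  let ?Y = "insert {0, side + K} ((\<lambda>i. {i + 1, side + ?g i}) ` {..<K} \<union> (\<lambda>i. {?g i, side + i}) ` {..<K})"
  have "?A - ?M \<subseteq> ?X"
  proof
    fix e assume e: "e \<in> ?A - ?M"
    then obtain u where u: "u < side" "e = {u, side + u}" unfolding initial_I[OF ms] by blast
    then have "\<not> target \<sigma> u u" using e by blast
    with u(1) have "u \<in> {..K} \<union> ?g ` {..<K}"
      by (cases u rule: ag_cases) (auto simp: target_def)
    then show "e \<in> ?X" using u(2) by blast
  qed
  moreover have "?M - ?A \<subseteq> ?Y"
  proof
    fix e assume e: "e \<in> ?M - ?A"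
    then obtain u v where uv: "target \<sigma> u v" "e = {u, side + v}" by blast
    have "u \<noteq> v \<or> \<not> u < side" using e uv unfolding initial_I[OF ms] by blast
    then show "e \<in> ?Y" using uv unfolding target_def by auto
  qed
  moreover have "card ?X \<le> (K + 1) + K"
  proof -
    have "card ?X \<le> card ({..K} \<union> ?g ` {..<K})" by (rule card_image_le) simp
    also have "\<dots> \<le> card {..K} + card (?g ` {..<K})" by (rule card_Un_le)
    also have "\<dots> \<le> (K + 1) + K" using card_image_le[of "{..<K}" ?g] by simp
    finally show ?thesis .
  qed
  moreover have "card ?Y \<le> 1 + (K + K)"
  proof -
    let ?U = "(\<lambda>i. {i + 1, side + ?g i}) ` {..<K}" and ?V = "(\<lambda>i. {?g i, side + i}) ` {..<K}"
    have "card ?Y \<le> Suc (card (?U \<union> ?V))" by (rule card_insert_le_m1[of "Suc _", simplified]) simp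
    also have "\<dots> \<le> Suc (card ?U + card ?V)" using card_Un_le[of ?U ?V] by simp
    also have "\<dots> \<le> Suc (K + K)"
      using card_image_le[of "{..<K}" "\<lambda>i. {i + 1, side + ?g i}"]
        card_image_le[of "{..<K}" "\<lambda>i. {?g i, side + i}"] by simp
    finally show ?thesis by simp
  qed
  moreover have "finite ?X" "finite ?Y" by simp_all
  ultimately have "card (?A - ?M) \<le> (K + 1) + K" "card (?M - ?A) \<le> 1 + (K + K)"
    by (meson card_mono order_trans)+
  then show ?thesis using card_Un_le[of "?A - ?M" "?M - ?A"] by simp
qed

lemma solvable_of_solution:
  assumes "solution \<sigma>" "k \<le> K" and ms: "ms = map (\<lambda>u. (u, side + u)) [0..<side]"
    and B: "B = 4 * K + 2"
    and pairs: "qs = [(0, side + K)] \<and> ps = [] \<or> qs = [] \<and> ps = [(K, side + K)]"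
  shows "solvable_adapt I"
proof -
  let ?M = "{{u, side + v} | u v. target \<sigma> u v}"
  have stab: "stable (target \<sigma>)" by (rule stable_target[OF assms(1,2)])
  have T: "target \<sigma> 0 K" by (simp add: target_def)
  \<comment> \<open>s_K belongs to z_0, who differs from z_K because
    \<open>1 \<le> K\<close>.\<close>
  have a: "{K, side + K} \<notin> ?M"
  proof
    assume "{K, side + K} \<in> ?M"
    then obtain u v where uv: "target \<sigma> u v" "{K, side + K} = {u, side + v}" by blast
    have "u < side" using stab uv(1) unfolding stable_def by blast
    then have "u = K" "v = K" using uv(2) by (auto simp: doubleton_eq_iff side_def)
    then have "K = 0" using uv(1) T stab unfolding stable_def by metis
    then show False using K by simp
  qed
  have b: "{0, side + K} \<in> ?M" using T by blast
  have "forced I \<subseteq> X \<and> X \<inter> forbidden I = {}"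
    if "{K, side + K} \<notin> X" "{0, side + K} \<in> X" for X
    using pairs that by (auto simp: I adapt_of_ranks_def)
  from this[OF a b] have c: "forced I \<subseteq> ?M" "?M \<inter> forbidden I = {}" by (rule conjunct1, rule conjunct2)
  have "budget I = 4 * K + 2" by (simp add: I adapt_of_ranks_def B)
  with budget_bound[OF ms] have d: "card (sym_diff (initial I) ?M) \<le> budget I" by (simp only:)
  show ?thesis
    unfolding solvable_adapt_def
    by (intro exI[of _ ?M] conjI stable_imp_weakly_stable[OF stab] c d)
qed

text \<open>Forcing {z_0, s_K} takes s_K away from z_K just as forbidding {z_K, s_K} does; from
  there stability leads to a solution.\<close>

lemma solution_of_solvable:
  assumes "solvable_adapt I" and kK: "k \<le> K"
    and pairs: "qs = [(0, side + K)] \<and> ps = [] \<or> qs = [] \<and> ps = [(K, side + K)]"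
  shows "\<exists>\<sigma>. solution \<sigma>"
proof -
  obtain M where M: "weakly_stable I M" "forced I \<subseteq> M" "M \<inter> forbidden I = {}"
    using assms(1) unfolding solvable_adapt_def by blast
  have st: "stable (\<lambda>u v. u < side \<and> v < side \<and> {u, side + v} \<in> M)" (is "stable ?P")
    by (rule weakly_stable_imp_stable[OF M(1)])
  have "\<not> ?P K K"
    using pairs
  proof (elim disjE conjE)
    assume "qs = [(0, side + K)]"
    then have "?P 0 K" using M(2) by (simp add: I adapt_of_ranks_def side_def)
    moreover have "K \<noteq> 0" using K by simp
    ultimately show "\<not> ?P K K" using st unfolding stable_def by metis
  next
    assume "ps = [(K, side + K)]"
    then show "\<not> ?P K K" using M(3) by (auto simp: I adapt_of_ranks_def)
  qed
  then show ?thesis by (rule stable_imp_solution[OF st _ kK])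
qed

end

section \<open>Weighted satisfiability as a slot system\<close>

text \<open>Tuples are coded as numbers by their digits: a slot by d indices in base k + 1, an
  option of such a slot by 2d positions in base \<open>length z\<close>.\<close>

definition digit :: "nat \<Rightarrow> nat \<Rightarrow> nat \<Rightarrow> nat" where
  "digit b e t = t div b ^ e mod b"

lemma digit_less: "0 < b \<Longrightarrow> digit b e t < b"
  by (simp add: digit_def)

lemma ex_digits:
  assumes "\<And>e. e < L \<Longrightarrow> \<delta> e < b"
  shows "\<exists>t < b ^ L. \<forall>e<L. digit b e t = \<delta> e"
  using assms
proof (induction L)
  case 0
  then show ?case by simp
next
  case (Suc L)
  then obtain t where t: "t < b ^ L" "\<And>e. e < L \<Longrightarrow> digit b e t = \<delta> e" by auto
  let ?t = "t + \<delta> L * b ^ L"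
  have "\<delta> L < b" using Suc by simp
  then have "?t < b ^ L + \<delta> L * b ^ L" "\<delta> L + 1 \<le> b" using t by simp_all
  then have "?t < (\<delta> L + 1) * b ^ L" by (simp add: add.commute)
  also have "\<dots> \<le> b * b ^ L" using \<open>\<delta> L + 1 \<le> b\<close> by (rule mult_le_mono1)
  finally have "?t < b ^ Suc L" by simp
  moreover have "digit b e ?t = \<delta> e" if "e < Suc L" for e
  proof (cases "e = L")
    case True
    have "?t div b ^ L = \<delta> L" using t(1) \<open>\<delta> L < b\<close> by (subst div_mult_self1) auto
    then show ?thesis using True \<open>\<delta> L < b\<close> by (simp add: digit_def)
  next
    case False
    then have e: "e < L" using that by simp
    then obtain m where m: "L = e + Suc m" using less_imp_Suc_add by (metis add_Suc_right)
    have "?t div b ^ e = (t + (\<delta> L * b ^ m * b) * b ^ e) div b ^ e"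
      by (simp add: m power_add mult_ac)
    also have "\<dots> = \<delta> L * b ^ m * b + t div b ^ e"
      using \<open>\<delta> L < b\<close> by (intro div_mult_self1) simp
    finally show ?thesis using t(2)[OF e] by (simp add: digit_def)
  qed
  ultimately show ?case by blast
qed

text \<open>A word \<open>z\<close> below is the parameter followed by the encoding of a formula; \<open>clause_start d z j\<close> is the
  position of the length of clause \<open>j\<close>. The minima and the bound \<open>d\<close> are redundant for the words
  that satisfy \<open>well_formed\<close>; they keep the number of loop iterations polynomial on all words.\<close>

definition weight :: "word \<Rightarrow> nat" where "weight z = min (lookup z 0) (length z)"

definition clause_count :: "word \<Rightarrow> nat" where "clause_count z = min (lookup z 1) (length z)"

definition clause_start :: "nat \<Rightarrow> word \<Rightarrow> nat \<Rightarrow> nat" where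
  "clause_start d z j = rec_nat 2 (\<lambda>_ a. a + min (lookup z a) d + 1) j"

definition well_formed :: "nat \<Rightarrow> word \<Rightarrow> bool" where
  "well_formed d z \<longleftrightarrow> 2 \<le> length z \<and> lookup z 0 \<le> length z \<and> lookup z 1 \<le> length z \<and>
     (\<forall>j<clause_count z. lookup z (clause_start d z j) \<le> d) \<and> clause_start d z (clause_count z) = length z"

text \<open>Variables are represented by positions of their literals. The number of a variable can
  be exponential in the size of the word, whereas positions stay below its length and can serve as
  options.\<close>

definition lit_pos :: "nat \<Rightarrow> word \<Rightarrow> nat \<Rightarrow> bool" where
  "lit_pos d z p \<longleftrightarrow> (\<exists>j<clause_count z. \<exists>r<d. r < lookup z (clause_start d z j) \<and> p = clause_start d z j + 1 + r)"

definition var_at :: "word \<Rightarrow> nat \<Rightarrow> nat" where "var_at z p = lookup z p div 2"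

definition gap :: "word \<Rightarrow> nat \<Rightarrow> nat \<Rightarrow> nat" where "gap z t r = digit (weight z + 1) r t"

definition lower :: "word \<Rightarrow> nat \<Rightarrow> nat \<Rightarrow> nat" where "lower z c r = digit (length z) (2 * r) c"

definition upper :: "word \<Rightarrow> nat \<Rightarrow> nat \<Rightarrow> nat" where "upper z c r = digit (length z) (2 * r + 1) c"

text \<open>If the true variables are \<open>x\<^sub>1 < \<dots> < x\<^sub>k\<close>, a positive literal of \<open>v\<close> is false iff \<open>v\<close> lies strictly
  between some consecutive \<open>x\<^sub>i\<close> and \<open>x\<^sub>i\<^sub>+\<^sub>1\<close> (where \<open>x\<^sub>0 = -\<infinity>\<close> and \<open>x\<^sub>k\<^sub>+\<^sub>1 = \<infinity>\<close>), a negative one iff \<open>v\<close> is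
  some \<open>x\<^sub>i\<close>. So the falsity of a clause with at most \<open>d\<close> literals is witnessed by \<open>d\<close> indices
  \<open>gap z t r \<le> k\<close> together with the variables at these indices (\<open>lower\<close>) and their successors
  (\<open>upper\<close>).\<close>

definition falsified :: "nat \<Rightarrow> word \<Rightarrow> nat \<Rightarrow> nat \<Rightarrow> nat \<Rightarrow> nat \<Rightarrow> bool" where
  "falsified d z t c j r \<longleftrightarrow>
     (if even (lookup z (clause_start d z j + 1 + r)) then
        (gap z t r = 0 \<or> var_at z (lower z c r) < var_at z (clause_start d z j + 1 + r)) \<and>
        (gap z t r = weight z \<or> var_at z (clause_start d z j + 1 + r) < var_at z (upper z c r))
      else gap z t r \<noteq> 0 \<and> var_at z (lower z c r) = var_at z (clause_start d z j + 1 + r))"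

text \<open>The first conjunct orders the true variables: digit 0 runs through every index as
  \<open>t\<close> runs through all tuples. In the second, a guess \<open>t\<close> with wrong gaps
  falsifies nothing, since \<open>falsified\<close> also checks that the gap is right.\<close>

definition consistent :: "nat \<Rightarrow> word \<Rightarrow> nat \<Rightarrow> nat \<Rightarrow> bool" where
  "consistent d z t c \<longleftrightarrow>
     (0 < gap z t 0 \<and> gap z t 0 < weight z \<longrightarrow> var_at z (lower z c 0) < var_at z (upper z c 0)) \<and>
     (\<forall>j<clause_count z. \<exists>r<d. r < lookup z (clause_start d z j) \<and> \<not> falsified d z t c j r)"

definition slots :: "nat \<Rightarrow> word \<Rightarrow> nat" where "slots d z = weight z + (weight z + 1) ^ d"

definition option_count :: "nat \<Rightarrow> word \<Rightarrow> nat" where "option_count d z = length z ^ (2 * d)"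

definition valid_option :: "nat \<Rightarrow> word \<Rightarrow> nat \<Rightarrow> nat \<Rightarrow> bool" where
  "valid_option d z i j \<longleftrightarrow> (if i < weight z then j < length z \<and> lit_pos d z j else consistent d z (i - weight z) j)"

text \<open>Slots count from 0, true variables from 1: x_g sits in slot g - 1 and its successor in
  slot g.\<close>

definition demands :: "nat \<Rightarrow> word \<Rightarrow> nat \<Rightarrow> nat \<Rightarrow> nat \<Rightarrow> nat \<Rightarrow> bool" where
  "demands d z i j i' j' \<longleftrightarrow> i' < weight z \<and> weight z \<le> i \<and>
     (\<exists>r<d. i' + 1 = gap z (i - weight z) r \<and> j' = lower z j r \<or> i' = gap z (i - weight z) r \<and> j' = upper z j r)"

section \<open>Encodings of formulas\<close>

fun decode_literal :: "nat \<Rightarrow> literal" where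
  "decode_literal l = (if even l then Pos (l div 2) else Neg (l div 2))"

lemma encode_decode: "encode_literal (decode_literal l) = l"
  by (cases "even l") auto

definition encode_clause :: "literal list \<Rightarrow> word" where
  "encode_clause C = length C # map encode_literal C"

lemma encode_cnf_clauses: "encode_cnf F = length F # concat (map encode_clause F)"
  by (simp add: encode_cnf_def encode_clause_def[abs_def])

lemma map_lookup: "map (lookup z) [2..<length z] = drop 2 z"
  by (rule nth_equalityI) (auto simp: lookup_def)

text \<open>Every number encodes a literal, so the length prefixes are all that has to be
  checked.\<close>

lemma well_formed_imp_encoding:
  assumes ok: "well_formed d z"
  shows "\<exists>F. encode_cnf F = tl z \<and> (\<forall>C\<in>set F. length C \<le> d)"
proof -
  let ?C = "\<lambda>j. map (\<lambda>r. decode_literal (lookup z (clause_start d z j + 1 + r))) [0..<lookup z (clause_start d z j)]"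
  let ?F = "map ?C [0..<clause_count z]"
  have le: "lookup z (clause_start d z j) \<le> d" if "j < clause_count z" for j using ok that by (simp add: well_formed_def)
  have "concat (map encode_clause (map ?C [0..<j])) = map (lookup z) [2..<clause_start d z j] \<and> 2 \<le> clause_start d z j"
    if "j \<le> clause_count z" for j
    using that
  proof (induction j)
    case 0
    then show ?case by (simp add: clause_start_def)
  next
    case (Suc j)
    let ?a = "clause_start d z j" let ?l = "lookup z ?a"
    have next': "clause_start d z (Suc j) = ?a + 1 + ?l" using le[of j] Suc.prems by (simp add: clause_start_def)
    have IH: "concat (map encode_clause (map ?C [0..<j])) = map (lookup z) [2..<?a]" "2 \<le> ?a" using Suc by simp_all
    have "[2..<?a + 1 + ?l] = [2..<?a] @ ?a # [?a + 1..<?a + 1 + ?l]"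
      using IH(2) upt_add_eq_append[of 2 ?a "1 + ?l"] by (simp add: upt_rec[of ?a])
    moreover have "[?a + 1..<?a + 1 + ?l] = map (\<lambda>r. ?a + 1 + r) [0..<?l]"
      using map_add_upt[of "?a + 1" ?l] by (simp add: add.commute)
    ultimately have "map (lookup z) [2..<clause_start d z (Suc j)] =
        map (lookup z) [2..<?a] @ ?l # map (\<lambda>r. lookup z (?a + 1 + r)) [0..<?l]"
      unfolding next' by simp
    moreover have "encode_clause (?C j) = ?l # map (\<lambda>r. lookup z (?a + 1 + r)) [0..<?l]"
      by (simp add: encode_clause_def comp_def encode_decode del: decode_literal.simps)
    ultimately show ?case using IH next' by (simp del: upt_Suc add: upt_Suc_append)
  qed
  from this[of "clause_count z"] have "concat (map encode_clause ?F) = drop 2 z"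
    using ok map_lookup[of z] by (simp add: well_formed_def)
  moreover have "lookup z 1 = z ! 1" "clause_count z = z ! 1" "2 \<le> length z"
    using ok by (auto simp: well_formed_def lookup_def clause_count_def)
  moreover have "tl z = z ! 1 # drop 2 z"
    using \<open>2 \<le> length z\<close> by (cases z; cases "tl z") auto
  ultimately have "encode_cnf ?F = tl z" by (simp add: encode_cnf_clauses)
  moreover have "\<forall>C\<in>set ?F. length C \<le> d" using le by simp
  ultimately show ?thesis by blast
qed

lemma encoding:
  assumes z: "z = k # encode_cnf F" and d: "\<forall>C\<in>set F. length C \<le> d"
  shows "clause_count z = length F" "lookup z 1 = length F" "clause_start d z (length F) = length z"
    "j < length F \<Longrightarrow> lookup z (clause_start d z j) = length (F ! j)"
    "j < length F \<Longrightarrow> r < length (F ! j) \<Longrightarrow> lookup z (clause_start d z j + 1 + r) = encode_literal (F ! j ! r)"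
proof -
  define pos where "pos = (\<lambda>j. 2 + length (concat (map encode_clause (take j F))))"
  have zz: "z = k # length F # concat (map encode_clause F)" using z encode_cnf_clauses by simp
  have split: "z = (k # length F # concat (map encode_clause (take j F))) @
      encode_clause (F ! j) @ concat (map encode_clause (drop (Suc j) F))" if "j < length F" for j
  proof -
    have "F = take j F @ F ! j # drop (Suc j) F" using that by (rule id_take_nth_drop)
    then have "concat (map encode_clause F) =
      concat (map encode_clause (take j F @ F ! j # drop (Suc j) F))" by simp
    then show ?thesis unfolding zz by simp
  qed
  have lookup_pos: "lookup z (pos j + s) = encode_clause (F ! j) ! s"
    if "j < length F" "s < length (encode_clause (F ! j))" for j s
    unfolding lookup_def using that(2)
    by (subst (1 2) split[OF that(1)]) (simp add: pos_def nth_append)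
  have len: "length (encode_clause C) = Suc (length C)" for C by (simp add: encode_clause_def)
  have rd0: "lookup z (pos j) = length (F ! j)" if "j < length F" for j
    using lookup_pos[OF that, of 0] by (simp add: encode_clause_def)
  have clause_start: "clause_start d z j = pos j" if "j \<le> length F" for j
    using that
  proof (induction j)
    case 0
    then show ?case by (simp add: clause_start_def pos_def)
  next
    case (Suc j)
    then have "clause_start d z (Suc j) = pos j + min (lookup z (pos j)) d + 1" by (simp add: clause_start_def)
    also have "\<dots> = pos j + length (F ! j) + 1" using rd0[of j] d Suc.prems by simp
    also have "\<dots> = pos (Suc j)" using Suc.prems by (simp add: pos_def take_Suc_conv_app_nth len)
    finally show ?case .
  qed
  show rd1: "lookup z 1 = length F" by (simp add: zz lookup_def)
  \<comment> \<open>Every clause contributes at least its length prefix, so the minimum in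
    \<open>clause_count\<close> does not cut off clauses.\<close>
  have "length F \<le> length (concat (map encode_clause F))"
    unfolding length_concat using sum_list_mono[of F "\<lambda>_. 1" "\<lambda>C. length (encode_clause C)"]
    by (simp add: len comp_def sum_list_triv)
  then show "clause_count z = length F" using rd1 by (simp add: clause_count_def zz)
  show "clause_start d z (length F) = length z" 
    by (simp only: clause_start[OF order_refl] pos_def) (simp add: zz)
  show "lookup z (clause_start d z j) = length (F ! j)" if "j < length F"
    using clause_start[of j] rd0[OF that] that by simp
  show "lookup z (clause_start d z j + 1 + r) = encode_literal (F ! j ! r)"
    if "j < length F" "r < length (F ! j)"
    using clause_start[of j] lookup_pos[of j "Suc r"] that by (simp add: encode_clause_def)
qed

text \<open>The k true variables all occur in the formula, so k is at most the number of literals.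
  Words that are not well formed may thus be sent to a fixed no-instance.\<close>

lemma weighted_sat_imp_well_formed:
  assumes "(x, k) \<in> weighted_sat d"
  shows "well_formed d (k # x)"
proof -
  obtain F S where F: "x = encode_cnf F" "\<forall>C\<in>set F. length C \<le> d" and S: "S \<subseteq> cnf_vars F" "card S = k"
    using assms unfolding weighted_sat_def by blast
  let ?z = "k # x"
  have z: "?z = k # encode_cnf F" using F by simp
  note enc = encoding[OF z F(2)]
  have "cnf_vars F \<subseteq> (\<lambda>l. l div 2) ` set (concat (map encode_clause F))"
  proof
    fix v assume "v \<in> cnf_vars F"
    then obtain C l where l: "C \<in> set F" "l \<in> set C" "v = literal_var l" unfolding cnf_vars_def by blast
    then have "encode_literal l \<in> set (concat (map encode_clause F))"
      by (auto simp: encode_clause_def)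
    moreover have "encode_literal l div 2 = v" using l(3) by (cases l) auto
    ultimately show "v \<in> (\<lambda>l. l div 2) ` set (concat (map encode_clause F))" by (metis imageI)
  qed
  then have "S \<subseteq> (\<lambda>l. l div 2) ` set (concat (map encode_clause F))" using S by blast
  then have "k \<le> card (set (concat (map encode_clause F)))"
    using S(2) card_mono card_image_le by (metis (no_types, lifting) List.finite_set finite_imageI order_trans)
  also have "\<dots> \<le> length (concat (map encode_clause F))" by (rule card_length)
  finally have "lookup ?z 0 \<le> length ?z" by (simp add: F(1) encode_cnf_clauses lookup_def)
  moreover have "2 \<le> length ?z" by (simp add: F(1) encode_cnf_clauses)
  moreover have "lookup ?z (clause_start d ?z j) \<le> d" if "j < clause_count ?z" for j
    using enc(4)[of j] that enc(1) F(2) by simp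
  moreover have "lookup ?z 1 \<le> length ?z" using enc(1,2) by (simp add: clause_count_def min_def split: if_splits)
  ultimately show ?thesis using enc(1,3) unfolding well_formed_def by simp
qed

lemma encode_literal_simps:
  "even (encode_literal l) \<longleftrightarrow> (\<exists>v. l = Pos v)" "encode_literal l div 2 = literal_var l"
  by (cases l; simp)+

lemma lit_pos_vars:
  assumes z: "z = k # encode_cnf F" and d: "\<forall>C\<in>set F. length C \<le> d"
  shows "cnf_vars F = var_at z ` {p. lit_pos d z p}"
proof -
  note enc = encoding[OF z d]
  have dF: "length (F ! j) \<le> d" if "j < length F" for j using d that by simp
  have "lit_pos d z p \<longleftrightarrow> (\<exists>j<length F. \<exists>r<length (F ! j). p = clause_start d z j + 1 + r)" for p
    unfolding lit_pos_def enc(1) using enc(4) dF by (metis order_less_le_trans)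
  then have "var_at z ` {p. lit_pos d z p} = {literal_var (F ! j ! r) | j r. j < length F \<and> r < length (F ! j)}"
    using enc(5) encode_literal_simps(2) by (auto simp: var_at_def image_iff) (metis)+
  also have "\<dots> = cnf_vars F"
  proof (intro set_eqI iffI)
    fix v assume "v \<in> cnf_vars F"
    then obtain C l where l: "C \<in> set F" "l \<in> set C" "v = literal_var l" unfolding cnf_vars_def by blast
    then obtain j r where "j < length F" "C = F ! j" "r < length C" "l = C ! r"
      by (auto simp: in_set_conv_nth)
    then show "v \<in> {literal_var (F ! j ! r) | j r. j < length F \<and> r < length (F ! j)}"
      using l(3) by blast
  next
    fix v assume "v \<in> {literal_var (F ! j ! r) | j r. j < length F \<and> r < length (F ! j)}"
    then obtain j r where "j < length F" "r < length (F ! j)" "v = literal_var (F ! j ! r)" by blast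
    then have "F ! j \<in> set F" "F ! j ! r \<in> set (F ! j)" "v = literal_var (F ! j ! r)" by simp_all
    then show "v \<in> cnf_vars F" unfolding cnf_vars_def by blast
  qed
  finally show ?thesis by simp
qed

lemma lit_pos_less:
  assumes z: "z = k # encode_cnf F" and d: "\<forall>C\<in>set F. length C \<le> d" and p: "lit_pos d z p"
  shows "p < length z"
proof (rule ccontr)
  note enc = encoding[OF z d]
  assume n: "\<not> p < length z"
  obtain j r where jr: "j < clause_count z" "r < lookup z (clause_start d z j)" "p = clause_start d z j + 1 + r"
    using p unfolding lit_pos_def by blast
  have mono: "clause_start d z i \<le> clause_start d z j" if "i \<le> j" for i j
    using that by (induction rule: dec_induct) (auto simp: clause_start_def)
  have "clause_start d z (Suc j) = clause_start d z j + lookup z (clause_start d z j) + 1"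
    using enc(4)[of j] jr(1) enc(1) d by (simp add: clause_start_def)
  moreover have "clause_start d z (Suc j) \<le> length z" using mono[of "Suc j" "clause_count z"] jr(1) enc by simp
  ultimately show False using n jr by simp
qed

section \<open>Choices of options and satisfying assignments\<close>

definition choice :: "nat \<Rightarrow> word \<Rightarrow> (nat \<Rightarrow> nat) \<Rightarrow> bool" where
  "choice d z \<sigma> \<longleftrightarrow> (\<forall>i<slots d z. \<sigma> i < option_count d z \<and> valid_option d z i (\<sigma> i) \<and>
     (\<forall>i'<weight z. \<forall>j'<option_count d z. demands d z i (\<sigma> i) i' j' \<longrightarrow> \<sigma> i' = j'))"

text \<open>Locates the gap of an increasing sequence into which \<open>v\<close> falls; it supplies
  the index that witnesses a false positive literal.\<close>

lemma ex_threshold: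
  fixes f :: "nat \<Rightarrow> nat"
  assumes "\<And>i. i + 1 < k \<Longrightarrow> f i < f (i + 1)"
  shows "\<exists>c\<le>k. \<forall>i<k. i < c \<longleftrightarrow> f i < v"
  using assms
proof (induction k)
  case (Suc k)
  then obtain c where c: "c \<le> k" "\<And>i. i < k \<Longrightarrow> i < c \<longleftrightarrow> f i < v" by auto
  show ?case
  proof (cases "c = k \<and> f k < v")
    case True
    then show ?thesis using c by (intro exI[of _ "Suc k"]) (auto simp: less_Suc_eq)
  next
    case False
    have "\<not> f k < v"
    proof (cases k)
      case 0
      then show ?thesis using False c by simp
    next
      case (Suc l)
      then have "f l < f k" using Suc.prems[of l] by simp
      moreover have "\<not> f l < v \<or> c = k" using c(2)[of l] c(1) Suc by auto
      ultimately show ?thesis using False by auto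
    qed
    then show ?thesis using c by (intro exI[of _ c]) (auto simp: less_Suc_eq)
  qed
qed simp

context
  fixes d :: nat and z :: word and k :: nat and F :: cnf
  assumes d: "1 \<le> d" and z: "z = k # encode_cnf F" and F: "\<forall>C\<in>set F. length C \<le> d"
    and ok: "well_formed d z"
begin

lemma weight: "weight z = k"
  using ok z by (simp add: well_formed_def weight_def lookup_def)

lemma length_z: "2 \<le> length z" "length z \<le> option_count d z"
proof -
  show "2 \<le> length z" using ok by (simp add: well_formed_def)
  then have "length z ^ 1 \<le> length z ^ (2 * d)" using d by (intro power_increasing) auto
  then show "length z \<le> option_count d z" by (simp add: option_count_def)
qed

lemma lower_less: "lower z c r < length z" and upper_less: "upper z c r < length z"
  using length_z(1) by (auto simp: lower_def upper_def intro!: digit_less)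

lemma clause_facts:
  "j < clause_count z \<longleftrightarrow> j < length F"
  "j < length F \<Longrightarrow> lookup z (clause_start d z j) = length (F ! j)"
  "j < length F \<Longrightarrow> length (F ! j) \<le> d"
  "j < length F \<Longrightarrow> r < length (F ! j) \<Longrightarrow> even (lookup z (clause_start d z j + 1 + r)) \<longleftrightarrow> (\<exists>v. F ! j ! r = Pos v)"
  "j < length F \<Longrightarrow> r < length (F ! j) \<Longrightarrow> var_at z (clause_start d z j + 1 + r) = literal_var (F ! j ! r)"
proof -
  note enc = encoding[OF z F]
  show "j < clause_count z \<longleftrightarrow> j < length F" using enc(1) by simp
  show "j < length F \<Longrightarrow> lookup z (clause_start d z j) = length (F ! j)" by (rule enc(4))
  show "j < length F \<Longrightarrow> length (F ! j) \<le> d" using F by simp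
  show "even (lookup z (clause_start d z j + 1 + r)) \<longleftrightarrow> (\<exists>v. F ! j ! r = Pos v)"
    "var_at z (clause_start d z j + 1 + r) = literal_var (F ! j ! r)"
    if "j < length F" "r < length (F ! j)"
    unfolding var_at_def enc(5)[OF that] by (rule encode_literal_simps)+
qed

text \<open>If a clause were false, the witnessing indices of its literals would form a tuple t. The
  demands make the option of slot k + t agree with the chosen variables, so it would falsify every
  literal of that clause and not be consistent.\<close>

lemma choice_imp_sat:
  assumes \<sigma>: "choice d z \<sigma>"
  shows "\<exists>S\<subseteq>cnf_vars F. card S = k \<and> cnf_holds S F"
proof -
  let ?v = "\<lambda>i. var_at z (\<sigma> i)"
  let ?S = "?v ` {..<k}"
  have base: "lit_pos d z (\<sigma> i)" if "i < k" for i
  proof -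
    have "i < slots d z" using that by (simp add: slots_def weight)
    then have "valid_option d z i (\<sigma> i)" using \<sigma> unfolding choice_def by blast
    then show ?thesis using that by (simp add: valid_option_def weight)
  qed
  have check: "consistent d z t (\<sigma> (k + t))" "\<And>r i. r < d \<Longrightarrow> gap z t r = i + 1 \<Longrightarrow> i < k \<Longrightarrow> lower z (\<sigma> (k + t)) r = \<sigma> i"
    "\<And>r i. r < d \<Longrightarrow> gap z t r = i \<Longrightarrow> i < k \<Longrightarrow> upper z (\<sigma> (k + t)) r = \<sigma> i"
    if t: "t < (k + 1) ^ d" for t
  proof -
    let ?c = "\<sigma> (k + t)"
    have "k + t < slots d z" using t by (simp add: slots_def weight)
    then have s: "valid_option d z (k + t) ?c"
      "\<And>i' j'. i' < k \<Longrightarrow> j' < option_count d z \<Longrightarrow> demands d z (k + t) ?c i' j' \<Longrightarrow> \<sigma> i' = j'"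
      using \<sigma> unfolding choice_def weight by blast+
    show "consistent d z t ?c" using s(1) by (simp add: valid_option_def weight)
    fix r i assume r: "r < d" "i < k"
    {
      assume "gap z t r = i + 1"
      then have dem: "demands d z (k + t) ?c i (lower z ?c r)" using r by (auto simp: demands_def weight)
      have "lower z ?c r < option_count d z" using lower_less[of ?c r] length_z(2) by simp
      from s(2)[OF r(2) this dem] show "lower z ?c r = \<sigma> i" by simp
    next
      assume "gap z t r = i"
      then have dem: "demands d z (k + t) ?c i (upper z ?c r)" using r by (auto simp: demands_def weight)
      have "upper z ?c r < option_count d z" using upper_less[of ?c r] length_z(2) by simp
      from s(2)[OF r(2) this dem] show "upper z ?c r = \<sigma> i" by simp
    }
  qed
  \<comment> \<open>The tuple coded by \<open>i + 1\<close> has lowest digit \<open>i + 1\<close>,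
    so its slot compares just these two variables.\<close>
  have mono: "?v i < ?v (i + 1)" if i: "i + 1 < k" for i
  proof -
    have "i + 1 < (k + 1) ^ 1" using i by simp
    also have "\<dots> \<le> (k + 1) ^ d" using d by (intro power_increasing) auto
    finally have t: "i + 1 < (k + 1) ^ d" .
    let ?c = "\<sigma> (k + (i + 1))"
    have g: "gap z (i + 1) 0 = i + 1" using i by (simp add: gap_def digit_def weight)
    then have "var_at z (lower z ?c 0) < var_at z (upper z ?c 0)"
      using check(1)[OF t] i unfolding consistent_def weight by simp
    moreover have "lower z ?c 0 = \<sigma> i" by (rule check(2)[OF t _ g]) (use i d in auto)
    moreover have "upper z ?c 0 = \<sigma> (i + 1)" by (rule check(3)[OF t _ g]) (use i d in auto)
    ultimately show ?thesis by simp
  qed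
  have less: "?v i < ?v j" if "i < j" "j < k" for i j
    using that
  proof (induction j)
    case (Suc j)
    show ?case
    proof (cases "i = j")
      case True
      then show ?thesis using mono[of i] Suc.prems by simp
    next
      case False
      then have "?v i < ?v j" using Suc by simp
      also have "\<dots> < ?v (Suc j)" using mono[of j] Suc.prems by simp
      finally show ?thesis .
    qed
  qed simp
  have "inj_on ?v {..<k}"
  proof (rule inj_onI)
    fix i j assume "i \<in> {..<k}" "j \<in> {..<k}" "?v i = ?v j"
    then show "i = j" using less[of i j] less[of j i] by (cases i j rule: linorder_cases) auto
  qed
  then have "card ?S = k" by (simp add: card_image)
  moreover have "?S \<subseteq> cnf_vars F" using base unfolding lit_pos_vars[OF z F] by blast
  moreover have "cnf_holds ?S F"
  proof (rule ccontr)
    assume "\<not> cnf_holds ?S F"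
    then obtain C where C: "C \<in> set F" "\<forall>l\<in>set C. \<not> literal_holds ?S l"
      unfolding cnf_holds_def by blast
    then obtain j where "j < length F" "C = F ! j" by (auto simp: in_set_conv_nth)
    with C have j: "j < length F" "\<And>r. r < length (F ! j) \<Longrightarrow> \<not> literal_holds ?S (F ! j ! r)" by simp_all
    \<comment> \<open>\<open>g\<close> witnesses that literal \<open>r\<close> is false; digits
      beyond the end of the clause are arbitrary up to \<open>k\<close>.\<close>
    define P where "P = (\<lambda>r g. g \<le> k \<and> (r < length (F ! j) \<longrightarrow> (case F ! j ! r of
        Pos v \<Rightarrow> (\<forall>i<k. i < g \<longleftrightarrow> ?v i < v) | Neg v \<Rightarrow> 0 < g \<and> ?v (g - 1) = v)))"
    have ex: "\<exists>g. P r g" for r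
    proof (cases "r < length (F ! j)")
      case True
      show ?thesis
      proof (cases "F ! j ! r")
        case (Pos v)
        obtain c where "c \<le> k" "\<forall>i<k. i < c \<longleftrightarrow> ?v i < v" using ex_threshold[of k ?v v] mono by blast
        then have "P r c" using Pos by (simp add: P_def)
        then show ?thesis by blast
      next
        case (Neg v)
        then have "v \<in> ?S" using j(2)[OF True] by simp
        then obtain i where "i < k" "?v i = v" by blast
        then have "P r (i + 1)" using Neg by (simp add: P_def)
        then show ?thesis by blast
      qed
    next
      case False
      then have "P r 0" by (simp add: P_def)
      then show ?thesis by blast
    qed
    define g where "g = (\<lambda>r. SOME g. P r g)"
    have "P r (g r)" for r unfolding g_def by (rule someI_ex[OF ex])
    then have g: "\<And>r. g r \<le> k" "\<And>r. r < length (F ! j) \<Longrightarrow> (case F ! j ! r of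
        Pos v \<Rightarrow> (\<forall>i<k. i < g r \<longleftrightarrow> ?v i < v) | Neg v \<Rightarrow> 0 < g r \<and> ?v (g r - 1) = v)"
      unfolding P_def by simp_all
    have "\<exists>t<(k + 1) ^ d. \<forall>r<d. digit (k + 1) r t = g r"
      by (rule ex_digits) (use g(1) in \<open>simp add: less_Suc_eq_le\<close>)
    then obtain t where t: "t < (k + 1) ^ d" "\<And>r. r < d \<Longrightarrow> gap z t r = g r"
      unfolding gap_def weight by blast
    let ?c = "\<sigma> (k + t)"
    from check(1)[OF t(1)] have "\<forall>j<clause_count z. \<exists>r<d. r < lookup z (clause_start d z j) \<and> \<not> falsified d z t ?c j r"
      unfolding consistent_def by (rule conjunct2)
    then obtain r where r: "r < d" "r < length (F ! j)" "\<not> falsified d z t ?c j r"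
      using clause_facts(1)[of j] clause_facts(2)[OF j(1)] j(1) by auto
    note gr = t(2)[OF r(1)]
    have low: "lower z ?c r = \<sigma> (g r - 1)" if "g r \<noteq> 0"
      using check(2)[OF t(1) r(1), of "g r - 1"] gr that g(1)[of r] by simp
    have up: "upper z ?c r = \<sigma> (g r)" if "g r \<noteq> k"
      using check(3)[OF t(1) r(1), of "g r"] gr that g(1)[of r] by simp
    have "falsified d z t ?c j r"
    proof (cases "F ! j ! r")
      case (Pos v)
      have thr: "i < g r \<longleftrightarrow> ?v i < v" if "i < k" for i using g(2)[OF r(2)] Pos that by simp
      have "v \<notin> ?S" using j(2)[OF r(2)] Pos by simp
      have A: "g r = 0 \<or> var_at z (lower z ?c r) < v"
        using thr[of "g r - 1"] low g(1)[of r] by (cases "g r = 0") simp_all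
      have B: "g r = k \<or> v < var_at z (upper z ?c r)"
      proof (cases "g r = k")
        case False
        then have "g r < k" using g(1)[of r] by simp
        then have "\<not> ?v (g r) < v" "?v (g r) \<noteq> v" using thr[of "g r"] \<open>v \<notin> ?S\<close> by auto
        then show ?thesis using up False by simp
      qed simp
      have "even (lookup z (clause_start d z j + 1 + r))" "var_at z (clause_start d z j + 1 + r) = v"
        using clause_facts(4,5)[OF j(1) r(2)] Pos by simp_all
      then show ?thesis using A B unfolding falsified_def gr weight by simp
    next
      case (Neg v)
      then have "g r \<noteq> 0" "?v (g r - 1) = v" using g(2)[OF r(2)] by auto
      moreover have "odd (lookup z (clause_start d z j + 1 + r))" "var_at z (clause_start d z j + 1 + r) = v"
        using clause_facts(4,5)[OF j(1) r(2)] Neg by simp_all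
      ultimately show ?thesis using low unfolding falsified_def gr weight by simp
    qed
    then show False using r by blast
  qed
  ultimately show ?thesis by blast
qed

text \<open>The true variables in increasing order fill the first k slots, each through some
  position where it occurs. Every other option is dictated by the demands, and it is consistent
  because a true literal is falsified under no guess.\<close>

lemma sat_imp_choice:
  assumes S: "S \<subseteq> cnf_vars F" "card S = k" "cnf_holds S F"
  shows "\<exists>\<sigma>. choice d z \<sigma>"
proof -
  have fin: "finite S"
    using S(1) by (rule finite_subset) (auto simp: cnf_vars_def)
  define v where "v = (\<lambda>i. sorted_list_of_set S ! i)"
  have len: "length (sorted_list_of_set S) = k" using S(2) by simp
  have less: "v i < v i'" if "i < i'" "i' < k" for i i'
    using strict_sorted_list_of_set[of S] that len unfolding v_def sorted_wrt_iff_nth_less by simp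
  have mem: "x \<in> S \<longleftrightarrow> (\<exists>i<k. v i = x)" for x
    using set_sorted_list_of_set[OF fin] len unfolding v_def by (metis in_set_conv_nth)
  define \<pi> where "\<pi> = (\<lambda>i. SOME p. lit_pos d z p \<and> var_at z p = v i)"
  have "lit_pos d z (\<pi> i) \<and> var_at z (\<pi> i) = v i" if "i < k" for i
  proof -
    have "v i \<in> cnf_vars F" using S(1) mem that by blast
    then have "\<exists>p. lit_pos d z p \<and> var_at z p = v i" unfolding lit_pos_vars[OF z F] by auto
    then show ?thesis unfolding \<pi>_def by (rule someI_ex)
  qed
  then have \<pi>: "\<And>i. i < k \<Longrightarrow> lit_pos d z (\<pi> i)" "\<And>i. i < k \<Longrightarrow> var_at z (\<pi> i) = v i" by simp_all
  have \<pi>_less: "\<pi> i < length z" if "i < k" for i using lit_pos_less[OF z F \<pi>(1)[OF that]] .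
  have gap_le: "gap z t r \<le> k" for t r
    using digit_less[of "weight z + 1" r t] by (simp add: gap_def weight)
  \<comment> \<open>At the two ends the neighbour is missing. The placeholder 0 is never inspected:
    \<open>falsified\<close>, \<open>consistent\<close> and \<open>demands\<close> all test the gap
    first.\<close>
  let ?lo = "\<lambda>t r. if gap z t r = 0 then 0 else \<pi> (gap z t r - 1)"
  let ?up = "\<lambda>t r. if gap z t r = k then 0 else \<pi> (gap z t r)"
  define Q where "Q = (\<lambda>t c. c < option_count d z \<and> (\<forall>r<d. lower z c r = ?lo t r \<and> upper z c r = ?up t r))"
  have ex: "\<exists>c. Q t c" for t
  proof -
    let ?\<delta> = "\<lambda>e. if even e then ?lo t (e div 2) else ?up t (e div 2)"
    have "\<exists>c<length z ^ (2 * d). \<forall>e<2 * d. digit (length z) e c = ?\<delta> e"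
    proof (rule ex_digits)
      fix e
      have "?lo t r < length z" "?up t r < length z" for r
        using length_z(1) gap_le[of t r] by (auto intro!: \<pi>_less)
      then show "?\<delta> e < length z" by simp
    qed
    then obtain c where c: "c < option_count d z" "\<And>e. e < 2 * d \<Longrightarrow> digit (length z) e c = ?\<delta> e"
      unfolding option_count_def by blast
    have "lower z c r = ?lo t r \<and> upper z c r = ?up t r" if "r < d" for r
      using c(2)[of "2 * r"] c(2)[of "2 * r + 1"] that by (simp add: lower_def upper_def)
    then show ?thesis using c(1) unfolding Q_def by blast
  qed
  define h where "h = (\<lambda>t. SOME c. Q t c)"
  have "Q t (h t)" for t unfolding h_def by (rule someI_ex[OF ex])
  then have h: "\<And>t. h t < option_count d z"
    "\<And>t r. r < d \<Longrightarrow> lower z (h t) r = ?lo t r" "\<And>t r. r < d \<Longrightarrow> upper z (h t) r = ?up t r"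
    unfolding Q_def by blast+
  define \<sigma> where "\<sigma> = (\<lambda>i. if i < k then \<pi> i else h (i - k))"
  have consistent: "consistent d z t (h t)" for t
    unfolding consistent_def
  proof (intro conjI impI allI)
    assume "0 < gap z t 0 \<and> gap z t 0 < weight z"
    then have g: "gap z t 0 \<noteq> 0" "gap z t 0 \<noteq> k" "gap z t 0 < k" "gap z t 0 - 1 < k" "gap z t 0 - 1 < gap z t 0"
      by (auto simp: weight)
    have "0 < d" using d by simp
    then have "lower z (h t) 0 = \<pi> (gap z t 0 - 1)" "upper z (h t) 0 = \<pi> (gap z t 0)"
      using h(2,3)[of 0 t] g(1,2) by simp_all
    then show "var_at z (lower z (h t) 0) < var_at z (upper z (h t) 0)"
      using \<pi>(2)[OF g(3)] \<pi>(2)[OF g(4)] less[OF g(5,3)] by simp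
  next
    fix j assume "j < clause_count z"
    then have j: "j < length F" using clause_facts by simp
    have "\<exists>l\<in>set (F ! j). literal_holds S l"
      using S(3) nth_mem[OF j] unfolding cnf_holds_def by blast
    then obtain r where r: "r < length (F ! j)" "literal_holds S (F ! j ! r)"
      by (auto simp: in_set_conv_nth)
    have lookup: "r < d" using r clause_facts(3)[OF j] by simp
    have "\<not> falsified d z t (h t) j r"
    proof
      assume f: "falsified d z t (h t) j r"
      let ?g = "gap z t r"
      have lo: "var_at z (lower z (h t) r) = v (?g - 1)" if "?g \<noteq> 0"
        using that h(2)[OF lookup, of t] \<pi>(2)[of "?g - 1"] gap_le[of t r] by simp
      have up: "var_at z (upper z (h t) r) = v ?g" if "?g \<noteq> k"
        using that h(3)[OF lookup, of t] \<pi>(2)[of ?g] gap_le[of t r] by simp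
      show False
      proof (cases "F ! j ! r")
        case (Pos x)
        then have x: "var_at z (clause_start d z j + 1 + r) = x" "even (lookup z (clause_start d z j + 1 + r))" "x \<in> S"
          using clause_facts(4,5)[OF j r(1)] r(2) by auto
        then obtain i where i: "i < k" "v i = x" using mem by blast
        \<comment> \<open>The literal being true, its variable is some \<open>v i\<close>, which
          cannot lie strictly between consecutive members of the sequence.\<close>
        have "?g = 0 \<or> v (?g - 1) < v i" "?g = k \<or> v i < v ?g"
          using f x(1,2) i(2) lo up unfolding falsified_def weight by (cases "?g = 0"; cases "?g = k"; simp)+
        moreover have "\<not> v (?g - 1) < v i" if "i < ?g" 
        proof (cases "i = ?g - 1")
          case False
          then have "i < ?g - 1" "?g - 1 < k" using that gap_le[of t r] by linarith+
          then show ?thesis using less[of i "?g - 1"] by simp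
        qed simp
        moreover have "\<not> v i < v ?g" if "\<not> i < ?g"
        proof (cases "i = ?g")
          case False
          then show ?thesis using less[of ?g i] that i(1) by simp
        qed simp
        ultimately show False using i(1) by (cases "i < ?g") auto
      next
        case (Neg x)
        then have x: "var_at z (clause_start d z j + 1 + r) = x" "odd (lookup z (clause_start d z j + 1 + r))" "x \<notin> S"
          using clause_facts(4,5)[OF j r(1)] r(2) by auto
        have g: "?g \<noteq> 0" "var_at z (lower z (h t) r) = x" using f x(1,2) unfolding falsified_def by simp_all
        then have "v (?g - 1) = x" "?g - 1 < k" using lo gap_le[of t r] by simp_all
        then show False using mem x by blast
      qed
    qed
    then show "\<exists>r<d. r < lookup z (clause_start d z j) \<and> \<not> falsified d z t (h t) j r"
      using r(1) lookup clause_facts(2)[OF j] by auto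
  qed
  have "choice d z \<sigma>"
    unfolding choice_def
  proof (intro allI impI conjI)
    fix i assume i: "i < slots d z"
    show "\<sigma> i < option_count d z" using h(1) \<pi>_less length_z(2) by (auto simp: \<sigma>_def intro: order_less_le_trans)
    show "valid_option d z i (\<sigma> i)" using consistent \<pi>(1) \<pi>_less by (simp add: valid_option_def \<sigma>_def weight)
    fix i' j' assume i': "i' < weight z" and dem: "demands d z i (\<sigma> i) i' j'"
    let ?t = "i - k"
    have ik: "\<not> i < k" using dem by (simp add: demands_def weight)
    obtain r where r: "r < d" "i' + 1 = gap z ?t r \<and> j' = lower z (h ?t) r \<or>
        i' = gap z ?t r \<and> j' = upper z (h ?t) r"
      using dem ik unfolding demands_def weight \<sigma>_def by auto
    have i'k: "i' < k" using i' by (simp add: weight)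
    from r(2) have "j' = \<pi> i'"
    proof
      assume *: "i' + 1 = gap z ?t r \<and> j' = lower z (h ?t) r"
      then have "gap z ?t r \<noteq> 0" "gap z ?t r - 1 = i'" by auto
      then show ?thesis using * h(2)[OF r(1), of ?t] by simp
    next
      assume *: "i' = gap z ?t r \<and> j' = upper z (h ?t) r"
      then have "gap z ?t r \<noteq> k" using i'k by simp
      then show ?thesis using * h(3)[OF r(1), of ?t] by simp
    qed
    then show "\<sigma> i' = j'" using i'k by (simp add: \<sigma>_def)
  qed
  then show ?thesis by blast
qed

end

text \<open>Length prefixes make the code self-delimiting. This is needed because membership in
  \<open>weighted_sat\<close> speaks of some formula with the given code.\<close>

lemma encode_cnf_inject:
  assumes "encode_cnf F = encode_cnf F'" "\<forall>C\<in>set F. length C \<le> d" "\<forall>C\<in>set F'. length C \<le> d"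
  shows "F = F'"
proof (rule nth_equalityI)
  let ?z = "0 # encode_cnf F"
  have z': "?z = 0 # encode_cnf F'" using assms(1) by simp
  note e = encoding[OF refl[of ?z] assms(2)] and e' = encoding[OF z' assms(3)]
  show len: "length F = length F'" using e(1) e'(1) by simp
  fix j assume j: "j < length F"
  show "F ! j = F' ! j"
  proof (rule nth_equalityI)
    show l: "length (F ! j) = length (F' ! j)" using e(4)[OF j] e'(4)[of j] j len by simp
    fix r assume r: "r < length (F ! j)"
    have "encode_literal (F ! j ! r) = encode_literal (F' ! j ! r)"
      using e(5)[OF j r] e'(5)[of j r] j len l r by simp
    then show "F ! j ! r = F' ! j ! r"
      by (cases "F ! j ! r"; cases "F' ! j ! r") (auto, presburger+)
  qed
qed

lemma weighted_sat_iff_choice: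
  assumes d: "1 \<le> d" and ok: "well_formed d (k # x)"
  shows "(x, k) \<in> weighted_sat d \<longleftrightarrow> (\<exists>\<sigma>. choice d (k # x) \<sigma>)"
proof -
  obtain F where F: "x = encode_cnf F" "\<forall>C\<in>set F. length C \<le> d"
    using well_formed_imp_encoding[OF ok] by auto
  then have z: "k # x = k # encode_cnf F" by simp
  have "(x, k) \<in> weighted_sat d \<longleftrightarrow> (\<exists>S \<subseteq> cnf_vars F. card S = k \<and> cnf_holds S F)"
  proof
    assume "(x, k) \<in> weighted_sat d"
    then obtain F' where F': "x = encode_cnf F'" "\<forall>C\<in>set F'. length C \<le> d"
      "\<exists>S \<subseteq> cnf_vars F'. card S = k \<and> cnf_holds S F'" unfolding weighted_sat_def by blast
    have "F' = F" by (rule encode_cnf_inject[OF trans[OF F'(1)[symmetric] F(1)] F'(2) F(2)])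
    from F'(3)[unfolded this] show "\<exists>S \<subseteq> cnf_vars F. card S = k \<and> cnf_holds S F" .
  next
    assume "\<exists>S \<subseteq> cnf_vars F. card S = k \<and> cnf_holds S F"
    then show "(x, k) \<in> weighted_sat d" unfolding weighted_sat_def using F by blast
  qed
  also have "\<dots> \<longleftrightarrow> (\<exists>\<sigma>. choice d (k # x) \<sigma>)"
    using choice_imp_sat[OF d z F(2) ok] sat_imp_choice[OF d z F(2) ok] by blast
  finally show ?thesis .
qed

section \<open>Computing the reduction\<close>

text \<open>\<open>evals\<close> bounds only the length of a value, and numbers read from the word
  can be exponentially large. Loop bounds and the arguments of \<open>digit\<close> must be
  polynomial in value.\<close>

definition cheap :: "('s \<Rightarrow> word) \<Rightarrow> ('s \<Rightarrow> nat) list \<Rightarrow> ('s \<Rightarrow> nat) \<Rightarrow> bool" where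
  "cheap w G f \<longleftrightarrow> evals w G f \<and> small w G f"

lemma cheapD: "cheap w G f \<Longrightarrow> evals w G f" "cheap w G f \<Longrightarrow> small w G f"
  by (simp_all add: cheap_def)

lemma cheap_le: "evals w G f \<Longrightarrow> (\<And>s. f s \<le> g s) \<Longrightarrow> small w G g \<Longrightarrow> cheap w G f"
  unfolding cheap_def by (blast intro: small_mono)

lemma cheap_const: "cheap w G (\<lambda>_. n)" by (simp add: cheap_def evals_const small_const)

lemma cheap_new: "cheap w (ext G) (\<lambda>t. fst (snd t))" "cheap w (ext G) (\<lambda>t. snd (snd t))"
  by (simp_all add: cheap_def evals_new small_new)

lemma cheap_lift: "cheap w G f \<Longrightarrow> cheap (lift w) (ext G) (lift f)"
  by (simp add: cheap_def evals_lift small_lift)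

lemma cheap_length: "cheap w G (\<lambda>s. length (w s))"
  by (simp add: cheap_def evals_length small_length)

lemma cheap_add: "cheap w G f \<Longrightarrow> cheap w G g \<Longrightarrow> cheap w G (\<lambda>s. f s + g s)"
  by (simp add: cheap_def evals_add small_add)

lemma cheap_mult: "cheap w G f \<Longrightarrow> cheap w G g \<Longrightarrow> cheap w G (\<lambda>s. f s * g s)"
  by (simp add: cheap_def evals_mult small_mult)

lemma cheap_power: "cheap w G f \<Longrightarrow> cheap w G (\<lambda>s. f s ^ n)"
  by (simp add: cheap_def evals_power small_power)

lemma cheap_diff: "cheap w G f \<Longrightarrow> cheap w G g \<Longrightarrow> cheap w G (\<lambda>s. f s - g s)"
  by (rule cheap_le[OF evals_diff, where g=f]) (auto simp: cheap_def)

lemma cheap_div: "cheap w G f \<Longrightarrow> cheap w G g \<Longrightarrow> cheap w G (\<lambda>s. f s div g s)"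
  by (rule cheap_le[OF evals_div, where g=f]) (auto simp: cheap_def)

lemma cheap_mod: "cheap w G f \<Longrightarrow> cheap w G g \<Longrightarrow> cheap w G (\<lambda>s. f s mod g s)"
  by (rule cheap_le[OF evals_mod, where g=f]) (auto simp: cheap_def)

lemma cheap_min_length: "evals w G f \<Longrightarrow> cheap w G (\<lambda>s. min (f s) (length (w s)))"
  by (rule cheap_le[OF evals_min[OF _ evals_length], where g="\<lambda>s. length (w s)"]) (auto simp: small_length)

lemma cheap_weight: "cheap w G (\<lambda>s. weight (w s))"
  unfolding weight_def by (intro cheap_min_length evals_lookup evals_const)

lemma cheap_clause_count: "cheap w G (\<lambda>s. clause_count (w s))"
  unfolding clause_count_def by (intro cheap_min_length evals_lookup evals_const)

lemma cheap_clause_start: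
  assumes j: "cheap w G j"
  shows "cheap w G (\<lambda>s. clause_start d (w s) (j s))"
proof -
  have le: "rec_nat 2 (\<lambda>_ a. a + min (lookup z a) d + 1) i \<le> 2 + i * (d + 1)" for z i
    by (induction i) auto
  have h: "small w G (\<lambda>s. 2 + j s * (d + 1))"
    by (intro small_add small_mult small_const cheapD(2)[OF j])
  have "evals w G (\<lambda>s. clause_start d (w s) (j s))"
    unfolding clause_start_def
  proof (rule evals_iter[OF cheapD[OF j] evals_const _ h])
    show "evals (lift w) (ext G) (\<lambda>t. snd (snd t) + min (lookup (w (fst t)) (snd (snd t))) d + 1)"
      by (intro evals_add evals_min evals_lookup evals_const evals_new)
    fix s i assume "i \<le> j s"
    then have "2 + i * (d + 1) \<le> 2 + j s * (d + 1)" by (intro add_left_mono mult_le_mono1)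
    then show "rec_nat 2 (\<lambda>_ a. a + min (lookup (w s) a) d + 1) i \<le> 2 + j s * (d + 1)"
      using le[of "w s" i] by linarith
  qed
  then show ?thesis by (rule cheap_le[OF _ _ h]) (use le in \<open>simp add: clause_start_def\<close>)
qed

lemma evals_var_at: "evals w G p \<Longrightarrow> evals w G (\<lambda>s. var_at (w s) (p s))"
  unfolding var_at_def by (intro evals_div evals_lookup evals_const)

lemma cheap_digit:
  assumes "evals w G b" "cheap w G e" "cheap w G t"
  shows "cheap w G (\<lambda>s. digit (b s) (e s) (t s))"
proof (rule cheap_le)
  show "evals w G (\<lambda>s. digit (b s) (e s) (t s))"
    unfolding digit_def by (intro evals_mod evals_div_power assms cheapD)
  show "digit (b s) (e s) (t s) \<le> t s" for s
    unfolding digit_def by (meson div_le_dividend mod_less_eq_dividend order_trans)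
qed (rule cheapD(2)[OF assms(3)])

lemma cheap_gap: "cheap w G t \<Longrightarrow> cheap w G r \<Longrightarrow> cheap w G (\<lambda>s. gap (w s) (t s) (r s))"
  unfolding gap_def by (intro cheap_digit evals_add evals_const cheapD(1)[OF cheap_weight])

lemma cheap_lower: "cheap w G c \<Longrightarrow> cheap w G r \<Longrightarrow> cheap w G (\<lambda>s. lower (w s) (c s) (r s))"
  unfolding lower_def by (intro cheap_digit evals_length cheap_mult cheap_const)

lemma cheap_upper: "cheap w G c \<Longrightarrow> cheap w G r \<Longrightarrow> cheap w G (\<lambda>s. upper (w s) (c s) (r s))"
  unfolding upper_def by (intro cheap_digit evals_length cheap_add cheap_mult cheap_const)

lemma tests_if:
  assumes "tests w G P" "tests w G Q" "tests w G R"
  shows "tests w G (\<lambda>s. if P s then Q s else R s)"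
proof -
  have "(if P s then of_bool (Q s) else of_bool (R s)) = (of_bool (if P s then Q s else R s) :: nat)" for s
    by simp
  with evals_if[OF assms] show ?thesis by (simp only:)
qed

lemma tests_neq: "evals w G f \<Longrightarrow> evals w G g \<Longrightarrow> tests w G (\<lambda>s. f s \<noteq> g s)"
  by (intro tests_not tests_eq)

lemma tests_falsified:
  assumes "cheap w G t" "cheap w G c" "cheap w G j" "cheap w G r"
  shows "tests w G (\<lambda>s. falsified d (w s) (t s) (c s) (j s) (r s))"
  unfolding falsified_def
  by (intro tests_if tests_conj tests_disj tests_neq tests_even tests_eq tests_less evals_var_at evals_lookup
      cheapD(1)[OF cheap_gap] cheapD(1)[OF cheap_lower] cheapD(1)[OF cheap_upper] cheapD(1)[OF cheap_weight]
      cheapD(1)[OF cheap_clause_start] evals_add evals_const assms cheapD(1)[OF assms(4)])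

lemma tests_consistent:
  assumes t: "cheap w G t" and c: "cheap w G c"
  shows "tests w G (\<lambda>s. consistent d (w s) (t s) (c s))"
proof -
  \<comment> \<open>Two nested loops: \<open>fst (snd (fst x))\<close> is the outer counter, the
    clause, and \<open>fst (snd x)\<close> the inner one, the literal.\<close>
  have falsified: "tests (lift (lift w)) (ext (ext G))
      (\<lambda>x. falsified d (w (fst (fst x))) (t (fst (fst x))) (c (fst (fst x))) (fst (snd (fst x))) (fst (snd x)))"
    by (rule tests_falsified) (rule cheap_lift[OF cheap_lift[OF t]] cheap_lift[OF cheap_lift[OF c]] cheap_lift[OF cheap_new(1)] cheap_new)+
  have len: "evals (lift (lift w)) (ext (ext G)) (\<lambda>x. lookup (w (fst (fst x))) (clause_start d (w (fst (fst x))) (fst (snd (fst x)))))"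
    by (rule evals_lookup[where w="lift (lift w)"], rule cheapD(1)[OF cheap_clause_start[where w="lift (lift w)"]],
        rule cheap_lift[OF cheap_new(1)])
  have "tests (lift w) (ext G) (\<lambda>x. \<exists>r<d. r < lookup (w (fst x)) (clause_start d (w (fst x)) (fst (snd x))) \<and>
      \<not> falsified d (w (fst x)) (t (fst x)) (c (fst x)) (fst (snd x)) r)"
    by (rule tests_ex[OF evals_const small_const])
      (intro tests_conj tests_not tests_less falsified len evals_new)
  then have "tests w G (\<lambda>s. \<forall>j<clause_count (w s). \<exists>r<d. r < lookup (w s) (clause_start d (w s) j) \<and>
      \<not> falsified d (w s) (t s) (c s) j r)"
    by (rule tests_all[OF cheapD[OF cheap_clause_count]])
  then show ?thesis
    unfolding consistent_def
    by (intro tests_conj tests_imp tests_less evals_var_at evals_const cheapD(1)[OF cheap_gap] cheapD(1)[OF cheap_lower]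
        cheapD(1)[OF cheap_upper] cheapD(1)[OF cheap_weight] cheap_const t c)
qed

lemma tests_lit_pos:
  assumes p: "evals w G p"
  shows "tests w G (\<lambda>s. lit_pos d (w s) (p s))"
proof -
  have start: "cheap (lift (lift w)) (ext (ext G)) (\<lambda>x. clause_start d (w (fst (fst x))) (fst (snd (fst x))))"
    by (rule cheap_clause_start[where w="lift (lift w)"], rule cheap_lift[OF cheap_new(1)])
  have "tests (lift w) (ext G) (\<lambda>x. \<exists>r<d. r < lookup (w (fst x)) (clause_start d (w (fst x)) (fst (snd x))) \<and>
      p (fst x) = clause_start d (w (fst x)) (fst (snd x)) + 1 + r)"
    by (rule tests_ex[OF evals_const small_const])
      (intro tests_conj tests_less tests_eq evals_add evals_const cheapD(1)[OF start] evals_new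
        evals_lift[OF evals_lift[OF p]] evals_lookup[where w="lift (lift w)"])
  then show ?thesis
    unfolding lit_pos_def by (rule tests_ex[OF cheapD[OF cheap_clause_count]])
qed

lemma tests_well_formed: "tests w G (\<lambda>s. well_formed d (w s))"
proof -
  have start: "cheap (lift w) (ext G) (\<lambda>x. clause_start d (w (fst x)) (fst (snd x)))"
    by (rule cheap_clause_start[where w="lift w"], rule cheap_new)
  have "tests w G (\<lambda>s. \<forall>j<clause_count (w s). lookup (w s) (clause_start d (w s) j) \<le> d)"
    by (rule tests_all[OF cheapD[OF cheap_clause_count]])
      (intro tests_le evals_const evals_lookup[where w="lift w"] cheapD(1)[OF start])
  then show ?thesis
    unfolding well_formed_def
    by (intro tests_conj tests_le tests_eq evals_const evals_length evals_lookup cheapD(1)[OF cheap_clause_start] cheap_clause_count)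
qed

lemma cheap_slots: "cheap w G (\<lambda>s. slots d (w s))"
  unfolding slots_def by (intro cheap_add cheap_power cheap_const cheap_weight)

lemma cheap_option_count: "cheap w G (\<lambda>s. option_count d (w s))"
  unfolding option_count_def by (intro cheap_power cheap_length)

lemma tests_valid_option:
  assumes i: "cheap w G i" and j: "cheap w G j"
  shows "tests w G (\<lambda>s. valid_option d (w s) (i s) (j s))"
  unfolding valid_option_def
  by (intro tests_if tests_conj tests_less tests_lit_pos tests_consistent evals_length cheap_diff cheap_weight i j
      cheapD(1)[OF i] cheapD(1)[OF j] cheapD(1)[OF cheap_weight])

lemma tests_demands:
  assumes i: "cheap w G i" and j: "cheap w G j" and i': "cheap w G i'" and j': "cheap w G j'"
  shows "tests w G (\<lambda>s. demands d (w s) (i s) (j s) (i' s) (j' s))"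
proof -
  have "cheap (lift w) (ext G) (\<lambda>x. gap (w (fst x)) (i (fst x) - weight (w (fst x))) (fst (snd x)))"
    by (rule cheap_gap[where w="lift w"]) (rule cheap_new cheap_diff cheap_lift[OF i] cheap_weight[where w="lift w"])+
  moreover have "cheap (lift w) (ext G) (\<lambda>x. lower (w (fst x)) (j (fst x)) (fst (snd x)))"
    by (rule cheap_lower[where w="lift w"]) (rule cheap_new cheap_lift[OF j])+
  moreover have "cheap (lift w) (ext G) (\<lambda>x. upper (w (fst x)) (j (fst x)) (fst (snd x)))"
    by (rule cheap_upper[where w="lift w"]) (rule cheap_new cheap_lift[OF j])+
  ultimately have "tests (lift w) (ext G) (\<lambda>x.
      i' (fst x) + 1 = gap (w (fst x)) (i (fst x) - weight (w (fst x))) (fst (snd x)) \<and>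
        j' (fst x) = lower (w (fst x)) (j (fst x)) (fst (snd x)) \<or>
      i' (fst x) = gap (w (fst x)) (i (fst x) - weight (w (fst x))) (fst (snd x)) \<and>
        j' (fst x) = upper (w (fst x)) (j (fst x)) (fst (snd x)))"
    by (intro tests_disj tests_conj tests_eq evals_add evals_const evals_lift[OF cheapD(1)[OF i']]
        evals_lift[OF cheapD(1)[OF j']] cheapD(1))
  then have "tests w G (\<lambda>s. \<exists>r<d. i' s + 1 = gap (w s) (i s - weight (w s)) r \<and> j' s = lower (w s) (j s) r \<or>
      i' s = gap (w s) (i s - weight (w s)) r \<and> j' s = upper (w s) (j s) r)"
    by (rule tests_ex[OF evals_const small_const])
  then show ?thesis
    unfolding demands_def
    by (intro tests_conj tests_less tests_le cheapD(1)[OF i] cheapD(1)[OF i'] cheapD(1)[OF cheap_weight])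
qed

lemma cheap_side_size: "cheap w G K \<Longrightarrow> cheap w G N \<Longrightarrow> cheap w G (\<lambda>s. side_size (K s) (N s))"
  unfolding side_size_def by (intro cheap_add cheap_mult cheap_const)

lemma cheap_slot_of: "cheap w G K \<Longrightarrow> cheap w G N \<Longrightarrow> cheap w G v \<Longrightarrow> cheap w G (\<lambda>s. slot_of (K s) (N s) (v s))"
  unfolding slot_of_def by (intro cheap_diff cheap_div cheap_add cheap_const)

lemma cheap_option_of: "cheap w G K \<Longrightarrow> cheap w G N \<Longrightarrow> cheap w G v \<Longrightarrow> cheap w G (\<lambda>s. option_of (K s) (N s) (v s))"
  unfolding option_of_def by (intro cheap_diff cheap_mod cheap_add cheap_const)

lemma tests_acceptable:
  assumes u: "cheap w G u" and v: "cheap w G v"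
  shows "tests w G (\<lambda>s. acceptable (slots d (w s)) (option_count d (w s)) (valid_option d (w s)) (demands d (w s)) (u s) (v s))"
  unfolding acceptable_def
  by (intro tests_if tests_conj tests_disj tests_le tests_eq tests_valid_option tests_demands cheap_slot_of cheap_option_of cheap_slots
      cheap_option_count evals_add evals_const u v cheapD(1)[OF u] cheapD(1)[OF v] cheapD(1)[OF cheap_slots] cheapD(1)[OF cheap_slot_of])

lemma evals_agent_rank:
  assumes a: "cheap w G a" and b: "cheap w G b"
  shows "evals w G (\<lambda>s. agent_rank (slots d (w s)) (option_count d (w s)) (valid_option d (w s)) (demands d (w s)) (a s) (b s))"
  unfolding agent_rank_def man_rank_def woman_rank_def
  by (intro evals_if tests_le tests_less tests_eq tests_acceptable cheap_diff evals_diff cheap_side_size cheap_slots cheap_option_count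
      evals_add evals_const a b cheapD(1)[OF a] cheapD(1)[OF b] cheapD(1)[OF cheap_side_size] cheapD(1)[OF cheap_slots])

section \<open>The encoded instance\<close>

definition word_side :: "nat \<Rightarrow> word \<Rightarrow> nat" where "word_side d z = side_size (slots d z) (option_count d z)"

definition word_rank :: "nat \<Rightarrow> word \<Rightarrow> nat \<Rightarrow> nat \<Rightarrow> nat" where
  "word_rank d z = agent_rank (slots d z) (option_count d z) (valid_option d z) (demands d z)"

lemma cheap_word_side: "cheap w G (\<lambda>s. word_side d (w s))"
  unfolding word_side_def by (intro cheap_side_size cheap_slots cheap_option_count)

lemma evals_word_rank: "cheap w G a \<Longrightarrow> cheap w G b \<Longrightarrow> evals w G (\<lambda>s. word_rank d (w s) (a s) (b s))"
  unfolding word_rank_def by (rule evals_agent_rank)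

definition instance_word :: "bool \<Rightarrow> nat \<Rightarrow> word \<Rightarrow> word" where
  "instance_word b d z = (let n = word_side d z; K = slots d z in
     encode_adapt n n (word_rank d z) (map (\<lambda>u. (u, n + u)) [0..<n])
       (if b then [(0, n + K)] else []) (if b then [] else [(K, n + K)]) (4 * K + 2))"

text \<open>The parameter consists of one tie per slot and the budget
  \<open>4 * slots d z + 2\<close>. The word \<open>[0]\<close> is parameter 0 followed by the empty
  word, which encodes no instance.\<close>

definition reduction :: "bool \<Rightarrow> nat \<Rightarrow> word \<Rightarrow> word" where
  "reduction b d z = (if well_formed d z then (5 * slots d z + 2) # instance_word b d z else [0])"

lemma emits_reduction: "emits (\<lambda>z. z) [] (reduction b d)"
proof -
  let ?n = "word_side d" and ?K = "slots d"
  have n2: "cheap w G (\<lambda>s. word_side d (w s) + word_side d (w s))" for w :: "'s \<Rightarrow> word" and G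
    by (intro cheap_add cheap_word_side)
  have rows: "emits (\<lambda>z. z) [] (\<lambda>z. concat (map (\<lambda>a. map (word_rank d z a) [0..<?n z + ?n z]) [0..<?n z + ?n z]))"
  proof (rule emits_concat_map[OF cheapD[OF n2[of "\<lambda>z. z"]]])
    show "emits fst (ext []) (\<lambda>t. map (word_rank d (fst t) (fst (snd t))) [0..<?n (fst t) + ?n (fst t)])"
    proof (rule emits_map[OF cheapD[OF n2[of fst]]])
      show "evals (lift fst) (ext (ext [])) (\<lambda>t. word_rank d (fst (fst t)) (fst (snd (fst t))) (fst (snd t)))"
        by (rule evals_word_rank[where w="lift fst"]) (rule cheap_lift[OF cheap_new(1)] cheap_new)+
    qed
  qed
  have start: "emits (\<lambda>z. z) [] (\<lambda>z. concat (map (\<lambda>u. [u] @ [?n z + u]) [0..<?n z]))"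
  proof (rule emits_concat_map[OF cheapD[OF cheap_word_side[of "\<lambda>z. z"]]])
    show "emits fst (ext []) (\<lambda>t. [fst (snd t)] @ [?n (fst t) + fst (snd t)])"
      by (intro emits_append emits_emit evals_add evals_new cheapD(1)[OF cheap_word_side[of fst]])
  qed
  have n: "evals (\<lambda>z. z) [] ?n" and K: "evals (\<lambda>z. z) [] ?K"
    using cheapD(1)[OF cheap_word_side[of "\<lambda>z. z"]] cheapD(1)[OF cheap_slots[of "\<lambda>z. z"]] by auto
  have "reduction b d = (\<lambda>z. if well_formed d z then [5 * ?K z + 2] @ [?n z] @ [?n z] @
      concat (map (\<lambda>a. map (word_rank d z a) [0..<?n z + ?n z]) [0..<?n z + ?n z]) @
      [?n z] @ concat (map (\<lambda>u. [u] @ [?n z + u]) [0..<?n z]) @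
      (if b then [1] @ [0] @ [?n z + ?K z] @ [0] else [0] @ [1] @ [?K z] @ [?n z + ?K z]) @
      [4 * ?K z + 2] else [0])"
    by (rule ext) (simp add: reduction_def instance_word_def Let_def encode_adapt_def encode_pairs_def comp_def)
  moreover have "emits (\<lambda>z. z) [] \<dots>"
    by (cases b; simp only: if_True if_False)
      (intro emits_if tests_well_formed[of "\<lambda>z. z"] emits_append emits_emit evals_add evals_mult evals_const n K rows start)+
  ultimately show ?thesis by simp
qed

lemma encode_pairs_append_inject:
  assumes "encode_pairs ps @ ys = encode_pairs ps' @ ys'"
  shows "ps = ps' \<and> ys = ys'"
proof -
  let ?c = "\<lambda>ps. concat (map (\<lambda>(a, b). [a, b]) ps) :: word"
  have "?c ps @ ys = ?c ps' @ ys' \<Longrightarrow> length ps = length ps' \<Longrightarrow> ps = ps' \<and> ys = ys'"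
  proof (induction ps arbitrary: ps')
    case Nil
    then show ?case by simp
  next
    case (Cons p ps)
    then obtain p' qs where "ps' = p' # qs" by (cases ps') auto
    then show ?case using Cons by (cases p; cases p') auto
  qed
  then show ?thesis using assms by (simp add: encode_pairs_def)
qed

text \<open>Membership in the target problem speaks of some instance with the given code, so the
  code must determine everything that stability depends on.\<close>

lemma encode_adapt_inject:
  assumes "encode_adapt nU nW r ms qs ps k = encode_adapt nU' nW' r' ms' qs' ps' k'"
  shows "nU = nU'" "nW = nW'" "ms = ms'" "qs = qs'" "ps = ps'" "k = k'"
    "a < nU + nW \<Longrightarrow> b < nU + nW \<Longrightarrow> r a b = r' a b"
proof -
  show n: "nU = nU'" "nW = nW'" using assms by (simp_all add: encode_adapt_def)
  let ?xs = "[0..<nU + nW]"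
  let ?rows = "\<lambda>r. map (\<lambda>a. map (r a) ?xs) ?xs"
  have eq: "concat (?rows r) @ encode_pairs ms @ encode_pairs qs @ encode_pairs ps @ [k] =
      concat (?rows r') @ encode_pairs ms' @ encode_pairs qs' @ encode_pairs ps' @ [k']"
    using assms unfolding encode_adapt_def n by simp
  have "length (concat (?rows r)) = length (concat (?rows r'))"
    by (simp add: length_concat comp_def)
  then have rows: "concat (?rows r) = concat (?rows r')"
    and rest: "encode_pairs ms @ encode_pairs qs @ encode_pairs ps @ [k] =
      encode_pairs ms' @ encode_pairs qs' @ encode_pairs ps' @ [k']"
    using eq append_eq_append_conv by blast+
  have "?rows r = ?rows r'"
  proof (rule concat_injective[OF rows])
    show "\<forall>(x, y)\<in>set (zip (?rows r) (?rows r')). length x = length y"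
      by (auto simp: set_zip)
  qed simp
  then have "map (r a) ?xs = map (r' a) ?xs" if "a < nU + nW" for a using that by (simp add: map_eq_conv)
  then show "a < nU + nW \<Longrightarrow> b < nU + nW \<Longrightarrow> r a b = r' a b" by (simp add: map_eq_conv)
  have 1: "ms = ms' \<and> encode_pairs qs @ encode_pairs ps @ [k] = encode_pairs qs' @ encode_pairs ps' @ [k']"
    by (rule encode_pairs_append_inject[OF rest])
  then have 2: "qs = qs' \<and> encode_pairs ps @ [k] = encode_pairs ps' @ [k']"
    using encode_pairs_append_inject by blast
  then have 3: "ps = ps' \<and> [k] = [k']" using encode_pairs_append_inject by blast
  show "ms = ms'" "qs = qs'" "ps = ps'" "k = k'" using 1 2 3 by simp_all
qed

section \<open>Correctness of the reduction\<close>

lemma gadget_slots: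
  assumes "1 \<le> d" "well_formed d z"
  shows "gadget (slots d z) (option_count d z) (weight z) (demands d z)"
proof
  show "1 \<le> slots d z" by (simp add: slots_def trans_le_add2)
  have "2 \<le> length z" using assms(2) by (simp add: well_formed_def)
  also have "\<dots> = length z ^ 1" by simp
  also have "\<dots> \<le> option_count d z"
    unfolding option_count_def using assms \<open>2 \<le> length z\<close> by (intro power_increasing) auto
  finally show "2 \<le> option_count d z" .
qed (auto simp: demands_def)

definition forced_pairs :: "bool \<Rightarrow> nat \<Rightarrow> nat \<Rightarrow> (nat \<times> nat) list" where
  "forced_pairs b n K = (if b then [(0, n + K)] else [])"

definition forbidden_pairs :: "bool \<Rightarrow> nat \<Rightarrow> nat \<Rightarrow> (nat \<times> nat) list" where
  "forbidden_pairs b n K = (if b then [] else [(K, n + K)])"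

lemma adapt_weakly_smtI:
  assumes "encodes_adapt x I" "valid_adapt I" "R I" "solvable_adapt I" "num_ties I + budget I = p"
  shows "(x, p) \<in> adapt_weakly_smt R"
  unfolding adapt_weakly_smt_def using assms by (intro CollectI exI[of _ x] exI[of _ I]) simp

text \<open>\<open>R\<close> stands for any restriction that the constructed instances satisfy, so
  one proof serves all the restricted problems; \<open>b\<close> selects a forced or a forbidden
  pair.\<close>

lemma instance_word_iff:
  assumes d: "1 \<le> d" and ok: "well_formed d (k # x)"
    and R: "\<And>I. one_sided_ties I \<Longrightarrow>
      (if b then card (forced I) = 1 \<and> forbidden I = {} else forced I = {} \<and> card (forbidden I) = 1) \<Longrightarrow> R I"
  shows "(instance_word b d (k # x), 5 * slots d (k # x) + 2) \<in> adapt_weakly_smt R \<longleftrightarrow>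
    (x, k) \<in> weighted_sat d"
proof -
  let ?z = "k # x"
  let ?K = "slots d ?z" and ?n = "word_side d ?z"
  let ?ms = "map (\<lambda>u. (u, ?n + u)) [0..<?n]"
  let ?qs = "forced_pairs b ?n ?K" and ?ps = "forbidden_pairs b ?n ?K"
  let ?I = "\<lambda>r. adapt_of_ranks ?n ?n r ?ms ?qs ?ps (4 * ?K + 2)"
  interpret gadget ?K "option_count d ?z" "weight ?z" "valid_option d ?z" "demands d ?z" by (rule gadget_slots[OF d ok])
  have kK: "weight ?z \<le> ?K" by (simp add: slots_def)
  have inst: "gadget_instance ?K (option_count d ?z) (weight ?z) (valid_option d ?z) (demands d ?z) r ?ms ?qs ?ps (4 * ?K + 2) (?I r)"
    if "\<And>a b. a < ?n + ?n \<Longrightarrow> b < ?n + ?n \<Longrightarrow> r a b = word_rank d ?z a b" for r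
    by unfold_locales (use that in \<open>simp_all add: word_side_def word_rank_def\<close>)
  have pairs: "?qs = [(0, side + ?K)] \<and> ?ps = [] \<or> ?qs = [] \<and> ?ps = [(?K, side + ?K)]"
    by (simp add: forced_pairs_def forbidden_pairs_def word_side_def)
  have word: "instance_word b d ?z = encode_adapt ?n ?n (word_rank d ?z) ?ms ?qs ?ps (4 * ?K + 2)"
    by (simp add: instance_word_def Let_def forced_pairs_def forbidden_pairs_def)
  have ms: "?ms = map (\<lambda>u. (u, side + u)) [0..<side]" by (simp add: word_side_def)
  have sol: "solution = choice d ?z"
    by (rule ext) (simp add: solution_def choice_def)
  have "(x, k) \<in> weighted_sat d \<longleftrightarrow> (\<exists>\<sigma>. solution \<sigma>)"
    unfolding sol by (rule weighted_sat_iff_choice[OF d ok])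
  also have "\<dots> \<longleftrightarrow> (instance_word b d ?z, 5 * ?K + 2) \<in> adapt_weakly_smt R"
  proof
    assume "\<exists>\<sigma>. solution \<sigma>"
    then obtain \<sigma> where \<sigma>: "solution \<sigma>" by blast
    let ?J = "?I (word_rank d ?z)"
    interpret J: gadget_instance ?K "option_count d ?z" "weight ?z" "valid_option d ?z" "demands d ?z" "word_rank d ?z" ?ms ?qs ?ps
      "4 * ?K + 2" ?J by (rule inst) (rule refl)
    have lt: "0 < side" "?K < side" by (simp_all add: side_def)
    have valid: "valid_adapt ?J"
      by (rule J.valid_adapt_I[OF ms]) (use lt pairs in auto)
    have solv: "solvable_adapt ?J"
      by (rule J.solvable_of_solution[OF \<sigma> kK ms refl pairs])
    have RJ: "R ?J"
      by (rule R[OF J.one_sided_I]) (simp add: adapt_of_ranks_def forced_pairs_def forbidden_pairs_def)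
    have enc: "encodes_adapt (instance_word b d ?z) ?J"
      unfolding encodes_adapt_def word by blast
    have param: "num_ties ?J + budget ?J = 5 * ?K + 2"
      unfolding J.num_ties_I by (simp add: adapt_of_ranks_def)
    show "(instance_word b d ?z, 5 * ?K + 2) \<in> adapt_weakly_smt R"
      by (rule adapt_weakly_smtI[where R=R, OF enc valid RJ solv param])
  next
    assume "(instance_word b d ?z, 5 * ?K + 2) \<in> adapt_weakly_smt R"
    then obtain I where I: "encodes_adapt (instance_word b d ?z) I" "solvable_adapt I"
      unfolding adapt_weakly_smt_def by blast
    from I(1) obtain nU nW r ms qs ps k' where
      enc: "encode_adapt ?n ?n (word_rank d ?z) ?ms ?qs ?ps (4 * ?K + 2) = encode_adapt nU nW r ms qs ps k'"
      and I': "I = adapt_of_ranks nU nW r ms qs ps k'"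
      unfolding encodes_adapt_def word by blast
    \<comment> \<open>The decoded instance may differ from the constructed one in ranks outside the
      agents, which \<open>gadget_instance\<close> allows.\<close>
    have "I = ?I r" unfolding I' using encode_adapt_inject(1-6)[OF enc] by simp
    moreover have "r a b = word_rank d ?z a b" if "a < ?n + ?n" "b < ?n + ?n" for a b
      using encode_adapt_inject(7)[OF enc that] by simp
    ultimately interpret J: gadget_instance ?K "option_count d ?z" "weight ?z" "valid_option d ?z" "demands d ?z" r ?ms ?qs ?ps
      "4 * ?K + 2" I using inst by simp
    show "\<exists>\<sigma>. solution \<sigma>" by (rule J.solution_of_solvable[OF I(2) kK pairs])
  qed
  finally show ?thesis by simp
qed

lemma fpt_reducible_weighted_sat:
  assumes d: "1 \<le> d" and L: "fpt_reducible L (weighted_sat d)"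
    and R: "\<And>I. one_sided_ties I \<Longrightarrow>
      (if b then card (forced I) = 1 \<and> forbidden I = {} else forced I = {} \<and> card (forbidden I) = 1) \<Longrightarrow> R I"
  shows "fpt_reducible L (adapt_weakly_smt R)"
proof (rule fpt_reducible_emits[OF L emits_reduction[of b d]])
  let ?h = "\<lambda>k::nat. 5 * (k + (k + 1) ^ d) + 2"
  show "polynomial ?h"
    by (intro polynomial_add polynomial_mult polynomial_power polynomial_id polynomial_const)
  show mono: "mono ?h"
    by (intro monoI add_mono mult_left_mono power_mono) auto
  fix x :: word and k :: nat
  let ?z = "k # x"
  show "\<exists>x' k'. reduction b d ?z = k' # x' \<and> k' \<le> ?h k \<and>
      ((x, k) \<in> weighted_sat d \<longleftrightarrow> (x', k') \<in> adapt_weakly_smt R)"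
  proof (cases "well_formed d ?z")
    case True
    have "weight ?z \<le> k" by (simp add: weight_def lookup_def)
    then have "5 * slots d ?z + 2 \<le> ?h k"
      using monoD[OF mono, of "weight ?z" k] by (simp add: slots_def)
    then show ?thesis
      using True instance_word_iff[of d k x b R, OF d True R] by (simp add: reduction_def)
  next
    case False
    have "\<not> encodes_adapt [] I" for I by (simp add: encodes_adapt_def encode_adapt_def)
    then have "([], 0) \<notin> adapt_weakly_smt R" unfolding adapt_weakly_smt_def by blast
    then show ?thesis
      using False weighted_sat_imp_well_formed[of x k d] by (auto simp: reduction_def)
  qed
qed

theorem proposition2:
  shows "W1_hard (adapt_weakly_smt one_sided_ties) \<and>
         W1_hard (adapt_weakly_smt
           (\<lambda>I. one_sided_ties I \<and> card (forced I) = 1 \<and> forbidden I = {})) \<and>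
         W1_hard (adapt_weakly_smt
           (\<lambda>I. one_sided_ties I \<and> forced I = {} \<and> card (forbidden I) = 1))"
proof -
  have hard: "W1_hard (adapt_weakly_smt R)"
    if "\<And>I. one_sided_ties I \<Longrightarrow> (if b then card (forced I) = 1 \<and> forbidden I = {}
      else forced I = {} \<and> card (forbidden I) = 1) \<Longrightarrow> R I" for b R
    unfolding W1_hard_def
  proof
    fix L assume "L \<in> W1"
    then obtain d where d: "1 \<le> d" "fpt_reducible L (weighted_sat d)" unfolding W1_def by blast
    show "fpt_reducible L (adapt_weakly_smt R)"
      by (rule fpt_reducible_weighted_sat[where b=b, OF d]) (rule that)
  qed
  show ?thesis
  proof (intro conjI)
    \<comment> \<open>Either kind of pair would serve for the problem without restriction on pairs;
      the forced one is taken.\<close>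
    show "W1_hard (adapt_weakly_smt one_sided_ties)" by (rule hard[of True])
  qed (rule hard[of True] hard[of False]; simp)+
qed

end
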